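(* Let $\Sigma$ be a complete simplicial (not necessarily rational) fan in $\mathbb R^n$ with $m$ one-dimensional cones (some of which may be empty), and let $\mathcal K=\mathcal K_\Sigma$ be its underlying simplicial complex on $[m]$. Assume that $m-n=2\ell$ is even, let $\Psi\colon\mathbb C^\ell\to\mathbb C^m$ be a $\mathbb C$-linear map such that $\mathrm{Re}\circ\Psi\colon\mathbb C^\ell\to\mathbb R^m$ is injective and $\Lambda_{\mathbb R}\circ\mathrm{Re}\circ\Psi=0$, and let $C_{\Psi,\Sigma}=\exp\Psi(\mathbb C^\ell)\subset(\mathbb C^\times)^m$. Then: (a) the holomorphic action of the group $C_{\Psi,\Sigma}$ on $U(\mathcal K)$ by coordinatewise multiplication is free and proper, and the quotient $U(\mathcal K)/C_{\Psi,\Sigma}$ has a structure of a compact complex manifold of complex dimension $m-\ell$; (b) there is a $\mathbb T^m$-equivariant diffeomorphism between $U(\mathcal K)/C_{\Psi,\Sigma}$ and $\mathcal Z_{\mathcal K}$ defining a complex structure on $\mathcal Z_{\mathcal K}$, in which $\mathbb T^m$ acts by holomorphic transformations.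
   Context: A fan in $\mathbb R^n$ is a finite collection of strongly convex polyhedral cones closed under taking faces and such that any two cones intersect in a common face. It is complete if the cones cover $\mathbb R^n$, and simplicial if each cone is generated by part of a basis of $\mathbb R^n$. Let $\boldsymbol a_1,\ldots,\boldsymbol a_m$ be chosen generators of the one-dimensional cones. One is allowed to formally add 'empty' one-dimensional cones (for instance to make $m-n$ even): for such an index $i$ one sets $\boldsymbol a_i=0$, and $i$ is a ghost vertex, i.e. no simplex of $\mathcal K_\Sigma$ contains $i$. The complex $\mathcal K_\Sigma$ on $[m]=\{1,\ldots,m\}$ consists of all sets $I$ of indices of nonempty one-dimensional cones such that $\{\boldsymbol a_i:i\in I\}$ spans a cone of $\Sigma$ (including $I=\varnothing$). For $W\subset X$ put $(X,W)^{\mathcal K}=\bigcup_{I\in\mathcal K}\{(x_1,\ldots,x_m)\in X^m:x_j\in W\text{ for }j\notin I\}$. Then $\mathcal Z_{\mathcal K}=(\mathbb D,\mathbb T)^{\mathcal K}$ ($\mathbb D$ the closed unit disc and $\mathbb T$ the unit circle in $\mathbb C$) is the moment-angle complex, and $U(\mathcal K)=(\mathbb C,\mathbb C^\times)^{\mathcal K}\subset\mathbb C^m$. The torus $\mathbb T^m$ acts coordinatewise. $\Lambda_{\mathbb R}\colon\mathbb R^m\to\mathbb R^n$ is the linear map $\boldsymbol e_i\mapsto\boldsymbol a_i$, $\mathrm{Re}\colon\mathbb C^m\to\mathbb R^m$ is the coordinatewise real part, and $\exp\colon\mathbb C^m\to(\mathbb C^\times)^m$ is the componentwise exponential. Smooth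 structure on $\mathcal Z_{\mathcal K}$: let $R_\Sigma=\exp(\operatorname{Ker}\Lambda_{\mathbb R})\subset\mathbb R^m_>$ (componentwise exponential), acting on $U(\mathcal K)$ by coordinatewise multiplication. This action is free and proper, every $R_\Sigma$-orbit meets $\mathcal Z_{\mathcal K}\subset U(\mathcal K)$ in exactly one point, and $\mathcal Z_{\mathcal K}$ carries the smooth structure transported from the smooth manifold $U(\mathcal K)/R_\Sigma$ by the resulting $\mathbb T^m$-equivariant homeomorphism. An action of $G$ on $X$ is proper if the map $G\times X\to X\times X$, $(g,x)\mapsto(gx,x)$, is proper. *)

theory Defs
  imports "HOL-Analysis.Analysis"
begin

section \<open>Fans\<close>

text \<open>
  The space $\mathbb{R}^n$ carrying the fan is an $n$-dimensional linear subspace \<open>N\<close> of a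
  Euclidean space. The case \<open>N = UNIV\<close> gives \<open>real ^ 'n\<close>; a subspace is used because Euclidean types
  have positive dimension, whereas $n = 0$ (the fan \<open>{{0}}\<close>, all indices ghosts, leading to complex
  tori) is a legitimate case.
\<close>

definition polyhedral_cone :: "'v::euclidean_space set \<Rightarrow> bool" where
  "polyhedral_cone \<sigma> \<longleftrightarrow> (\<exists>S. finite S \<and> \<sigma> = convex_cone hull S)"

definition strongly_convex :: "'v::euclidean_space set \<Rightarrow> bool" where
  "strongly_convex \<sigma> \<longleftrightarrow> \<sigma> \<inter> uminus ` \<sigma> = {0}"

text \<open>\<open>{}\<close> is a face in the sense of \<open>(face_of)\<close>, but not a cone.\<close>

definition fan :: "'v::euclidean_space set \<Rightarrow> 'v set set \<Rightarrow> bool" where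
  "fan N \<Sigma> \<longleftrightarrow>
     finite \<Sigma> \<and>
     (\<forall>\<sigma>\<in>\<Sigma>. \<sigma> \<subseteq> N \<and> polyhedral_cone \<sigma> \<and> strongly_convex \<sigma>) \<and>
     (\<forall>\<sigma>\<in>\<Sigma>. \<forall>\<tau>. \<tau> face_of \<sigma> \<and> \<tau> \<noteq> {} \<longrightarrow> \<tau> \<in> \<Sigma>) \<and>
     (\<forall>\<sigma>\<in>\<Sigma>. \<forall>\<tau>\<in>\<Sigma>. \<sigma> \<inter> \<tau> face_of \<sigma> \<and> \<sigma> \<inter> \<tau> face_of \<tau>)"

definition complete_fan :: "'v::euclidean_space set \<Rightarrow> 'v set set \<Rightarrow> bool" where
  "complete_fan N \<Sigma> \<longleftrightarrow> fan N \<Sigma> \<and> \<Union>\<Sigma> = N"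

definition simplicial_fan :: "'v::euclidean_space set \<Rightarrow> 'v set set \<Rightarrow> bool" where
  "simplicial_fan N \<Sigma> \<longleftrightarrow> fan N \<Sigma> \<and> (\<forall>\<sigma>\<in>\<Sigma>. \<exists>B. independent B \<and> \<sigma> = convex_cone hull B)"

text \<open>
  The index set $[m]$ is a finite type \<open>'m\<close>. The indices with \<open>a i \<noteq> 0\<close> enumerate the
  one-dimensional cones without repetition; those with \<open>a i = 0\<close> are the empty cones
  (ghost vertices).
\<close>

definition ray_generators :: "'v::euclidean_space set set \<Rightarrow> ('m::finite \<Rightarrow> 'v) \<Rightarrow> bool" where
  "ray_generators \<Sigma> a \<longleftrightarrow>
     bij_betw (\<lambda>i. convex_cone hull {a i}) {i. a i \<noteq> 0} {\<rho>\<in>\<Sigma>. dim \<rho> = 1}"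

definition fan_complex :: "'v::euclidean_space set set \<Rightarrow> ('m::finite \<Rightarrow> 'v) \<Rightarrow> 'm set set" where
  "fan_complex \<Sigma> a = {I. I \<subseteq> {i. a i \<noteq> 0} \<and> convex_cone hull (a ` I) \<in> \<Sigma>}"

definition Lambda_R :: "('m::finite \<Rightarrow> 'v::euclidean_space) \<Rightarrow> real ^ 'm \<Rightarrow> 'v" where
  "Lambda_R a x = (\<Sum>i\<in>UNIV. (x $ i) *\<^sub>R a i)"


section \<open>Polyhedral products and multiplicative groups\<close>

definition polyhedral_product ::
    "complex set \<Rightarrow> complex set \<Rightarrow> 'm::finite set set \<Rightarrow> (complex ^ 'm) set" where
  "polyhedral_product X W K =
     (\<Union>I\<in>K. {x. (\<forall>j. x $ j \<in> X) \<and> (\<forall>j. j \<notin> I \<longrightarrow> x $ j \<in> W)})"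

definition moment_angle_complex :: "'m::finite set set \<Rightarrow> (complex ^ 'm) set" where
  "moment_angle_complex K = polyhedral_product (cball 0 1) (sphere 0 1) K"

definition U_space :: "'m::finite set set \<Rightarrow> (complex ^ 'm) set" where
  "U_space K = polyhedral_product UNIV (- {0}) K"

definition compact_torus :: "(complex ^ 'm::finite) set" where
  "compact_torus = {t. \<forall>i. t $ i \<in> sphere 0 1}"

definition vexp :: "'a::{real_normed_field,banach} ^ 'm::finite \<Rightarrow> 'a ^ 'm" where
  "vexp x = (\<chi> i. exp (x $ i))"

definition Re_vec :: "complex ^ 'm::finite \<Rightarrow> real ^ 'm" where
  "Re_vec z = (\<chi> i. Re (z $ i))"

text \<open>
  $R_\Sigma$ is regarded as a subset of \<open>complex ^ 'm\<close>, so that, like $C_{\Psi,\Sigma}$ and the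
  torus, it acts by the coordinatewise product \<open>(*)\<close> of vectors.
\<close>

definition R_group :: "('m::finite \<Rightarrow> 'v::euclidean_space) \<Rightarrow> (complex ^ 'm) set" where
  "R_group a = (\<lambda>r. \<chi> i. complex_of_real (r $ i)) ` vexp ` {x. Lambda_R a x = 0}"

definition C_group :: "(complex ^ 'l::finite \<Rightarrow> complex ^ 'm::finite) \<Rightarrow> (complex ^ 'm) set" where
  "C_group \<Psi> = vexp ` range \<Psi>"

definition mult_group_action :: "(complex ^ 'm::finite) set \<Rightarrow> (complex ^ 'm) set \<Rightarrow> bool" where
  "mult_group_action G U \<longleftrightarrow>
     1 \<in> G \<and> (\<forall>g\<in>G. \<forall>h\<in>G. g * h \<in> G) \<and> (\<forall>g\<in>G. \<exists>h\<in>G. g * h = 1) \<and>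
     (\<forall>g\<in>G. \<forall>z\<in>U. g * z \<in> U)"

definition free_action :: "(complex ^ 'm::finite) set \<Rightarrow> (complex ^ 'm) set \<Rightarrow> bool" where
  "free_action G U \<longleftrightarrow> (\<forall>g\<in>G. \<forall>z\<in>U. g * z = z \<longrightarrow> g = 1)"

text \<open>Continuity is stated separately since it is not part of \<open>proper_map\<close>.\<close>

definition proper_action :: "(complex ^ 'm::finite) set \<Rightarrow> (complex ^ 'm) set \<Rightarrow> bool" where
  "proper_action G U \<longleftrightarrow>
     (let X = prod_topology (top_of_set G) (top_of_set U);
          Y = prod_topology (top_of_set U) (top_of_set U);
          f = (\<lambda>(g, z). (g * z, z))
      in continuous_map X Y f \<and> proper_map X Y f)"

definition orbit :: "(complex ^ 'm::finite) set \<Rightarrow> complex ^ 'm \<Rightarrow> (complex ^ 'm) set" where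
  "orbit G z = (\<lambda>g. g * z) ` G"

definition orbit_space ::
    "(complex ^ 'm::finite) set \<Rightarrow> (complex ^ 'm) set \<Rightarrow> (complex ^ 'm) set topology" where
  "orbit_space G U =
     topology (\<lambda>V. V \<subseteq> orbit G ` U \<and> openin (top_of_set U) {z \<in> U. orbit G z \<in> V})"

lemma openin_orbit_space:
  "openin (orbit_space G U) V \<longleftrightarrow>
     V \<subseteq> orbit G ` U \<and> openin (top_of_set U) {z \<in> U. orbit G z \<in> V}"
proof -
  have "istopology (\<lambda>V. V \<subseteq> orbit G ` U \<and> openin (top_of_set U) {z \<in> U. orbit G z \<in> V})"
    unfolding istopology_def
  proof (intro conjI allI impI)
    fix S T
    assume S: "S \<subseteq> orbit G ` U \<and> openin (top_of_set U) {z \<in> U. orbit G z \<in> S}"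
      and T: "T \<subseteq> orbit G ` U \<and> openin (top_of_set U) {z \<in> U. orbit G z \<in> T}"
    show "S \<inter> T \<subseteq> orbit G ` U" using S by blast
    have "{z \<in> U. orbit G z \<in> S \<inter> T} = {z \<in> U. orbit G z \<in> S} \<inter> {z \<in> U. orbit G z \<in> T}" by blast
    then show "openin (top_of_set U) {z \<in> U. orbit G z \<in> S \<inter> T}" using S T by (simp add: openin_Int)
  next
    fix \<K>
    assume K: "\<forall>S\<in>\<K>. S \<subseteq> orbit G ` U \<and> openin (top_of_set U) {z \<in> U. orbit G z \<in> S}"
    show "\<Union>\<K> \<subseteq> orbit G ` U" using K by blast
    have "{z \<in> U. orbit G z \<in> \<Union>\<K>} = (\<Union>S\<in>\<K>. {z \<in> U. orbit G z \<in> S})" by blast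
    then show "openin (top_of_set U) {z \<in> U. orbit G z \<in> \<Union>\<K>}" using K by (auto intro: openin_Union)
  qed
  then show ?thesis by (simp add: orbit_space_def topology_inverse')
qed

lemma topspace_orbit_space: "topspace (orbit_space G U) = orbit G ` U"
proof
  show "topspace (orbit_space G U) \<subseteq> orbit G ` U"
    by (auto simp: topspace_def openin_orbit_space)
  have "{z \<in> U. orbit G z \<in> orbit G ` U} = U" by blast
  then have "openin (orbit_space G U) (orbit G ` U)" by (simp add: openin_orbit_space)
  then show "orbit G ` U \<subseteq> topspace (orbit_space G U)" by (rule openin_subset)
qed


section \<open>Smooth and holomorphic maps on open sets\<close>

primrec times_differentiable_on ::
    "nat \<Rightarrow> 'e::real_normed_vector set \<Rightarrow> ('e \<Rightarrow> 'f::real_normed_vector) \<Rightarrow> bool" where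
  "times_differentiable_on 0 S f \<longleftrightarrow> continuous_on S f"
| "times_differentiable_on (Suc k) S f \<longleftrightarrow>
     (\<forall>x\<in>S. f differentiable (at x)) \<and>
     (\<forall>v. times_differentiable_on k S (\<lambda>x. frechet_derivative f (at x) v))"

text \<open>The next two notions are meant for open \<open>S\<close> only.\<close>

definition smooth_on :: "'e::euclidean_space set \<Rightarrow> ('e \<Rightarrow> 'f::euclidean_space) \<Rightarrow> bool" where
  "smooth_on S f \<longleftrightarrow> (\<forall>k. times_differentiable_on k S f)"

definition holo_on :: "(complex ^ 'a::finite) set \<Rightarrow> (complex ^ 'a \<Rightarrow> complex ^ 'b::finite) \<Rightarrow> bool" where
  "holo_on S f \<longleftrightarrow>
     (\<forall>x\<in>S. \<exists>D. (f has_derivative D) (at x) \<and> Vector_Spaces.linear (*s) (*s) D)"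

text \<open>
  The group $C_{\Psi,\Sigma}$ is a complex Lie group through the global coordinate
  $w \mapsto \exp\Psi(w)$; the action is holomorphic if it is jointly holomorphic in $w$ and $z$.
  The last clause is complex differentiability on the product $\mathbb{C}^\ell \times U$.
\<close>

definition holomorphic_action ::
    "(complex ^ 'l::finite \<Rightarrow> complex ^ 'm::finite) \<Rightarrow> (complex ^ 'm) set \<Rightarrow> bool" where
  "holomorphic_action \<Psi> U \<longleftrightarrow>
     open U \<and> mult_group_action (C_group \<Psi>) U \<and>
     homeomorphic_map euclidean (top_of_set (C_group \<Psi>)) (\<lambda>w. vexp (\<Psi> w)) \<and>
     (\<forall>w. \<forall>z\<in>U. \<exists>D. ((\<lambda>(w, z). vexp (\<Psi> w) * z) has_derivative D) (at (w, z)) \<and>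
        (\<forall>c h k. D (c *s h, c *s k) = c *s D (h, k)))"


section \<open>Manifolds\<close>

text \<open>
  A chart is a pair \<open>(V, \<phi>)\<close> with values in the Euclidean space \<open>'e\<close>, whose dimension is that of
  the manifold. The parameter \<open>reg\<close> is the regularity required of maps between open subsets
  of model spaces: \<open>smooth_on\<close> or \<open>holo_on\<close>.
\<close>

definition is_chart :: "'x topology \<Rightarrow> 'x set \<times> ('x \<Rightarrow> 'e::euclidean_space) \<Rightarrow> bool" where
  "is_chart X = (\<lambda>(V, \<phi>).
     openin X V \<and> open (\<phi> ` V) \<and>
     homeomorphic_map (subtopology X V) (top_of_set (\<phi> ` V)) \<phi>)"

definition is_manifold ::
    "('e::euclidean_space set \<Rightarrow> ('e \<Rightarrow> 'e) \<Rightarrow> bool) \<Rightarrow> 'x topology \<Rightarrow>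
     ('x set \<times> ('x \<Rightarrow> 'e)) set \<Rightarrow> bool" where
  "is_manifold reg X A \<longleftrightarrow>
     Hausdorff_space X \<and> second_countable X \<and>
     (\<forall>c\<in>A. is_chart X c) \<and> (\<Union>c\<in>A. fst c) = topspace X \<and>
     (\<forall>(V, \<phi>)\<in>A. \<forall>(W, \<psi>)\<in>A. reg (\<phi> ` (V \<inter> W)) (\<psi> \<circ> inv_into V \<phi>))"

definition manifold_map ::
    "('e::euclidean_space set \<Rightarrow> ('e \<Rightarrow> 'f::euclidean_space) \<Rightarrow> bool) \<Rightarrow>
     'x topology \<Rightarrow> ('x set \<times> ('x \<Rightarrow> 'e)) set \<Rightarrow>
     'y topology \<Rightarrow> ('y set \<times> ('y \<Rightarrow> 'f)) set \<Rightarrow> ('x \<Rightarrow> 'y) \<Rightarrow> bool" where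
  "manifold_map reg X A Y B f \<longleftrightarrow>
     continuous_map X Y f \<and>
     (\<forall>(V, \<phi>)\<in>A. \<forall>(W, \<psi>)\<in>B. reg (\<phi> ` {x \<in> V. f x \<in> W}) (\<psi> \<circ> f \<circ> inv_into V \<phi>))"

definition complex_manifold ::
    "'x topology \<Rightarrow> ('x set \<times> ('x \<Rightarrow> complex ^ 'k::finite)) set \<Rightarrow> bool" where
  "complex_manifold X A \<longleftrightarrow> is_manifold holo_on X A"

definition smooth_manifold ::
    "'x topology \<Rightarrow> ('x set \<times> ('x \<Rightarrow> 'e::euclidean_space)) set \<Rightarrow> bool" where
  "smooth_manifold X A \<longleftrightarrow> is_manifold smooth_on X A"

definition diffeomorphism ::
    "'x topology \<Rightarrow> ('x set \<times> ('x \<Rightarrow> 'e::euclidean_space)) set \<Rightarrow>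
     'y topology \<Rightarrow> ('y set \<times> ('y \<Rightarrow> 'e)) set \<Rightarrow> ('x \<Rightarrow> 'y) \<Rightarrow> bool" where
  "diffeomorphism X A Y B f \<longleftrightarrow>
     smooth_manifold X A \<and> smooth_manifold Y B \<and> homeomorphic_map X Y f \<and>
     manifold_map smooth_on X A Y B f \<and>
     manifold_map smooth_on Y B X A (inv_into (topspace X) f)"

text \<open>Transport of an atlas along a bijection \<open>f\<close> with domain \<open>T\<close>.\<close>

definition transport_atlas ::
    "'x set \<Rightarrow> ('x \<Rightarrow> 'y) \<Rightarrow> ('x set \<times> ('x \<Rightarrow> 'e)) set \<Rightarrow> ('y set \<times> ('y \<Rightarrow> 'e)) set" where
  "transport_atlas T f A = (\<lambda>(V, \<phi>). (f ` V, \<phi> \<circ> inv_into T f)) ` A"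

text \<open>
  The manifold structure on a quotient by a free proper action is the unique one for which the
  projection is a submersion. For \<open>reg = holo_on\<close> the Frechet derivative is complex linear,
  so surjectivity has the same meaning over the reals and over the complex numbers.
\<close>

definition quotient_chart ::
    "((complex ^ 'm::finite) set \<Rightarrow> (complex ^ 'm \<Rightarrow> 'e::euclidean_space) \<Rightarrow> bool) \<Rightarrow>
     (complex ^ 'm) set \<Rightarrow> (complex ^ 'm) set \<Rightarrow>
     (complex ^ 'm) set set \<times> ((complex ^ 'm) set \<Rightarrow> 'e) \<Rightarrow> bool" where
  "quotient_chart reg G U = (\<lambda>(V, \<phi>).
     is_chart (orbit_space G U) (V, \<phi>) \<and>
     reg {z \<in> U. orbit G z \<in> V} (\<phi> \<circ> orbit G) \<and>
     (\<forall>z\<in>U. orbit G z \<in> V \<longrightarrow> surj (frechet_derivative (\<phi> \<circ> orbit G) (at z))))"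

text \<open>
  The (maximal) smooth atlas of $\mathcal{Z}_{\mathcal{K}}$, transported from $U(\mathcal{K})/R_\Sigma$ by the map
  sending an orbit to its unique point in $\mathcal{Z}_{\mathcal{K}}$.
\<close>

definition moment_angle_atlas ::
    "('m::finite \<Rightarrow> 'v::euclidean_space) \<Rightarrow> 'm set set \<Rightarrow>
     ((complex ^ 'm) set \<times> (complex ^ 'm \<Rightarrow> 'e::euclidean_space)) set" where
  "moment_angle_atlas a K =
     transport_atlas (orbit (R_group a) ` U_space K)
       (\<lambda>P. THE z. z \<in> P \<inter> moment_angle_complex K)
       {c. quotient_chart smooth_on (R_group a) (U_space K) c}"

end

theory Submission
  imports Defs
begin

text \<open>
  Write \<open>L\<close> for the kernel of \<open>Lambda_R a\<close>. The fan enters only through the fact that \<open>Lambda_R a\<close>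
  maps the set of all \<open>p \<ge> 0\<close> with support in \<open>K\<close> bijectively onto \<open>N\<close>. By homogeneity and compactness
  the inverse is Lipschitz. In logarithmic coordinates this bounds translations along \<open>L\<close> between points
  whose moduli are under control (properness) and shows that every orbit meets the moment-angle
  complex exactly once.

  By dimension count \<open>B = Re_vec \<circ> \<Psi>\<close> is an isomorphism onto \<open>L\<close>, so both groups have the form
  \<open>exp (H u)\<close> with \<open>H\<close> real-linear and real part \<open>B\<close>: take \<open>H = \<Psi>\<close> or \<open>H = B\<close>. The heart of the
  proof is a smooth map \<open>W\<close> on \<open>U\<close> that depends on the moduli of the coordinates only and satisfies
  \<open>W (exp (H u) * z) = W z + u\<close> for both groups simultaneously. It trivialises both actions, and
  the zero set of \<open>W\<close> is a smooth slice common to them, so that \<open>z \<mapsto> exp (- \<Psi> (W z)) * z\<close> induces the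
  diffeomorphism of the two quotients, equivariant because \<open>W\<close> is invariant under the torus. The
  moment-angle complex itself is only a topological slice and cannot play this role.
\<close>

section \<open>The cone complex of a complete simplicial fan\<close>

text \<open>The obstacle is the coordinates that may vanish: their logarithms are infinite, so
  \<open>U\<close> does not split off the kernel in any obvious global way. Two facts overcome this.
  A vector of \<open>L\<close> supported on a simplex \<open>J\<close> is zero, since its positive
  and negative parts are cone points with equal image; hence the logarithms outside \<open>J\<close>
  alone recover the translation, and they are finite on the part of \<open>U\<close> where only
  coordinates in \<open>J\<close> may vanish. Patching these local recipes needs weights that are
  smooth across the boundary of each part, where a further coordinate tends to zero. The weight of
  \<open>J\<close> is therefore supported where the point, once normalised by its own recipe, has
  controlled moduli; the translation bound then keeps this support away from the boundary inside
  \<open>U\<close>. So the estimate on translations already enters the construction of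
  \<open>W\<close>, and properness is read off from \<open>W\<close>. Smoothness is carried along
  with complex differentiability, and charts of both kinds come from one real inverse function
  theorem: the inverse of a complex linear derivative is complex linear.\<close>

definition cone_points :: "'m::finite set set \<Rightarrow> (real ^ 'm) set" where
  "cone_points K = {p. (\<forall>i. 0 \<le> p $ i) \<and> {i. p $ i \<noteq> 0} \<in> K}"

section \<open>Convex cones: coordinates of their points, and faces\<close>

lemma mem_convex_cone_hull_image:
  assumes "finite I"
  shows "x \<in> convex_cone hull (v ` I) \<longleftrightarrow> (\<exists>t. (\<forall>i\<in>I. 0 \<le> t i) \<and> x = (\<Sum>i\<in>I. t i *\<^sub>R v i))"
proof
  let ?S = "{x. \<exists>t. (\<forall>i\<in>I. 0 \<le> t i) \<and> x = (\<Sum>i\<in>I. t i *\<^sub>R v i)}"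
  have "convex_cone ?S"
    unfolding convex_cone_iff
  proof (intro conjI ballI allI impI)
    show "0 \<in> ?S" by (auto intro!: exI[of _ "\<lambda>_. 0"])
  next
    fix x y assume "x \<in> ?S" "y \<in> ?S"
    then obtain s t where "\<forall>i\<in>I. 0 \<le> s i" "\<forall>i\<in>I. 0 \<le> t i"
      "x = (\<Sum>i\<in>I. s i *\<^sub>R v i)" "y = (\<Sum>i\<in>I. t i *\<^sub>R v i)" by auto
    then show "x + y \<in> ?S"
      by (auto intro!: exI[of _ "\<lambda>i. s i + t i"] simp: scaleR_left_distrib sum.distrib)
  next
    fix x c assume "x \<in> ?S" "0 \<le> (c::real)"
    then obtain s where "\<forall>i\<in>I. 0 \<le> s i" "x = (\<Sum>i\<in>I. s i *\<^sub>R v i)" by auto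
    then show "c *\<^sub>R x \<in> ?S"
      using \<open>0 \<le> c\<close> by (auto intro!: exI[of _ "\<lambda>i. c * s i"] simp: scaleR_sum_right)
  qed
  moreover have "v ` I \<subseteq> ?S"
  proof
    fix x assume "x \<in> v ` I"
    then obtain j where j: "j \<in> I" "x = v j" by auto
    have "(\<Sum>i\<in>I. (if i = j then 1 else 0) *\<^sub>R v i) = (\<Sum>i\<in>I. if i = j then v i else 0)"
      by (rule sum.cong) auto
    then have "x = (\<Sum>i\<in>I. (if i = j then 1 else 0) *\<^sub>R v i)"
      using j assms by simp
    then show "x \<in> ?S" by (intro CollectI exI[of _ "\<lambda>i. if i = j then 1 else 0"]) auto
  qed
  ultimately have "convex_cone hull (v ` I) \<subseteq> ?S" by (rule hull_minimal[rotated])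
  then show "x \<in> convex_cone hull (v ` I) \<Longrightarrow> \<exists>t. (\<forall>i\<in>I. 0 \<le> t i) \<and> x = (\<Sum>i\<in>I. t i *\<^sub>R v i)"
    by blast
next
  assume "\<exists>t. (\<forall>i\<in>I. 0 \<le> t i) \<and> x = (\<Sum>i\<in>I. t i *\<^sub>R v i)"
  then obtain t where t: "\<forall>i\<in>I. 0 \<le> t i" "x = (\<Sum>i\<in>I. t i *\<^sub>R v i)" by auto
  have "(\<Sum>i\<in>J. t i *\<^sub>R v i) \<in> convex_cone hull (v ` I)" if "J \<subseteq> I" for J
    using finite_subset[OF that assms] that
  proof (induction J rule: finite_induct)
    case empty
    then show ?case by (simp add: convex_cone_hull_contains_0)
  next
    case (insert j J)
    have "t j *\<^sub>R v j \<in> convex_cone hull (v ` I)"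
      using insert.prems t by (intro convex_cone_hull_mul hull_inc) auto
    then show ?case using insert by (simp add: convex_cone_hull_add)
  qed
  then show "x \<in> convex_cone hull (v ` I)" using t by blast
qed

lemma convex_cone_hull_singleton: "convex_cone hull {v} = {c *\<^sub>R v |c. 0 \<le> c}"
  using mem_convex_cone_hull_image[of "{v}" _ id] by auto

lemma convex_cone_hull_scaleR:
  assumes "0 < c"
  shows "convex_cone hull {c *\<^sub>R v} = convex_cone hull {v}"
proof
  show "convex_cone hull {c *\<^sub>R v} \<subseteq> convex_cone hull {v}"
    using assms by (intro hull_minimal) (auto simp: convex_cone_convex_cone_hull convex_cone_hull_mul hull_inc)
  have "(1 / c) *\<^sub>R (c *\<^sub>R v) \<in> convex_cone hull {c *\<^sub>R v}"
    using assms by (intro convex_cone_hull_mul hull_inc) auto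
  then show "convex_cone hull {v} \<subseteq> convex_cone hull {c *\<^sub>R v}"
    using assms by (intro hull_minimal) (auto simp: convex_cone_convex_cone_hull)
qed

text \<open>Coordinates with respect to \<open>v\<close> are unique, and nonnegative on the cone. If
  a proper mixture of two points has zero coordinates outside \<open>J\<close>, no cancellation is
  possible, so both points have zero coordinates there.\<close>

lemma face_of_convex_cone_hull:
  fixes v :: "'i \<Rightarrow> 'v::real_vector"
  assumes "finite I" and ind: "\<And>d. (\<Sum>i\<in>I. d i *\<^sub>R v i) = 0 \<Longrightarrow> \<forall>i\<in>I. d i = 0" and "J \<subseteq> I"
  shows "convex_cone hull (v ` J) face_of convex_cone hull (v ` I)"
  unfolding face_of_def
proof (intro conjI ballI impI)
  show "convex_cone hull (v ` J) \<subseteq> convex_cone hull (v ` I)"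
    using assms by (intro hull_mono) auto
  show "convex (convex_cone hull (v ` J))" by (rule convex_convex_cone_hull)
next
  fix p q x
  assume pq: "p \<in> convex_cone hull (v ` I)" "q \<in> convex_cone hull (v ` I)"
    and x: "x \<in> convex_cone hull (v ` J)" "x \<in> open_segment p q"
  have finJ: "finite J" using assms finite_subset by blast
  obtain s t r where st: "\<forall>i\<in>I. 0 \<le> s i" "\<forall>i\<in>I. 0 \<le> t i"
      "p = (\<Sum>i\<in>I. s i *\<^sub>R v i)" "q = (\<Sum>i\<in>I. t i *\<^sub>R v i)"
    and r: "\<forall>i\<in>J. 0 \<le> r i" "x = (\<Sum>i\<in>J. r i *\<^sub>R v i)"
    using pq x(1) unfolding mem_convex_cone_hull_image[OF assms(1)] mem_convex_cone_hull_image[OF finJ]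
    by blast
  obtain u where u: "0 < u" "u < 1" "x = (1 - u) *\<^sub>R p + u *\<^sub>R q"
    using x(2) by (auto simp: in_segment)
  \<comment> \<open>Difference of the two expansions of \<open>x\<close>: through \<open>p\<close>
    and \<open>q\<close>, and over \<open>J\<close> alone.\<close>
  define d where "d i = (1 - u) * s i + u * t i - (if i \<in> J then r i else 0)" for i
  have "(\<Sum>i\<in>I. d i *\<^sub>R v i) = (1 - u) *\<^sub>R p + u *\<^sub>R q - (\<Sum>i\<in>I. (if i \<in> J then r i else 0) *\<^sub>R v i)"
    by (simp add: d_def st scaleR_diff_left scaleR_left_distrib sum_subtractf sum.distrib scaleR_sum_right)
  also have "(\<Sum>i\<in>I. (if i \<in> J then r i else 0) *\<^sub>R v i) = (\<Sum>i\<in>J. r i *\<^sub>R v i)"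
    using assms(1,3) by (intro sum.mono_neutral_cong_right) auto
  finally have "(\<Sum>i\<in>I. d i *\<^sub>R v i) = 0" using u r by simp
  from ind[OF this] have d0: "d i = 0" if "i \<in> I" for i using that by blast
  have z: "s i = 0 \<and> t i = 0" if "i \<in> I - J" for i
  proof -
    have "(1 - u) * s i + u * t i = 0" using d0[of i] that by (simp add: d_def)
    moreover have "0 \<le> (1 - u) * s i" "0 \<le> u * t i" using st u that by auto
    ultimately have "(1 - u) * s i = 0" "u * t i = 0" by linarith+
    then show ?thesis using u by simp
  qed
  have "p = (\<Sum>i\<in>J. s i *\<^sub>R v i)" "q = (\<Sum>i\<in>J. t i *\<^sub>R v i)"
    unfolding st using assms(1,3) z by (auto intro!: sum.mono_neutral_right)
  then show "p \<in> convex_cone hull (v ` J)" "q \<in> convex_cone hull (v ` J)"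
    using st assms(3) mem_convex_cone_hull_image[OF finJ] by blast+
qed

text \<open>The sum is the midpoint of the segment from \<open>2 *\<^sub>R x\<close> to
  \<open>2 *\<^sub>R y\<close>. Equal points are treated apart because their open segment is
  empty.\<close>

lemma face_of_cone_sum:
  fixes x y :: "'v::real_vector"
  assumes F: "F face_of S" and "convex_cone F" and S: "convex_cone S"
    and xy: "x \<in> S" "y \<in> S" "x + y \<in> F"
  shows "x \<in> F"
proof -
  have half: "w \<in> F" if "2 *\<^sub>R w \<in> F" for w
    using convex_cone_scaleR[OF assms(2), of "1/2" "2 *\<^sub>R w"] that by simp
  show ?thesis
  proof (cases "x = y")
    case True
    then have "2 *\<^sub>R x \<in> F" using xy by (simp add: scaleR_2)
    then show ?thesis by (rule half)
  next
    case False
    have "x + y \<in> open_segment (2 *\<^sub>R x) (2 *\<^sub>R y)"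
      unfolding in_segment using False by (intro conjI exI[of _ "1/2"]) auto
    then have "2 *\<^sub>R x \<in> F"
      using F xy S by (meson convex_cone_scaleR face_ofD zero_le_numeral)
    then show ?thesis by (rule half)
  qed
qed

section \<open>From the fan to a bijection between its cone complex and the ambient space\<close>

locale fan_rays =
  fixes N :: "'v::euclidean_space set" and \<Sigma> and a :: "'m::finite \<Rightarrow> 'v" and K
  assumes complete: "complete_fan N \<Sigma>" and simplicial: "simplicial_fan N \<Sigma>"
    and rays: "ray_generators \<Sigma> a" and K_def: "K = fan_complex \<Sigma> a"
begin

lemma fan: "fan N \<Sigma>"
  using complete complete_fan_def by blast

lemma ray_in: "a i \<noteq> 0 \<Longrightarrow> convex_cone hull {a i} \<in> \<Sigma>"
  using rays by (auto simp: ray_generators_def dest: bij_betwE)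

lemma ray_inj: "a i \<noteq> 0 \<Longrightarrow> a j \<noteq> 0 \<Longrightarrow> convex_cone hull {a i} = convex_cone hull {a j} \<Longrightarrow> i = j"
  using rays unfolding ray_generators_def bij_betw_def inj_on_def by blast

lemma generator_in: "0 \<in> N \<Longrightarrow> a i \<in> N"
proof (cases "a i = 0")
  case False
  then have "convex_cone hull {a i} \<subseteq> N" using ray_in fan by (auto simp: fan_def)
  then show ?thesis using hull_inc[of "a i" "{a i}"] by auto
qed auto

text \<open>The intersection of two cones of the fan is a face of each, and here it is the whole
  ray.\<close>

lemma ray_face: assumes "\<sigma> \<in> \<Sigma>" "a i \<noteq> 0" "a i \<in> \<sigma>" shows "convex_cone hull {a i} face_of \<sigma>"
proof -
  have "convex_cone \<sigma>"
    using fan assms(1) by (auto simp: fan_def polyhedral_cone_def convex_cone_convex_cone_hull)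
  then have "convex_cone hull {a i} \<subseteq> \<sigma>" using assms(3) by (intro hull_minimal) auto
  then have "convex_cone hull {a i} \<inter> \<sigma> = convex_cone hull {a i}" by blast
  then show ?thesis using fan assms ray_in by (metis fan_def)
qed

text \<open>Some nonzero summand of an expansion of \<open>a i\<close> lies in the face spanned by
  \<open>a i\<close>, hence is a positive multiple of it. Thus every finite generating family of a
  cone of the fan contains, up to scaling, each chosen generator lying in that cone.\<close>

lemma extreme_ray_generator:
  assumes fin: "finite B" and cone: "convex_cone hull (v ` B) \<in> \<Sigma>" and "a i \<noteq> 0"
    and ai: "a i \<in> convex_cone hull (v ` B)"
  obtains b c where "b \<in> B" "c > 0" "v b = c *\<^sub>R a i"
proof -
  obtain t where t: "\<forall>j\<in>B. 0 \<le> t j" "a i = (\<Sum>j\<in>B. t j *\<^sub>R v j)"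
    using ai mem_convex_cone_hull_image[OF fin] by blast
  have "\<exists>j\<in>B. t j *\<^sub>R v j \<noteq> 0" using t(2) \<open>a i \<noteq> 0\<close> sum.neutral[of B "\<lambda>j. t j *\<^sub>R v j"] by auto
  then obtain b where b: "b \<in> B" "t b *\<^sub>R v b \<noteq> 0" by blast
  have tb: "t b > 0" using b t by (metis order_le_less scale_zero_left)
  have "a i = t b *\<^sub>R v b + (\<Sum>j\<in>B - {b}. t j *\<^sub>R v j)"
    using t(2) b fin by (simp add: sum.remove)
  moreover have "t b *\<^sub>R v b \<in> convex_cone hull (v ` B)"
    using b tb by (intro convex_cone_hull_mul hull_inc) auto
  moreover have "(\<Sum>j\<in>B - {b}. t j *\<^sub>R v j) \<in> convex_cone hull (v ` B)"
  proof -
    have "(\<Sum>j\<in>B - {b}. t j *\<^sub>R v j) \<in> convex_cone hull (v ` (B - {b}))"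
      using fin t(1) by (subst mem_convex_cone_hull_image) auto
    then show ?thesis using hull_mono[of "v ` (B - {b})" "v ` B"] by blast
  qed
  moreover have "a i \<in> convex_cone hull {a i}" by (rule hull_inc) auto
  ultimately have "t b *\<^sub>R v b \<in> convex_cone hull {a i}"
    using face_of_cone_sum[OF ray_face[OF cone assms(3) ai]]
    by (simp add: convex_cone_convex_cone_hull)
  then obtain c where c: "c \<ge> 0" "t b *\<^sub>R v b = c *\<^sub>R a i"
    by (auto simp: convex_cone_hull_singleton)
  have "c > 0" using c b by (cases "c = 0") auto
  moreover have "v b = (c / t b) *\<^sub>R a i"
    using arg_cong[OF c(2), of "\<lambda>x. (1 / t b) *\<^sub>R x"] tb by simp
  ultimately show ?thesis using that[of b "c / t b"] b tb by auto
qed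

lemma K_iff: "I \<in> K \<longleftrightarrow> (\<forall>i\<in>I. a i \<noteq> 0) \<and> convex_cone hull (a ` I) \<in> \<Sigma>"
  by (auto simp: K_def fan_complex_def)

text \<open>Simpliciality provides some independent generating set, not the chosen generators. By
  extremality each \<open>a i\<close> is a positive multiple of one of its vectors, and different
  indices give different vectors because their rays differ.\<close>

lemma generators_independent:
  assumes I: "I \<in> K" and d: "(\<Sum>i\<in>I. d i *\<^sub>R a i) = 0"
  shows "\<forall>i\<in>I. d i = 0"
proof -
  obtain B where B: "independent B" "convex_cone hull (a ` I) = convex_cone hull B"
    using simplicial I K_iff by (auto simp: simplicial_fan_def)
  have finB: "finite B" using B independent_imp_finite by blast
  have "\<exists>b c. b \<in> B \<and> c > 0 \<and> b = c *\<^sub>R a i" if "i \<in> I" for i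
  proof -
    have "a i \<in> convex_cone hull (id ` B)"
      using B(2) hull_inc[of "a i" "a ` I"] that by auto
    moreover have "convex_cone hull (id ` B) \<in> \<Sigma>" "a i \<noteq> 0"
      using I that B K_iff by auto
    ultimately obtain b c where "b \<in> B" "c > 0" "id b = c *\<^sub>R a i"
      using extreme_ray_generator[OF finB] by metis
    then show ?thesis by auto
  qed
  then obtain b c where bc: "\<And>i. i \<in> I \<Longrightarrow> b i \<in> B \<and> c i > 0 \<and> b i = c i *\<^sub>R a i" by metis
  have cone: "convex_cone hull {b i} = convex_cone hull {a i}" if "i \<in> I" for i
    using bc[OF that] convex_cone_hull_scaleR[of "c i" "a i"] by simp
  have inj: "inj_on b I"
  proof (rule inj_onI)
    fix i j assume ij: "i \<in> I" "j \<in> I" "b i = b j"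
    then have "convex_cone hull {a i} = convex_cone hull {a j}" using cone by metis
    then show "i = j" using ray_inj ij I K_iff by blast
  qed
  have "(\<Sum>i\<in>I. d i *\<^sub>R a i) = (\<Sum>i\<in>I. (d i / c i) *\<^sub>R b i)"
  proof (rule sum.cong)
    fix i assume "i \<in> I"
    then have "c i > 0" "b i = c i *\<^sub>R a i" using bc by blast+
    then show "d i *\<^sub>R a i = (d i / c i) *\<^sub>R b i" by simp
  qed auto
  also have "\<dots> = (\<Sum>x\<in>b ` I. (d (inv_into I b x) / c (inv_into I b x)) *\<^sub>R x)"
    using inj by (simp add: sum.reindex inv_into_f_f)
  finally have sum0: "(\<Sum>x\<in>b ` I. (d (inv_into I b x) / c (inv_into I b x)) *\<^sub>R x) = 0"
    using d by simp
  have "d i / c i = 0" if "i \<in> I" for i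
  proof -
    have "finite I" by simp
    then have "finite (b ` I)" "b ` I \<subseteq> B" using bc by blast+
    from independentD[OF B(1) this sum0, of "b i"] show ?thesis
      using that inj by (simp add: inv_into_f_f)
  qed
  then show ?thesis using bc by fastforce
qed

text \<open>A subfamily of independent generators spans a face, and fans are closed under
  faces.\<close>

lemma K_down: assumes "I \<in> K" "J \<subseteq> I" shows "J \<in> K"
proof -
  have "convex_cone hull (a ` J) face_of convex_cone hull (a ` I)"
    using assms generators_independent by (intro face_of_convex_cone_hull) auto
  moreover have "convex_cone hull (a ` I) \<in> \<Sigma>" "\<forall>i\<in>J. a i \<noteq> 0" using assms K_iff by blast+
  ultimately show ?thesis
    unfolding K_iff using fan convex_cone_hull_nonempty[of "a ` J"] by (auto simp: fan_def)
qed

lemma Lambda_support: "Lambda_R a p = (\<Sum>i\<in>{i. p $ i \<noteq> 0}. (p $ i) *\<^sub>R a i)"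
  unfolding Lambda_R_def by (rule sum.mono_neutral_right) auto

text \<open>The common image lies in the intersection of the two supporting cones, a face of the
  first. Each summand \<open>(p $ i) *\<^sub>R a i\<close> stays in that face, so \<open>a i\<close>
  lies in the second cone, whose generators must then include one on the ray of \<open>a i\<close>;
  distinct indices have distinct rays.\<close>

lemma support_subset:
  assumes p: "p \<in> cone_points K" and q: "q \<in> cone_points K" and eq: "Lambda_R a p = Lambda_R a q"
  shows "{i. p $ i \<noteq> 0} \<subseteq> {i. q $ i \<noteq> 0}"
proof
  fix i assume i: "i \<in> {i. p $ i \<noteq> 0}"
  let ?I = "{i. p $ i \<noteq> 0}" and ?J = "{i. q $ i \<noteq> 0}"
  let ?S = "convex_cone hull (a ` ?I)" and ?T = "convex_cone hull (a ` ?J)"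
  have p0: "\<forall>i. 0 \<le> p $ i" and q0: "\<forall>i. 0 \<le> q $ i" and IJ: "?I \<in> K" "?J \<in> K"
    using p q by (auto simp: cone_points_def)
  have ST: "?S \<in> \<Sigma>" "?T \<in> \<Sigma>" using IJ K_iff by blast+
  have ai: "a i \<noteq> 0" using IJ(1) i unfolding K_iff by simp
  have "Lambda_R a p \<in> ?S" "Lambda_R a q \<in> ?T"
    unfolding Lambda_support using p0 q0 by (subst mem_convex_cone_hull_image; auto)+
  then have F: "Lambda_R a p \<in> ?S \<inter> ?T" "(?S \<inter> ?T) face_of ?S"
    using eq fan ST unfolding fan_def by auto
  have split: "Lambda_R a p = (p $ i) *\<^sub>R a i + (\<Sum>j\<in>?I - {i}. (p $ j) *\<^sub>R a j)"
    unfolding Lambda_support using i by (simp add: sum.remove)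
  have "convex_cone (?S \<inter> ?T)"
    using convex_cone_convex_cone_hull[of "a ` ?I"] convex_cone_convex_cone_hull[of "a ` ?J"]
    by (simp add: convex_cone_iff)
  moreover have "(p $ i) *\<^sub>R a i \<in> ?S"
    using i p0 by (intro convex_cone_hull_mul hull_inc) auto
  moreover have "(\<Sum>j\<in>?I - {i}. (p $ j) *\<^sub>R a j) \<in> ?S"
  proof -
    have "(\<Sum>j\<in>?I - {i}. (p $ j) *\<^sub>R a j) \<in> convex_cone hull (a ` (?I - {i}))"
      using p0 by (subst mem_convex_cone_hull_image) auto
    then show ?thesis using hull_mono[of "a ` (?I - {i})" "a ` ?I"] by blast
  qed
  ultimately have "(p $ i) *\<^sub>R a i \<in> ?S \<inter> ?T"
    using face_of_cone_sum[OF F(2)] F(1) split by (simp add: convex_cone_convex_cone_hull)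
  then have "(p $ i) *\<^sub>R a i \<in> ?T" by blast
  then have "(1 / p $ i) *\<^sub>R ((p $ i) *\<^sub>R a i) \<in> ?T"
    by (rule convex_cone_hull_mul) (simp add: p0)
  moreover have "(1 / p $ i) *\<^sub>R ((p $ i) *\<^sub>R a i) = a i" using i by simp
  ultimately have "a i \<in> ?T" by (simp only:)
  then obtain j c where j: "j \<in> ?J" "c > 0" "a j = c *\<^sub>R a i"
    using extreme_ray_generator[OF _ ST(2) ai] by auto
  then have "convex_cone hull {a j} = convex_cone hull {a i}"
    using convex_cone_hull_scaleR by simp
  then have "j = i" using ray_inj[of j i] ai IJ(2) j unfolding K_iff by simp
  then show "i \<in> ?J" using j by simp
qed

lemma Lambda_inj_on: "inj_on (Lambda_R a) (cone_points K)"
proof (rule inj_onI)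
  fix p q assume pq: "p \<in> cone_points K" "q \<in> cone_points K" "Lambda_R a p = Lambda_R a q"
  then have supp: "{i. p $ i \<noteq> 0} = {i. q $ i \<noteq> 0}" by (intro equalityI support_subset) auto
  have "(\<Sum>i\<in>{i. p $ i \<noteq> 0}. (p $ i - q $ i) *\<^sub>R a i) = 0"
    using pq(3) unfolding Lambda_support supp by (simp add: scaleR_diff_left sum_subtractf)
  then have "\<forall>i\<in>{i. p $ i \<noteq> 0}. p $ i - q $ i = 0"
    using pq(1) by (intro generators_independent) (auto simp: cone_points_def)
  moreover have "p $ i = q $ i" if "p $ i = 0" for i using that supp by auto
  ultimately show "p = q" unfolding vec_eq_iff by force
qed

text \<open>Each vector of the independent set generating the cone through \<open>x\<close> spans a
  face of it, so it can be exchanged for the chosen generator of the same ray.\<close>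

lemma Lambda_surj: assumes "x \<in> N" shows "\<exists>p\<in>cone_points K. Lambda_R a p = x"
proof -
  obtain \<sigma> where \<sigma>: "\<sigma> \<in> \<Sigma>" "x \<in> \<sigma>" using complete assms by (auto simp: complete_fan_def)
  then obtain B where B: "independent B" "\<sigma> = convex_cone hull B"
    using simplicial by (auto simp: simplicial_fan_def)
  have finB: "finite B" using B independent_imp_finite by blast
  have ind: "\<forall>b\<in>B. d b = 0" if "(\<Sum>b\<in>B. d b *\<^sub>R id b) = 0" for d
    using independentD[OF B(1) finB order_refl, of d] that by auto
  have "\<exists>i. a i \<noteq> 0 \<and> convex_cone hull {a i} = convex_cone hull {b}" if "b \<in> B" for b
  proof -
    have "convex_cone hull (id ` {b}) face_of convex_cone hull (id ` B)"
      using that ind by (intro face_of_convex_cone_hull[OF finB]) auto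
    then have "convex_cone hull {b} \<in> \<Sigma>"
      using fan \<sigma> B convex_cone_hull_nonempty[of "{b}"] by (auto simp: fan_def)
    \<comment> \<open>\<open>ray_generators\<close> enumerates the cones of dimension one
      only.\<close>
    moreover have "dim (convex_cone hull {b}) = 1"
    proof -
      have b0: "b \<noteq> 0" using B that dependent_zero by blast
      have "span (convex_cone hull {b}) = span {b}"
      proof (rule span_eq[THEN iffD2], intro conjI)
        show "convex_cone hull {b} \<subseteq> span {b}"
          by (auto simp: convex_cone_hull_singleton span_mul span_base)
        show "{b} \<subseteq> span (convex_cone hull {b})" by (simp add: hull_inc span_base)
      qed
      then have "dim (convex_cone hull {b}) = dim {b}" by (metis dim_span)
      then show ?thesis using b0 by (simp add: dim_insert)
    qed
    ultimately have "convex_cone hull {b} \<in> (\<lambda>i. convex_cone hull {a i}) ` {i. a i \<noteq> 0}"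
      using rays by (auto simp: ray_generators_def bij_betw_def)
    then show ?thesis by auto
  qed
  then obtain i where i: "\<And>b. b \<in> B \<Longrightarrow> a (i b) \<noteq> 0 \<and> convex_cone hull {a (i b)} = convex_cone hull {b}"
    by metis
  have mem: "b \<in> convex_cone hull {a (i b)}" "a (i b) \<in> convex_cone hull {b}" if "b \<in> B" for b
    using i[OF that] by (metis hull_inc insertI1)+
  have "convex_cone hull (a ` i ` B) = convex_cone hull B"
  proof
    have "a (i b) \<in> convex_cone hull B" if "b \<in> B" for b
      using mem(2)[OF that] hull_mono[of "{b}" B] that by blast
    then show "convex_cone hull (a ` i ` B) \<subseteq> convex_cone hull B"
      by (intro hull_minimal) (auto simp: convex_cone_convex_cone_hull)
    have "b \<in> convex_cone hull (a ` i ` B)" if "b \<in> B" for b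
      using mem(1)[OF that] hull_mono[of "{a (i b)}" "a ` i ` B"] that by blast
    then show "convex_cone hull B \<subseteq> convex_cone hull (a ` i ` B)"
      by (intro hull_minimal) (auto simp: convex_cone_convex_cone_hull)
  qed
  then have "i ` B \<in> K" "x \<in> convex_cone hull (a ` i ` B)" using \<sigma> B i K_iff by auto
  then obtain t where t: "\<forall>j\<in>i ` B. 0 \<le> t j" "x = (\<Sum>j\<in>i ` B. t j *\<^sub>R a j)"
    using mem_convex_cone_hull_image[of "i ` B" x a] by (metis finite)
  define p where "p = (\<chi> j. if j \<in> i ` B then t j else 0)"
  \<comment> \<open>Some coefficients may be zero, so the support is only a subset of the simplex;
    \<open>K_down\<close> covers this.\<close>
  have "{j. p $ j \<noteq> 0} \<subseteq> i ` B" by (auto simp: p_def)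
  then have "{j. p $ j \<noteq> 0} \<in> K" using \<open>i ` B \<in> K\<close> K_down by blast
  moreover have "Lambda_R a p = x"
    unfolding t Lambda_R_def p_def by (intro sum.mono_neutral_cong_right) auto
  moreover have "0 \<le> p $ j" for j using t(1) unfolding p_def by auto
  ultimately show ?thesis unfolding cone_points_def by blast
qed

lemma empty_in_K: "0 \<in> N \<Longrightarrow> {} \<in> K"
  using Lambda_surj[of 0] K_down by (auto simp: cone_points_def)

end

section \<open>Translations along the kernel\<close>

lemma U_space_iff:
  assumes "\<And>I J. I \<in> K \<Longrightarrow> J \<subseteq> I \<Longrightarrow> J \<in> K"
  shows "z \<in> U_space K \<longleftrightarrow> {i. z $ i = 0} \<in> K"
proof
  assume "z \<in> U_space K"
  then obtain I where "I \<in> K" "\<forall>j. j \<notin> I \<longrightarrow> z $ j \<noteq> 0"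
    by (auto simp: U_space_def polyhedral_product_def)
  then show "{i. z $ i = 0} \<in> K" by - (rule assms[of I]; auto)
next
  assume "{i. z $ i = 0} \<in> K"
  then show "z \<in> U_space K"
    unfolding U_space_def polyhedral_product_def by (intro UN_I[of "{i. z $ i = 0}"]) auto
qed

lemma moment_angle_complex_iff:
  assumes "\<And>I J. I \<in> K \<Longrightarrow> J \<subseteq> I \<Longrightarrow> J \<in> K"
  shows "z \<in> moment_angle_complex K \<longleftrightarrow> (\<forall>i. norm (z $ i) \<le> 1) \<and> {i. norm (z $ i) \<noteq> 1} \<in> K"
proof
  assume "z \<in> moment_angle_complex K"
  then obtain I where I: "I \<in> K" "\<forall>j. norm (z $ j) \<le> 1" "\<forall>j. j \<notin> I \<longrightarrow> norm (z $ j) = 1"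
    by (auto simp: moment_angle_complex_def polyhedral_product_def)
  then have "{i. norm (z $ i) \<noteq> 1} \<in> K" by - (rule assms[of I]; auto)
  then show "(\<forall>i. norm (z $ i) \<le> 1) \<and> {i. norm (z $ i) \<noteq> 1} \<in> K" using I by blast
next
  assume "(\<forall>i. norm (z $ i) \<le> 1) \<and> {i. norm (z $ i) \<noteq> 1} \<in> K"
  then show "z \<in> moment_angle_complex K"
    unfolding moment_angle_complex_def polyhedral_product_def
    by (intro UN_I[of "{i. norm (z $ i) \<noteq> 1}"]) (auto simp: dist_norm)
qed

lemma open_U_space: "open (U_space K)"
proof -
  have "U_space K = (\<Union>I\<in>K. \<Inter>j\<in>- I. {x. x $ j \<noteq> 0})"
    by (auto simp: U_space_def polyhedral_product_def)
  moreover have "open {x :: complex ^ 'a. x $ j \<noteq> 0}" for j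
    by (intro open_Collect_neq continuous_intros)
  ultimately show ?thesis by (auto intro!: open_INT)
qed

lemma compact_moment_angle_complex: "compact (moment_angle_complex K)"
proof -
  have eq: "moment_angle_complex K =
      (\<Union>I\<in>K. (\<Inter>j. {x. norm (x $ j) \<le> 1}) \<inter> (\<Inter>j\<in>- I. {x. norm (x $ j) = 1}))"
    by (auto simp: moment_angle_complex_def polyhedral_product_def dist_norm)
  have "closed (moment_angle_complex K)"
    unfolding eq by (intro closed_UN closed_Int closed_INT ballI finite closed_Collect_le
        closed_Collect_eq continuous_intros)
  moreover have "norm x \<le> of_nat CARD('a)" if "x \<in> moment_angle_complex K" for x :: "complex ^ 'a"
  proof -
    have "norm (x $ j) \<le> 1" for j using that unfolding eq by auto
    then have "(\<Sum>j\<in>UNIV. norm (x $ j)) \<le> (\<Sum>j\<in>(UNIV :: 'a set). 1)" by (intro sum_mono)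
    then show ?thesis using L2_set_le_sum[of UNIV "\<lambda>j. norm (x $ j)"] by (simp add: norm_vec_def)
  qed
  ultimately show ?thesis by (auto simp: compact_eq_bounded_closed intro: boundedI)
qed

lemma linear_Lambda_R: "linear (Lambda_R a)"
  unfolding Lambda_R_def
  by (intro linearI) (simp_all add: scaleR_left_distrib sum.distrib scaleR_sum_right)

text \<open>Surjectivity is required only over the range of \<open>Lambda_R a\<close>, so that the
  locale mentions neither \<open>N\<close> nor \<open>\<Sigma>\<close>. The kernel is parametrised
  by an abstract space through \<open>B\<close>.\<close>

locale slice_data =
  fixes a :: "'m::finite \<Rightarrow> 'v::euclidean_space" and K :: "'m set set"
    and B :: "'x::euclidean_space \<Rightarrow> real ^ 'm"
  assumes K_down: "I \<in> K \<Longrightarrow> J \<subseteq> I \<Longrightarrow> J \<in> K"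
    and empty_K: "{} \<in> K"
    and Lambda_inj: "inj_on (Lambda_R a) (cone_points K)"
    and Lambda_surj: "\<exists>p\<in>cone_points K. Lambda_R a p = Lambda_R a y"
    and B_linear: "linear B" and B_inj: "inj B" and B_range: "range B = {x. Lambda_R a x = 0}"
begin

abbreviation "U \<equiv> U_space K"
abbreviation "Z \<equiv> moment_angle_complex K"

lemma U_iff: "z \<in> U \<longleftrightarrow> {i. z $ i = 0} \<in> K"
  using K_down by (rule U_space_iff)

lemma Z_iff: "z \<in> Z \<longleftrightarrow> (\<forall>i. norm (z $ i) \<le> 1) \<and> {i. norm (z $ i) \<noteq> 1} \<in> K"
  using K_down by (rule moment_angle_complex_iff)

lemma Z_subset_U: "Z \<subseteq> U"
proof
  fix z assume "z \<in> Z"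
  then have "{i. norm (z $ i) \<noteq> 1} \<in> K" by (simp add: Z_iff)
  then have "{i. z $ i = 0} \<in> K" by (rule K_down) auto
  then show "z \<in> U" by (simp add: U_iff)
qed

lemma cone_points_subset:
  assumes "p \<in> cone_points K" "\<And>i. 0 \<le> q $ i" "\<And>i. p $ i = 0 \<Longrightarrow> q $ i = 0"
  shows "q \<in> cone_points K"
proof -
  have "{i. p $ i \<noteq> 0} \<in> K" using assms(1) by (simp add: cone_points_def)
  then have "{i. q $ i \<noteq> 0} \<in> K" by (rule K_down) (use assms in auto)
  then show ?thesis using assms(2) by (simp add: cone_points_def)
qed

lemma closed_cone_points: "closed (cone_points K)"
proof -
  have "cone_points K = (\<Union>I\<in>K. (\<Inter>i. {p. 0 \<le> p $ i}) \<inter> (\<Inter>i\<in>- I. {p. p $ i = 0}))"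
    (is "_ = ?R")
  proof (intro equalityI subsetI)
    fix p assume "p \<in> cone_points K"
    then show "p \<in> ?R" by (auto simp: cone_points_def)
  next
    fix p assume "p \<in> ?R"
    then obtain I where I: "I \<in> K" "\<forall>i. 0 \<le> p $ i" "\<forall>i. i \<notin> I \<longrightarrow> p $ i = 0" by auto
    then have "{i. p $ i \<noteq> 0} \<in> K" by - (rule K_down[OF I(1)], auto)
    then show "p \<in> cone_points K" using I by (simp add: cone_points_def)
  qed
  then show ?thesis
    by (auto intro!: closed_UN closed_Int closed_INT closed_Collect_le closed_Collect_eq continuous_intros)
qed

text \<open>Subtracting the common part makes two points of the cone complex orthogonal, so that both are
  bounded by their difference; then compactness applies.\<close>

lemma Lambda_bounded_below:
  obtains c where "c > 0"
    "\<And>p q. p \<in> cone_points K \<Longrightarrow> q \<in> cone_points K \<Longrightarrow> c * norm (p - q) \<le> norm (Lambda_R a p - Lambda_R a q)"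
proof -
  let ?L = "Lambda_R a" and ?P = "cone_points K"
  interpret linear ?L by (rule linear_Lambda_R)
  \<comment> \<open>Orthogonality and distance one force the squared norms of both points to add up
    to one, so \<open>S\<close> is bounded.\<close>
  define S where "S = (?P \<times> ?P) \<inter> ({w. fst w \<bullet> snd w = 0} \<inter> {w. norm (fst w - snd w) = 1})"
  define F where "F w = norm (?L (fst w) - ?L (snd w))" for w
  have cL: "continuous_on UNIV ?L" 
    using linear_Lambda_R by (intro linear_continuous_on) (simp add: linear_conv_bounded_linear)
  have "closed S" unfolding S_def
    by (intro closed_Int closed_Times closed_cone_points closed_Collect_eq continuous_intros)
  moreover have "bounded S"
  proof (rule boundedI)
    fix w assume w: "w \<in> S"
    have "fst w \<bullet> snd w = 0" using w by (simp add: S_def)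
    then have "norm (fst w - snd w)^2 = norm (fst w)^2 + norm (snd w)^2"
      unfolding power2_norm_eq_inner using inner_commute[of "fst w" "snd w"]
      by (simp add: inner_diff_left inner_diff_right)
    then have "norm (fst w)^2 + norm (snd w)^2 = 1" using w by (simp add: S_def)
    then show "norm w \<le> 1" by (simp add: norm_prod_def)
  qed
  ultimately have comp: "compact S" by (simp add: compact_eq_bounded_closed)
  have contF: "continuous_on S F" unfolding F_def
    by (intro continuous_intros continuous_on_compose2[OF cL]) auto
  have Fpos: "F w > 0" if "w \<in> S" for w
  proof -
    have "fst w \<noteq> snd w" using that by (auto simp: S_def)
    then have "?L (fst w) \<noteq> ?L (snd w)" using Lambda_inj that by (auto simp: S_def dest: inj_onD)
    then show ?thesis by (simp add: F_def)
  qed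
  \<comment> \<open>\<open>S\<close> can be empty, for instance if every index is a ghost; then any
    positive constant will do.\<close>
  obtain c where c: "c > 0" "\<And>w. w \<in> S \<Longrightarrow> c \<le> F w"
  proof (cases "S = {}")
    case True
    then show ?thesis using that[of 1] by auto
  next
    case False
    then obtain w where "w \<in> S" "\<forall>v\<in>S. F w \<le> F v"
      using continuous_attains_inf[OF comp False contF] by blast
    then show ?thesis using that[of "F w"] Fpos by auto
  qed
  have "c * norm (p - q) \<le> norm (?L p - ?L q)" if p: "p \<in> ?P" and q: "q \<in> ?P" for p q
  proof (cases "p = q")
    case False
    define r where "r = 1 / norm (p - q)"
    have r: "r > 0" using False by (simp add: r_def)
    \<comment> \<open>In every coordinate one of the two truncated differences is zero, which gives
      orthogonality; the factor \<open>r\<close> normalises the distance.\<close>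
    define p' where "p' = (\<chi> i. r * (p $ i - min (p $ i) (q $ i)))"
    define q' where "q' = (\<chi> i. r * (q $ i - min (p $ i) (q $ i)))"
    have pq_diff: "p' - q' = r *\<^sub>R (p - q)"
      by (simp add: p'_def q'_def vec_eq_iff algebra_simps)
    have nn: "0 \<le> p $ i" "0 \<le> q $ i" for i using p q by (auto simp: cone_points_def)
    have "p' \<in> ?P" by (rule cone_points_subset[OF p]) (use r nn in \<open>auto simp: p'_def\<close>)
    moreover have "q' \<in> ?P" by (rule cone_points_subset[OF q]) (use r nn in \<open>auto simp: q'_def\<close>)
    moreover have "p' \<bullet> q' = 0"
      by (auto simp: inner_vec_def p'_def q'_def min_def intro!: sum.neutral)
    moreover have "norm (p' - q') = 1" using False by (simp add: pq_diff r_def)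
    ultimately have "(p', q') \<in> S" by (simp add: S_def)
    then have "c \<le> norm (?L p' - ?L q')" using c(2)[of "(p', q')"] by (simp add: F_def)
    also have "?L p' - ?L q' = r *\<^sub>R (?L p - ?L q)"
      using arg_cong[OF pq_diff, of ?L] by (simp only: diff scale)
    also have "norm \<dots> = r * norm (?L p - ?L q)" using r by simp
    finally show ?thesis using False by (simp add: r_def field_simps)
  qed auto
  then show ?thesis using c(1) that by blast
qed

text \<open>The vectors stand for negative logarithms of moduli: large positive entries, from
  coordinates near zero, are allowed only along a simplex. Such a vector is within a multiple of
  \<open>M\<close> of a cone point, so the Lipschitz bound for cone points carries over to vectors
  with equal image.\<close>

lemma kernel_bound:
  obtains C where "C > 0"
    "\<And>M p q I J. 0 \<le> M \<Longrightarrow> I \<in> K \<Longrightarrow> J \<in> K \<Longrightarrow> Lambda_R a p = Lambda_R a q \<Longrightarrow>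
      (\<And>i. - M \<le> p $ i) \<Longrightarrow> (\<And>i. i \<notin> I \<Longrightarrow> p $ i \<le> M) \<Longrightarrow>
      (\<And>i. - M \<le> q $ i) \<Longrightarrow> (\<And>i. i \<notin> J \<Longrightarrow> q $ i \<le> M) \<Longrightarrow> norm (p - q) \<le> C * M"
proof -
  let ?L = "Lambda_R a"
  interpret linear ?L by (rule linear_Lambda_R)
  obtain c where c: "c > 0"
    "\<And>p q. p \<in> cone_points K \<Longrightarrow> q \<in> cone_points K \<Longrightarrow> c * norm (p - q) \<le> norm (?L p - ?L q)"
    using Lambda_bounded_below by blast
  obtain D where D: "D > 0" "\<And>x. norm (?L x) \<le> D * norm x"
    using linear_bounded_pos[OF linear_Lambda_R, of a] by blast
  define m where "m = real CARD('m)"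
  have m: "m > 0" by (simp add: m_def)
  have near: "\<exists>s\<in>cone_points K. norm (p - s) \<le> m * M"
    if M: "0 \<le> M" and I: "I \<in> K" and p: "\<And>i. - M \<le> p $ i" "\<And>i. i \<notin> I \<Longrightarrow> p $ i \<le> M" for M I p
  proof -
    \<comment> \<open>Negative entries and entries outside \<open>I\<close> have size at most
      \<open>M\<close> and are dropped.\<close>
    define s where "s = (\<chi> i. if i \<in> I then max (p $ i) 0 else 0)"
    have "{i. s $ i \<noteq> 0} \<in> K" by (rule K_down[OF I]) (auto simp: s_def)
    then have "s \<in> cone_points K" by (simp add: cone_points_def s_def)
    moreover have "norm ((p - s) $ i) \<le> M" for i
      using p[of i] M by (auto simp: s_def max_def abs_le_iff)
    then have "(\<Sum>i\<in>UNIV. norm ((p - s) $ i)) \<le> (\<Sum>i\<in>(UNIV :: 'm set). M)" by (intro sum_mono)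
    then have "norm (p - s) \<le> m * M" using norm_le_l1_cart[of "p - s"] by (simp add: m_def)
    ultimately show ?thesis by blast
  qed
  \<comment> \<open>The first summand pays for the two approximations, the second for the distance
    between the cone points: their images differ by at most \<open>2 * D * m * M\<close>.\<close>
  define C where "C = 2 * m + 2 * D * m / c"
  have "C > 0" using m D(1) c(1) by (simp add: C_def add_pos_pos)
  have bound: "norm (p - q) \<le> C * M"
    if M: "0 \<le> M" and IJ: "I \<in> K" "J \<in> K" and eq: "?L p = ?L q"
      and p: "\<And>i. - M \<le> p $ i" "\<And>i. i \<notin> I \<Longrightarrow> p $ i \<le> M"
      and q: "\<And>i. - M \<le> q $ i" "\<And>i. i \<notin> J \<Longrightarrow> q $ i \<le> M" for M p q I J
  proof -
    obtain s where s: "s \<in> cone_points K" "norm (p - s) \<le> m * M" using near[OF M IJ(1) p] by blast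
    obtain t where t: "t \<in> cone_points K" "norm (q - t) \<le> m * M" using near[OF M IJ(2) q] by blast
    have "?L s - ?L t = ?L (q - t) - ?L (p - s)" using eq by (simp add: diff)
    then have "norm (?L s - ?L t) \<le> norm (?L (q - t)) + norm (?L (p - s))"
      by (metis norm_triangle_ineq4)
    also have "\<dots> \<le> D * (m * M) + D * (m * M)"
      using D s(2) t(2) by (intro add_mono order_trans[OF D(2)] mult_left_mono) auto
    finally have "c * norm (s - t) \<le> 2 * D * m * M"
      using c(2)[OF s(1) t(1)] by (simp add: mult_ac)
    then have "norm (s - t) \<le> 2 * D * m / c * M" using c(1) by (simp add: field_simps)
    moreover have "norm (p - q) \<le> norm (p - s) + norm (s - t) + norm (q - t)"
      using dist_triangle[of p q s] dist_triangle[of s q t] by (simp add: dist_norm norm_minus_commute)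
    ultimately show ?thesis using s(2) t(2) by (simp add: C_def algebra_simps)
  qed
  show ?thesis by (rule that[OF \<open>C > 0\<close>], rule bound, assumption+)
qed

lemma Lambda_B [simp]: "Lambda_R a (B u) = 0"
  using B_range by blast

text \<open>For \<open>M = 0\<close> this is membership in \<open>Z\<close>; as \<open>M\<close>
  grows these sets exhaust \<open>U\<close>.\<close>

definition log_bounded :: "real \<Rightarrow> complex ^ 'm \<Rightarrow> bool" where
  "log_bounded M z \<longleftrightarrow> (\<forall>i. norm (z $ i) \<le> exp M) \<and> {i. norm (z $ i) < exp (- M)} \<in> K"

text \<open>The negative logarithms of the moduli of \<open>x\<close> and \<open>z\<close> differ by
  the kernel vector \<open>B u\<close>, so \<open>kernel_bound\<close> applies; \<open>B\<close> is
  bounded below, being linear and injective.\<close>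

lemma translation_bound:
  obtains C where "C > 0"
    "\<And>M z x u. 0 \<le> M \<Longrightarrow> log_bounded M z \<Longrightarrow> log_bounded M x \<Longrightarrow>
      (\<And>i. norm (z $ i) = exp (B u $ i) * norm (x $ i)) \<Longrightarrow> norm u \<le> C * M"
proof -
  obtain C where C: "C > 0"
    "\<And>M p q I J. 0 \<le> M \<Longrightarrow> I \<in> K \<Longrightarrow> J \<in> K \<Longrightarrow> Lambda_R a p = Lambda_R a q \<Longrightarrow>
      (\<And>i. - M \<le> p $ i) \<Longrightarrow> (\<And>i. i \<notin> I \<Longrightarrow> p $ i \<le> M) \<Longrightarrow>
      (\<And>i. - M \<le> q $ i) \<Longrightarrow> (\<And>i. i \<notin> J \<Longrightarrow> q $ i \<le> M) \<Longrightarrow> norm (p - q) \<le> C * M"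
    using kernel_bound by blast
  obtain b where b: "b > 0" "\<And>u. b * norm u \<le> norm (B u)"
    using linear_inj_bounded_below_pos[OF B_linear B_inj] by (metis mult.commute)
  interpret L: linear "Lambda_R a" by (rule linear_Lambda_R)
  have bound: "norm u \<le> C / b * M"
    if M: "0 \<le> M" and zb: "log_bounded M z" and xb: "log_bounded M x"
      and zx: "\<And>i. norm (z $ i) = exp (B u $ i) * norm (x $ i)" for M z x u
  proof -
    define I where "I = {i. norm (z $ i) < exp (- M)}"
    define J where "J = {i. norm (x $ i) < exp (- M)}"
    have IJ: "I \<in> K" "J \<in> K" using zb xb by (simp_all add: log_bounded_def I_def J_def)
    have z: "norm (z $ i) \<le> exp M" "i \<notin> I \<Longrightarrow> exp (- M) \<le> norm (z $ i)" for i
      using zb by (auto simp: log_bounded_def I_def)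
    have x: "norm (x $ i) \<le> exp M" "i \<notin> J \<Longrightarrow> exp (- M) \<le> norm (x $ i)" for i
      using xb by (auto simp: log_bounded_def J_def)
    \<comment> \<open>Where \<open>x\<close> and \<open>z\<close> vanish the logarithm is replaced
      by a value that keeps both \<open>p $ i\<close> and \<open>q $ i\<close> nonnegative. These
      indices belong to \<open>I\<close> and to \<open>J\<close>, where entries may be
      large.\<close>
    define p where "p = (\<chi> i. if x $ i = 0 then \<bar>B u $ i\<bar> else - ln (norm (x $ i)))"
    define q where "q = p - B u"
    have nz: "z $ i = 0 \<longleftrightarrow> x $ i = 0" for i
      using zx[of i] by (metis exp_not_eq_zero mult_eq_0_iff norm_eq_zero)
    have q_ln: "q $ i = - ln (norm (z $ i))" if "x $ i \<noteq> 0" for i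
      using that zx[of i] by (simp add: q_def p_def ln_mult)
    have lnbd: "- M \<le> ln t" if "exp (- M) \<le> t" for t
    proof -
      have "0 < t" using exp_gt_zero[of "- M"] that by (rule less_le_trans)
      then show ?thesis using that ln_le_cancel_iff[of "exp (- M)" t] by simp
    qed
    have lnbd': "ln t \<le> M" if "t \<le> exp M" "t > 0" for t
      using that ln_le_cancel_iff[of t "exp M"] by simp
    have "norm (p - q) \<le> C * M"
    proof (rule C(2)[OF M IJ(2) IJ(1)])
      show "Lambda_R a p = Lambda_R a q" by (simp add: q_def L.diff)
      show "- M \<le> p $ i" for i using lnbd'[OF x(1), of i] M by (auto simp: p_def)
      show "p $ i \<le> M" if "i \<notin> J" for i
      proof -
        have "x $ i \<noteq> 0" using x(2)[OF that] exp_gt_zero[of "- M"] by auto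
        then show ?thesis using lnbd[OF x(2)[OF that]] by (simp add: p_def)
      qed
      show "- M \<le> q $ i" for i
        using lnbd'[OF z(1), of i] M q_ln nz by (cases "x $ i = 0") (auto simp: q_def p_def)
      show "q $ i \<le> M" if "i \<notin> I" for i
      proof -
        have "x $ i \<noteq> 0" using z(2)[OF that] nz[of i] exp_gt_zero[of "- M"] by auto
        then show ?thesis using lnbd[OF z(2)[OF that]] q_ln by simp
      qed
    qed
    then have "norm (B u) \<le> C * M" by (simp add: q_def)
    then have "b * norm u \<le> C * M" using b(2) order_trans by blast
    then show ?thesis using b(1) by (simp add: field_simps)
  qed
  have "C / b > 0" using C(1) b(1) by simp
  show ?thesis by (rule that[OF \<open>C / b > 0\<close>], rule bound, assumption+)
qed

text \<open>Replace the infinite entries of the negative logarithm of the moduli by a large number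
  and project along the kernel to the cone point \<open>p\<close> with the same image. Away from the
  zeros of \<open>z\<close>, \<open>p\<close> is the negative logarithm of the moduli of the
  translate, so the translate lies in \<open>Z\<close>.\<close>

lemma translate_into_Z:
  assumes z: "z \<in> U"
  obtains u p where "p \<in> cone_points K" "\<And>i. exp (B u $ i) * norm (z $ i) = (if z $ i = 0 then 0 else exp (- p $ i))"
    "\<And>i. z $ i = 0 \<Longrightarrow> p $ i \<noteq> 0"
proof -
  let ?L = "Lambda_R a"
  interpret linear ?L by (rule linear_Lambda_R)
  obtain c where c: "c > 0"
    "\<And>p q. p \<in> cone_points K \<Longrightarrow> q \<in> cone_points K \<Longrightarrow> c * norm (p - q) \<le> norm (?L p - ?L q)"
    using Lambda_bounded_below by blast
  define w where "w = (\<chi> i. if z $ i = 0 then 0 else - ln (norm (z $ i)))"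
  \<comment> \<open>The Lipschitz bound places \<open>p\<close> at distance less than
    \<open>T\<close> from \<open>t\<close>, so \<open>p\<close> stays nonzero wherever
    \<open>t\<close> equals \<open>T\<close>, that is, at the zeros of \<open>z\<close>.\<close>
  define T where "T = norm (?L w) / c + 1"
  have T: "T > 0" using c(1) by (simp add: T_def add_nonneg_pos)
  define t where "t = (\<chi> i. if z $ i = 0 then T else 0)"
  have t: "t \<in> cone_points K"
    using z T by (auto simp: cone_points_def t_def U_iff)
  obtain p where p: "p \<in> cone_points K" "?L p = ?L (w + t)" using Lambda_surj by blast
  have "c * norm (p - t) \<le> norm (?L w)" using c(2)[OF p(1) t] p(2) by (simp add: add)
  then have "norm (p - t) < T" using c(1) by (simp add: T_def field_simps)
  then have lt: "\<bar>p $ i - t $ i\<bar> < T" for i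
    using component_le_norm_cart[of "p - t" i] by simp
  have "?L (w + t - p) = 0" using p(2) by (simp add: diff)
  then obtain u where u: "B u = w + t - p" using B_range by (metis (mono_tags) mem_Collect_eq rangeE)
  have "exp (B u $ i) * norm (z $ i) = (if z $ i = 0 then 0 else exp (- p $ i))" for i
    by (simp add: u w_def t_def exp_diff exp_minus field_simps)
  moreover have "p $ i \<noteq> 0" if "z $ i = 0" for i
    using lt[of i] that by (auto simp: t_def)
  ultimately show ?thesis using that p(1) by blast
qed

end

section \<open>Calculus of smooth maps\<close>

abbreviation "tdiff \<equiv> times_differentiable_on"

section \<open>Closure properties of the classes of finite differentiability\<close>

lemma tdiff_cong:
  assumes "open S" "\<And>x. x \<in> S \<Longrightarrow> f x = g x" "tdiff k S f"
  shows "tdiff k S g"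
  using assms(2,3)
proof (induction k arbitrary: f g)
  case 0
  then show ?case using continuous_on_cong[of S S f g] by simp
next
  case (Suc k)
  have D: "(g has_derivative frechet_derivative f (at x)) (at x)" if "x \<in> S" for x
  proof (rule has_derivative_transform_within_open[OF _ assms(1) that])
    show "(f has_derivative frechet_derivative f (at x)) (at x)"
      using Suc.prems(2) that by (simp add: frechet_derivative_works)
    show "f y = g y" if "y \<in> S" for y using Suc.prems(1) that by simp
  qed
  have "tdiff k S (\<lambda>x. frechet_derivative g (at x) v)" for v
  proof (rule Suc.IH)
    show "frechet_derivative f (at x) v = frechet_derivative g (at x) v" if "x \<in> S" for x
      using frechet_derivative_at[OF D[OF that]] by simp
    show "tdiff k S (\<lambda>x. frechet_derivative f (at x) v)" using Suc.prems(2) by simp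
  qed
  moreover have "g differentiable (at x)" if "x \<in> S" for x using D[OF that] by (rule differentiableI)
  ultimately show ?case by simp
qed

lemma tdiff_SucI:
  assumes "open S" "\<And>x. x \<in> S \<Longrightarrow> (f has_derivative D x) (at x)" "\<And>v. tdiff k S (\<lambda>x. D x v)"
  shows "tdiff (Suc k) S f"
proof -
  have "tdiff k S (\<lambda>x. frechet_derivative f (at x) v)" for v
    by (rule tdiff_cong[OF assms(1) _ assms(3)[of v]]) (use frechet_derivative_at[OF assms(2)] in simp)
  moreover have "f differentiable (at x)" if "x \<in> S" for x
    using assms(2)[OF that] by (rule differentiableI)
  ultimately show ?thesis by simp
qed

lemma tdiff_SucD:
  assumes "tdiff (Suc k) S f"
  shows "tdiff k S f"
  using assms
proof (induction k arbitrary: f)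
  case 0
  then show ?case
    by (auto intro!: continuous_at_imp_continuous_on differentiable_imp_continuous_within)
next
  case (Suc k)
  then show ?case by auto
qed

lemma tdiff_subset: "tdiff k S f \<Longrightarrow> T \<subseteq> S \<Longrightarrow> tdiff k T f"
proof (induction k arbitrary: f)
  case 0
  then show ?case by (auto intro: continuous_on_subset)
qed auto

lemma tdiff_local:
  assumes "\<And>x. x \<in> S \<Longrightarrow> \<exists>T. open T \<and> x \<in> T \<and> tdiff k T f"
  shows "tdiff k S f"
  using assms
proof (induction k arbitrary: f)
  case 0
  show ?case unfolding times_differentiable_on.simps
  proof (rule continuous_at_imp_continuous_on, rule ballI)
    fix x assume "x \<in> S"
    then obtain T where "open T" "x \<in> T" "continuous_on T f" using 0 by auto
    then show "isCont f x" by (simp add: continuous_on_eq_continuous_at)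
  qed
next
  case (Suc k)
  have "\<exists>T. open T \<and> x \<in> T \<and> tdiff k T (\<lambda>x. frechet_derivative f (at x) v)" if "x \<in> S" for x v
    using Suc.prems[OF that] by auto
  then have "tdiff k S (\<lambda>x. frechet_derivative f (at x) v)" for v by (rule Suc.IH)
  moreover have "f differentiable (at x)" if "x \<in> S" for x using Suc.prems[OF that] by auto
  ultimately show ?case by simp
qed

lemma tdiff_const: "tdiff k S (\<lambda>x. c)"
proof (induction k arbitrary: c)
  case (Suc k)
  then show ?case by (simp del: frechet_derivative_const add: frechet_derivative_const)
qed auto

lemma tdiff_bounded_linear:
  assumes "bounded_linear L" "open S" "tdiff k S f"
  shows "tdiff k S (\<lambda>x. L (f x))"
  using assms(3)
proof (induction k arbitrary: f)
  case 0
  then show ?case by (auto intro: bounded_linear.continuous_on[OF assms(1)])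
next
  case (Suc k)
  show ?case
  proof (rule tdiff_SucI[OF assms(2)])
    show "((\<lambda>x. L (f x)) has_derivative (\<lambda>h. L (frechet_derivative f (at x) h))) (at x)" if "x \<in> S" for x
      using Suc.prems that
      by (intro bounded_linear.has_derivative[OF assms(1)]) (auto simp: frechet_derivative_works[symmetric])
    show "tdiff k S (\<lambda>x. L (frechet_derivative f (at x) v))" for v using Suc by auto
  qed
qed

lemma tdiff_id: assumes "open S" shows "tdiff k S (\<lambda>x. x)"
proof (cases k)
  case (Suc k)
  show ?thesis unfolding Suc
    by (rule tdiff_SucI[OF assms, where D = "\<lambda>x v. v"]) (auto simp: tdiff_const)
qed (auto simp: continuous_on_id)

lemma tdiff_linear:
  assumes "bounded_linear L" "open S" shows "tdiff k S L"
  using tdiff_bounded_linear[OF assms tdiff_id[OF assms(2)]] .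

lemma tdiff_add:
  assumes "open S" "tdiff k S f" "tdiff k S g"
  shows "tdiff k S (\<lambda>x. f x + g x)"
  using assms(2,3)
proof (induction k arbitrary: f g)
  case 0
  then show ?case by (simp add: continuous_on_add)
next
  case (Suc k)
  show ?case
  proof (rule tdiff_SucI[OF assms(1)])
    show "((\<lambda>x. f x + g x) has_derivative
        (\<lambda>h. frechet_derivative f (at x) h + frechet_derivative g (at x) h)) (at x)" if "x \<in> S" for x
      using Suc.prems that
      by (intro has_derivative_add) (auto simp: frechet_derivative_works[symmetric])
    show "tdiff k S (\<lambda>x. frechet_derivative f (at x) v + frechet_derivative g (at x) v)" for v
      using Suc by auto
  qed
qed

lemma tdiff_bilinear:
  assumes bl: "bounded_bilinear m" and S: "open S" and fg: "tdiff k S f" "tdiff k S g"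
  shows "tdiff k S (\<lambda>x. m (f x) (g x))"
  using fg
proof (induction k arbitrary: f g)
  case 0
  then show ?case by (simp add: bounded_bilinear.continuous_on[OF bl])
next
  case (Suc k)
  show ?case
  proof (rule tdiff_SucI[OF S])
    show "((\<lambda>x. m (f x) (g x)) has_derivative
        (\<lambda>h. m (f x) (frechet_derivative g (at x) h) + m (frechet_derivative f (at x) h) (g x))) (at x)"
      if "x \<in> S" for x
      using Suc.prems that
      by (intro bounded_bilinear.FDERIV[OF bl]) (auto simp: frechet_derivative_works[symmetric])
    show "tdiff k S (\<lambda>x. m (f x) (frechet_derivative g (at x) v) + m (frechet_derivative f (at x) v) (g x))" for v
      using Suc.prems tdiff_SucD[OF Suc.prems(1)] tdiff_SucD[OF Suc.prems(2)]
      by (intro tdiff_add S Suc.IH) auto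
  qed
qed

lemma tdiff_sum:
  assumes "open S" "\<And>i. i \<in> I \<Longrightarrow> tdiff k S (f i)"
  shows "tdiff k S (\<lambda>x. \<Sum>i\<in>I. f i x)"
  using assms(2)
proof (induction I rule: infinite_finite_induct)
  case (insert i I)
  then show ?case by (simp add: tdiff_add[OF assms(1)])
qed (simp_all add: tdiff_const)

lemmas tdiff_scaleR = tdiff_bilinear[OF bounded_bilinear_scaleR]
lemmas tdiff_inner_const = tdiff_bounded_linear[OF bounded_linear_inner_left]

lemma tdiff_componentwise:
  fixes f :: "'e::real_normed_vector \<Rightarrow> 'f::euclidean_space"
  assumes "open S" "\<And>b. b \<in> Basis \<Longrightarrow> tdiff k S (\<lambda>x. f x \<bullet> b)"
  shows "tdiff k S f"
proof -
  have "tdiff k S (\<lambda>x. \<Sum>b\<in>Basis. (f x \<bullet> b) *\<^sub>R b)"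
    using assms by (intro tdiff_sum tdiff_scaleR tdiff_const)
  then show ?thesis by (simp add: euclidean_representation)
qed

lemma linear_euclidean_sum:
  fixes L :: "'a::euclidean_space \<Rightarrow> 'b::real_vector"
  assumes "linear L"
  shows "L w = (\<Sum>b\<in>Basis. (w \<bullet> b) *\<^sub>R L b)"
  using arg_cong[OF euclidean_representation[of w], of L, symmetric]
  by (simp add: linear_sum[OF assms] linear_scale[OF assms])

text \<open>In the chain rule the direction \<open>frechet_derivative g (at x) v\<close> varies with
  \<open>x\<close>, whereas the induction hypothesis concerns derivatives of \<open>f\<close> in a
  fixed direction. Expanding the direction in a basis separates the two dependences.\<close>

lemma tdiff_compose:
  fixes g :: "'e::real_normed_vector \<Rightarrow> 'f::euclidean_space"
  assumes S: "open S" and T: "open T" and sub: "g ` S \<subseteq> T" and g: "tdiff k S g" and f: "tdiff k T f"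
  shows "tdiff k S (\<lambda>x. f (g x))"
  using f g
proof (induction k arbitrary: f)
  case 0
  then show ?case using sub by (auto intro: continuous_on_compose2)
next
  case (Suc k)
  have df: "(f has_derivative frechet_derivative f (at y)) (at y)" if "y \<in> T" for y
    using Suc.prems that by (simp add: frechet_derivative_works)
  have dg: "(g has_derivative frechet_derivative g (at x)) (at x)" if "x \<in> S" for x
    using Suc.prems that by (simp add: frechet_derivative_works)
  show ?case
  proof (rule tdiff_SucI[OF S])
    fix x assume x: "x \<in> S"
    then have y: "g x \<in> T" using sub by blast
    have "((\<lambda>x. f (g x)) has_derivative (\<lambda>h. frechet_derivative f (at (g x)) (frechet_derivative g (at x) h))) (at x)"
      using diff_chain_at[OF dg[OF x] df[OF y]] by (simp add: o_def)
    moreover have "linear (frechet_derivative f (at (g x)))"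
      using df[OF y] has_derivative_linear by blast
    ultimately show "((\<lambda>x. f (g x)) has_derivative
        (\<lambda>h. \<Sum>b\<in>Basis. (frechet_derivative g (at x) h \<bullet> b) *\<^sub>R frechet_derivative f (at (g x)) b)) (at x)"
      by (simp only: linear_euclidean_sum[symmetric])
  next
    fix v
    show "tdiff k S (\<lambda>x. \<Sum>b\<in>Basis. (frechet_derivative g (at x) v \<bullet> b) *\<^sub>R frechet_derivative f (at (g x)) b)"
    proof (intro tdiff_sum[OF S] tdiff_scaleR[OF S] tdiff_inner_const[OF S])
      show "tdiff k S (\<lambda>x. frechet_derivative g (at x) v)" using Suc.prems by auto
      show "tdiff k S (\<lambda>x. frechet_derivative f (at (g x)) b)" for b
        using Suc.IH[of "\<lambda>y. frechet_derivative f (at y) b"] Suc.prems tdiff_SucD[OF Suc.prems(2)] by auto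
    qed
  qed
qed

lemma tdiff_mult:
  fixes f g :: "_ \<Rightarrow> 'f::real_normed_algebra"
  shows "open S \<Longrightarrow> tdiff k S f \<Longrightarrow> tdiff k S g \<Longrightarrow> tdiff k S (\<lambda>x. f x * g x)"
  using tdiff_bilinear[OF bounded_bilinear_mult] .

lemma tdiff_exp: "open S \<Longrightarrow> tdiff k S (exp :: 'a::{banach,real_normed_field} \<Rightarrow> 'a)"
proof (induction k)
  case 0
  then show ?case by (simp add: continuous_on_exp)
next
  case (Suc k)
  show ?case
  proof (rule tdiff_SucI[OF Suc.prems])
    show "(exp has_derivative (\<lambda>h. exp x * h)) (at x)" for x :: 'a
      using DERIV_exp[of x] by (simp add: has_field_derivative_def)
    show "tdiff k S (\<lambda>x. exp x * v)" for v
      using Suc by (intro tdiff_mult tdiff_const)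
  qed
qed

lemma tdiff_inverse:
  fixes S :: "real set"
  assumes "open S" "0 \<notin> S" shows "tdiff k S inverse"
proof (induction k)
  case 0
  then show ?case using assms by (auto intro!: continuous_on_inverse continuous_on_id)
next
  case (Suc k)
  show ?case
  proof (rule tdiff_SucI[OF assms(1)])
    show "(inverse has_derivative (\<lambda>h. (inverse x * inverse x) * (- h))) (at x)" if "x \<in> S" for x
      using has_derivative_inverse'[of x UNIV] that assms(2) by (auto simp: mult_ac)
    show "tdiff k S (\<lambda>x. (inverse x * inverse x) * (- v))" for v
      using assms(1) Suc by (intro tdiff_mult tdiff_const)
  qed
qed

lemma tdiff_ln: "tdiff k {0<..} (ln :: real \<Rightarrow> real)"
proof (cases k)
  case 0
  then show ?thesis by (auto intro!: continuous_on_ln continuous_on_id)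
next
  case (Suc k)
  show ?thesis unfolding Suc
  proof (rule tdiff_SucI)
    show "(ln has_derivative (\<lambda>h. inverse x * h)) (at x)" if "x \<in> {0<..}" for x :: real
      using DERIV_ln[of x] that by (simp add: has_field_derivative_def)
    show "tdiff k {0<..} (\<lambda>x. inverse x * v)" for v :: real
      by (intro tdiff_mult tdiff_const tdiff_inverse) auto
  qed auto
qed

text \<open>Derivatives of members of this family are linear combinations of members, so all are smooth.\<close>

definition flat_bump :: "nat \<Rightarrow> real \<Rightarrow> real" where
  "flat_bump n x = (if x \<le> 0 then 0 else inverse x ^ n * exp (- inverse x))"

text \<open>Raise \<open>t / n \<le> exp (t / n)\<close> to the power \<open>n\<close>.\<close>

lemma power_le_exp:
  assumes "0 \<le> (t::real)" shows "t ^ n \<le> real n ^ n * exp t"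
proof (cases "n = 0")
  case False
  then have "t / n \<le> exp (t / n)" using exp_ge_add_one_self[of "t / n"] by linarith
  then have "(t / n) ^ n \<le> exp (t / n) ^ n" using assms by (intro power_mono) auto
  also have "\<dots> = exp t" using False by (simp add: exp_of_nat_mult[symmetric])
  finally show ?thesis using False by (simp add: power_divide field_simps)
qed (use assms in auto)

text \<open>Two extra powers of \<open>inverse x\<close> are absorbed by the exponential; the
  resulting quadratic bound gives the zero derivative at the origin.\<close>

lemma flat_bump_le: "\<bar>flat_bump n x\<bar> \<le> real (n + 2) ^ (n + 2) * x\<^sup>2"
proof (cases "x \<le> 0")
  case False
  then have x: "x > 0" by simp
  define t where "t = inverse x"
  have t: "t > 0" using x by (simp add: t_def)
  define C where "C = real (n + 2) ^ (n + 2)"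
  have "t ^ (n + 2) \<le> C * exp t" unfolding C_def using t by (intro power_le_exp) simp
  then have "t ^ (n + 2) * exp (- t) \<le> C * exp t * exp (- t)" by (rule mult_right_mono) simp
  also have "\<dots> = C" by (simp add: exp_minus)
  finally have "t ^ n * t\<^sup>2 * exp (- t) * x\<^sup>2 \<le> C * x\<^sup>2"
    unfolding power_add by (rule mult_right_mono) simp
  moreover have "t ^ n * t\<^sup>2 * exp (- t) * x\<^sup>2 = t ^ n * exp (- t)"
    using x by (simp add: t_def field_simps)
  moreover have "flat_bump n x = t ^ n * exp (- t)" using x by (simp add: flat_bump_def t_def)
  moreover have "0 \<le> t ^ n * exp (- t)" using t by simp
  ultimately show ?thesis by (simp only: C_def abs_of_nonneg)
qed (simp add: flat_bump_def)

lemma flat_bump_has_derivative: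
  "(flat_bump n has_derivative (\<lambda>h. (flat_bump (n + 2) x - real n * flat_bump (n + 1) x) * h)) (at x)"
proof (cases x "0 :: real" rule: linorder_cases)
  case less
  have "((\<lambda>x. 0) has_derivative (\<lambda>h. 0 * h)) (at x)" by simp
  then have "(flat_bump n has_derivative (\<lambda>h. 0 * h)) (at x)"
    by (rule has_derivative_transform_within_open[of _ _ _ _ "{..<0}"]) (use less in \<open>auto simp: flat_bump_def\<close>)
  then show ?thesis using less by (simp add: flat_bump_def)
next
  case equal
  define C where "C = real (n + 2) ^ (n + 2)"
  have "(flat_bump n has_derivative (\<lambda>h. 0)) (at 0)"
    unfolding has_derivative_at
  proof (intro conjI)
    have "(\<lambda>h. norm (flat_bump n (0 + h) - flat_bump n 0 - 0) / norm h) \<midarrow>0\<rightarrow> 0"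
    proof (rule Lim_null_comparison)
      show "\<forall>\<^sub>F h in at 0. norm (norm (flat_bump n (0 + h) - flat_bump n 0 - 0) / norm h) \<le> C * \<bar>h\<bar>"
      proof (rule always_eventually, rule allI)
        fix h :: real
        have "\<bar>flat_bump n h\<bar> \<le> C * h\<^sup>2" unfolding C_def by (rule flat_bump_le)
        also have "\<dots> = C * \<bar>h\<bar> * \<bar>h\<bar>" by (simp add: power2_eq_square)
        finally show "norm (norm (flat_bump n (0 + h) - flat_bump n 0 - 0) / norm h) \<le> C * \<bar>h\<bar>"
          by (cases "h = 0") (auto simp: flat_bump_def divide_le_eq C_def)
      qed
      have "((\<lambda>h. C * \<bar>h\<bar>) \<longlongrightarrow> C * \<bar>0\<bar>) (at (0::real))" by (intro tendsto_intros)
      then show "((\<lambda>h. C * \<bar>h\<bar>) \<longlongrightarrow> 0) (at (0::real))" by simp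
    qed
    then show "(\<lambda>h. norm (flat_bump n (0 + h) - flat_bump n 0 - 0) / norm h) \<midarrow>0\<rightarrow> 0" .
  qed auto
  then show ?thesis using equal by (simp add: flat_bump_def)
next
  case greater
  have "((\<lambda>x. inverse x ^ n * exp (- inverse x)) has_field_derivative
      (flat_bump (n + 2) x - real n * flat_bump (n + 1) x)) (at x)"
  proof -
    have "((\<lambda>x. inverse x ^ n) has_field_derivative - (real n * inverse x ^ (n + 1))) (at x)"
      using DERIV_power[OF DERIV_inverse[of x], of n] greater by (cases n) (auto simp: mult_ac)
    moreover have "((\<lambda>x. exp (- inverse x)) has_field_derivative exp (- inverse x) * inverse x ^ 2) (at x)"
      using greater by (auto intro!: derivative_eq_intros simp: power2_eq_square)
    ultimately have "((\<lambda>x. inverse x ^ n * exp (- inverse x)) has_field_derivative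
        - (real n * inverse x ^ (n + 1)) * exp (- inverse x) + exp (- inverse x) * inverse x ^ 2 * inverse x ^ n) (at x)"
      by (rule DERIV_mult)
    then show ?thesis
      by (rule DERIV_cong) (use greater in \<open>simp add: flat_bump_def algebra_simps power_add power2_eq_square\<close>)
  qed
  then have "((\<lambda>x. inverse x ^ n * exp (- inverse x)) has_derivative
      (\<lambda>h. (flat_bump (n + 2) x - real n * flat_bump (n + 1) x) * h)) (at x)"
    by (simp add: has_field_derivative_def)
  then show ?thesis
    by (rule has_derivative_transform_within_open[of _ _ _ _ "{0<..}"]) (use greater in \<open>auto simp: flat_bump_def\<close>)
qed

lemma tdiff_flat_bump: "tdiff k UNIV (flat_bump n)"
proof (induction k arbitrary: n)
  case 0
  then show ?case
    by (auto intro!: continuous_at_imp_continuous_on has_derivative_continuous[OF flat_bump_has_derivative])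
next
  case (Suc k)
  show ?case
  proof (rule tdiff_SucI[OF open_UNIV flat_bump_has_derivative])
    have "tdiff k UNIV (\<lambda>x. flat_bump (n + 2) x * v + flat_bump (n + 1) x * (- real n * v))" for v
      using Suc by (intro tdiff_add tdiff_mult tdiff_const) auto
    then show "tdiff k UNIV (\<lambda>x. (flat_bump (n + 2) x - real n * flat_bump (n + 1) x) * v)" for v
      by (simp add: algebra_simps)
  qed
qed

text \<open>A product rule in which one factor is merely continuous, made possible by the zero of
  the other factor. It allows the inverses of a family of linear maps to be differentiated when only
  their continuity is known.\<close>

lemma has_derivative_scaleR_zero:
  fixes \<phi> :: "'e::real_normed_vector \<Rightarrow> real" and \<psi> :: "'e \<Rightarrow> 'f::real_normed_vector"
  assumes cont: "isCont \<phi> x" and der: "(\<psi> has_derivative D) (at x)" and "\<psi> x = 0"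
  shows "((\<lambda>y. \<phi> y *\<^sub>R \<psi> y) has_derivative (\<lambda>h. \<phi> x *\<^sub>R D h)) (at x)"
proof -
  interpret D: bounded_linear D using der has_derivative_bounded_linear by blast
  obtain C where C: "\<And>h. norm (D h) \<le> norm h * C" using D.bounded by blast
  have "(\<lambda>h. norm (\<psi> (x + h) - D h) / norm h) \<midarrow>0\<rightarrow> 0"
    using der assms(3) by (simp add: has_derivative_at)
  then have "(\<lambda>h. norm ((\<psi> (x + h) - D h) /\<^sub>R norm h)) \<midarrow>0\<rightarrow> 0"
    by (simp add: divide_inverse mult.commute)
  then have 1: "(\<lambda>h. (\<psi> (x + h) - D h) /\<^sub>R norm h) \<midarrow>0\<rightarrow> 0"
    by (rule tendsto_norm_zero_cancel)
  have 2: "((\<lambda>h. \<phi> (x + h)) \<longlongrightarrow> \<phi> x) (at 0)"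
    using cont by (simp add: isCont_def LIM_offset_zero_iff[where a = x])
  have 3: "((\<lambda>h. (\<phi> (x + h) - \<phi> x) *\<^sub>R (D h /\<^sub>R norm h)) \<longlongrightarrow> 0) (at 0)"
  proof (rule Lim_null_comparison)
    show "\<forall>\<^sub>F h in at 0. norm ((\<phi> (x + h) - \<phi> x) *\<^sub>R (D h /\<^sub>R norm h)) \<le> \<bar>\<phi> (x + h) - \<phi> x\<bar> * C"
    proof (rule eventually_at_filter[THEN iffD2, rule_format], rule always_eventually, intro allI impI)
      fix h :: 'e assume "h \<noteq> 0"
      then have "norm (D h /\<^sub>R norm h) \<le> C" using C[of h] by (simp add: field_simps)
      then show "norm ((\<phi> (x + h) - \<phi> x) *\<^sub>R (D h /\<^sub>R norm h)) \<le> \<bar>\<phi> (x + h) - \<phi> x\<bar> * C"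
        unfolding norm_scaleR by (intro mult_left_mono) auto
    qed
    have "((\<lambda>h. \<bar>\<phi> (x + h) - \<phi> x\<bar> * C) \<longlongrightarrow> \<bar>\<phi> x - \<phi> x\<bar> * C) (at 0)"
      using 2 by (intro tendsto_intros)
    then show "((\<lambda>h. \<bar>\<phi> (x + h) - \<phi> x\<bar> * C) \<longlongrightarrow> 0) (at 0)" by simp
  qed
  have "((\<lambda>h. \<phi> (x + h) *\<^sub>R ((\<psi> (x + h) - D h) /\<^sub>R norm h) + (\<phi> (x + h) - \<phi> x) *\<^sub>R (D h /\<^sub>R norm h))
      \<longlongrightarrow> \<phi> x *\<^sub>R 0 + 0) (at 0)"
    using 1 2 3 by (intro tendsto_intros)
  moreover have "\<phi> (x + h) *\<^sub>R ((\<psi> (x + h) - D h) /\<^sub>R norm h) + (\<phi> (x + h) - \<phi> x) *\<^sub>R (D h /\<^sub>R norm h)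
      = (\<phi> (x + h) *\<^sub>R \<psi> (x + h) - \<phi> x *\<^sub>R D h) /\<^sub>R norm h" for h
    by (simp add: algebra_simps)
  ultimately have "(\<lambda>h. (\<phi> (x + h) *\<^sub>R \<psi> (x + h) - \<phi> x *\<^sub>R D h) /\<^sub>R norm h) \<midarrow>0\<rightarrow> 0" by simp
  from tendsto_norm_zero[OF this]
  have "(\<lambda>h. norm (\<phi> (x + h) *\<^sub>R \<psi> (x + h) - \<phi> x *\<^sub>R D h) / norm h) \<midarrow>0\<rightarrow> 0"
    by (simp add: divide_inverse mult.commute)
  moreover have "bounded_linear (\<lambda>h. \<phi> x *\<^sub>R D h)"
    using D.bounded_linear_axioms by (rule bounded_linear_const_scaleR)
  ultimately show ?thesis using assms(3) by (simp add: has_derivative_at)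
qed

section \<open>Inverses of families of linear maps, and the smooth inverse function theorem\<close>

context
  fixes V :: "'e::euclidean_space set" and A :: "'e \<Rightarrow> 'f::euclidean_space \<Rightarrow> 'f"
  assumes V: "open V" and lin: "\<And>y. y \<in> V \<Longrightarrow> linear (A y)" and bij: "\<And>y. y \<in> V \<Longrightarrow> bij (A y)"
begin

text \<open>\<open>A y0\<close> is bounded below by \<open>c\<close>, and
  \<open>\<epsilon> y\<close> bounds the distance from \<open>A y\<close> to \<open>A y0\<close>.
  Once this is below \<open>c / 2\<close>, the unknown term on the right of the estimate is absorbed
  on the left.\<close>

lemma inverse_family_continuous:
  assumes A: "\<And>v. continuous_on V (\<lambda>y. A y v)"
  shows "continuous_on V (\<lambda>y. inv (A y) v)"
  unfolding continuous_on_eq_continuous_at[OF V]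
proof
  fix y0 assume y0: "y0 \<in> V"
  let ?x = "\<lambda>y. inv (A y) v"
  define \<epsilon> where "\<epsilon> y = (\<Sum>b\<in>Basis. norm (A y b - A y0 b))" for y
  obtain c where c: "c > 0" "\<And>w. c * norm w \<le> norm (A y0 w)"
    using linear_inj_bounded_below_pos[OF lin[OF y0] bij_is_inj[OF bij[OF y0]]] by (metis mult.commute)
  have \<epsilon>: "norm (A y w - A y0 w) \<le> \<epsilon> y * norm w" if "y \<in> V" for y w
  proof -
    have "A y w - A y0 w = (\<Sum>b\<in>Basis. (w \<bullet> b) *\<^sub>R (A y b - A y0 b))"
      using linear_euclidean_sum[OF lin[OF that], of w] linear_euclidean_sum[OF lin[OF y0], of w]
      by (simp add: sum_subtractf scaleR_diff_right)
    also have "norm \<dots> \<le> (\<Sum>b\<in>Basis. norm w * norm (A y b - A y0 b))"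
      by (intro order_trans[OF norm_sum] sum_mono) (simp add: Basis_le_norm mult_right_mono)
    finally show ?thesis by (simp add: \<epsilon>_def sum_distrib_left mult.commute)
  qed
  have \<epsilon>0: "(\<epsilon> \<longlongrightarrow> 0) (at y0)"
  proof -
    have "((\<lambda>y. A y b) \<longlongrightarrow> A y0 b) (at y0)" for b
      using A[of b] y0 V by (metis continuous_on_eq_continuous_at isCont_def)
    then have "(\<epsilon> \<longlongrightarrow> (\<Sum>b\<in>Basis. norm (A y0 b - A y0 b))) (at y0)"
      unfolding \<epsilon>_def by (intro tendsto_intros)
    then show ?thesis by simp
  qed
  have "((\<lambda>y. ?x y - ?x y0) \<longlongrightarrow> 0) (at y0)"
  proof (rule Lim_null_comparison)
    have "\<forall>\<^sub>F y in at y0. \<epsilon> y < c / 2" using order_tendstoD(2)[OF \<epsilon>0, of "c / 2"] c(1) by simp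
    moreover have "\<forall>\<^sub>F y in at y0. y \<in> V" using V y0 by (rule eventually_at_in_open'[THEN eventually_mono]) auto
    ultimately show "\<forall>\<^sub>F y in at y0. norm (?x y - ?x y0) \<le> 2 / c * norm (?x y0) * \<epsilon> y"
    proof eventually_elim
      case (elim y)
      have Ax: "A y (?x y) = v" "A y0 (?x y0) = v"
        using bij elim(2) y0 by (simp_all add: bij_is_surj surj_f_inv_f)
      have "c * norm (?x y - ?x y0) \<le> norm (A y0 (?x y - ?x y0))" by (rule c(2))
      also have "A y0 (?x y - ?x y0) = A y0 (?x y) - A y (?x y)"
        using Ax by (simp add: linear_diff[OF lin[OF y0]])
      also have "norm \<dots> \<le> \<epsilon> y * norm (?x y)" using \<epsilon>[OF elim(2)] by (simp add: norm_minus_commute)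
      also have "\<dots> \<le> \<epsilon> y * (norm (?x y - ?x y0) + norm (?x y0))"
        using norm_triangle_sub[of "?x y" "?x y0"]
        by (intro mult_left_mono) (auto simp: \<epsilon>_def sum_nonneg add.commute)
      also have "\<dots> \<le> c / 2 * norm (?x y - ?x y0) + \<epsilon> y * norm (?x y0)"
        using mult_right_mono[of "\<epsilon> y" "c / 2" "norm (?x y - ?x y0)"] elim(1)
        by (simp only: distrib_left) simp
      finally have "c / 2 * norm (?x y - ?x y0) \<le> \<epsilon> y * norm (?x y0)" by simp
      then show ?case using c(1) by (simp add: field_simps)
    qed
    have "((\<lambda>y. 2 / c * norm (?x y0) * \<epsilon> y) \<longlongrightarrow> 2 / c * norm (?x y0) * 0) (at y0)"
      using \<epsilon>0 by (intro tendsto_intros)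
    then show "((\<lambda>y. 2 / c * norm (?x y0) * \<epsilon> y) \<longlongrightarrow> 0) (at y0)" by simp
  qed
  then show "isCont ?x y0" by (simp add: isCont_def LIM_zero_iff)
qed

text \<open>The derivative of the inverse contains only inverses and derivatives of the family, so
  in the expanded form \<open>D\<close> the order of differentiability rises by one at each
  induction step.\<close>

lemma tdiff_inverse_family:
  assumes "\<And>v. tdiff k V (\<lambda>y. A y v)"
  shows "tdiff k V (\<lambda>y. inv (A y) v)"
  using assms
proof (induction k arbitrary: v)
  case 0
  then show ?case using inverse_family_continuous by simp
next
  case (Suc k)
  have linv: "linear (inv (A y))" if "y \<in> V" for y
    using lin[OF that] bij[OF that] by (rule inj_linear_imp_inv_linear[OF _ bij_is_inj])
  have A0: "continuous_on V (\<lambda>y. A y v)" for v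
    using Suc.prems[of v] by (auto intro!: continuous_at_imp_continuous_on differentiable_imp_continuous_within)
  define E where "E b y h = frechet_derivative (\<lambda>y. A y b) (at y) h" for b y h
  have E: "((\<lambda>y. A y b) has_derivative E b y) (at y)" if "y \<in> V" for y b
    using Suc.prems[of b] that unfolding E_def by (simp add: frechet_derivative_works)
  have IH: "tdiff k V (\<lambda>y. inv (A y) w)" for w
    using Suc.IH tdiff_SucD[OF Suc.prems] by blast
  define D where "D y h = - (\<Sum>b\<in>Basis. \<Sum>c\<in>Basis. ((inv (A y) v \<bullet> b) * (E b y h \<bullet> c)) *\<^sub>R inv (A y) c)" for y h
  show ?case
  proof (rule tdiff_SucI[OF V])
    fix y0 assume y0: "y0 \<in> V"
    let ?x = "\<lambda>y. inv (A y) v" and ?i = "inv (A y0)"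
    \<comment> \<open>\<open>?x y = ?x y0 + ?i (R y)\<close>, because \<open>R y\<close> equals
      \<open>A y0 (?x y) - A y (?x y)\<close>. Each difference \<open>A y0 b - A y b\<close>
      vanishes at \<open>y0\<close>, so continuity of the coefficients is enough.\<close>
    define R where "R y = (\<Sum>b\<in>Basis. (?x y \<bullet> b) *\<^sub>R (A y0 b - A y b))" for y
    have bl: "bounded_linear ?i" using linv[OF y0] by (simp add: linear_conv_bounded_linear)
    have "isCont ?x y0" using inverse_family_continuous[OF A0] V y0 by (simp add: continuous_on_eq_continuous_at)
    then have "isCont (\<lambda>y. ?x y \<bullet> b) y0" for b by (intro continuous_intros)
    moreover have "((\<lambda>y. A y0 b - A y b) has_derivative (\<lambda>h. - E b y0 h)) (at y0)" for b
      using has_derivative_diff[OF has_derivative_const E[OF y0]] by simp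
    ultimately have "(R has_derivative (\<lambda>h. \<Sum>b\<in>Basis. (?x y0 \<bullet> b) *\<^sub>R (- E b y0 h))) (at y0)"
      unfolding R_def by (intro has_derivative_sum has_derivative_scaleR_zero) auto
    then have "((\<lambda>y. ?x y0 + ?i (R y)) has_derivative (\<lambda>h. 0 + ?i (\<Sum>b\<in>Basis. (?x y0 \<bullet> b) *\<^sub>R (- E b y0 h)))) (at y0)"
      by (rule has_derivative_add[OF has_derivative_const bounded_linear.has_derivative[OF bl]])
    moreover have "0 + ?i (\<Sum>b\<in>Basis. (?x y0 \<bullet> b) *\<^sub>R (- E b y0 h)) = D y0 h" for h
    proof -
      have "?i (E b y0 h) = (\<Sum>c\<in>Basis. (E b y0 h \<bullet> c) *\<^sub>R ?i c)" for b
        by (rule linear_euclidean_sum[OF linv[OF y0]])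
      then show ?thesis
        using linv[OF y0] by (simp add: D_def linear_sum linear_scale linear_neg scaleR_sum_right sum_negf)
    qed
    ultimately have "((\<lambda>y. ?x y0 + ?i (R y)) has_derivative D y0) (at y0)" by simp
    then show "(?x has_derivative D y0) (at y0)"
    proof (rule has_derivative_transform_within_open[OF _ V y0])
      fix y assume y: "y \<in> V"
      have "R y = A y0 (?x y) - A y (?x y)"
        using linear_euclidean_sum[OF lin[OF y], of "?x y"] linear_euclidean_sum[OF lin[OF y0], of "?x y"]
        by (simp add: R_def sum_subtractf scaleR_diff_right)
      then have "R y = A y0 (?x y) - v" using bij[OF y] by (simp add: bij_is_surj surj_f_inv_f)
      then show "?x y0 + ?i (R y) = ?x y"
        using linear_diff[OF linv[OF y0]] bij[OF y0] by (simp add: bij_is_inj)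
    qed
  next
    fix h
    have Eh: "tdiff k V (\<lambda>y. E b y h)" for b using Suc.prems[of b] by (simp add: E_def)
    have "tdiff k V (\<lambda>y. (\<Sum>b\<in>Basis. \<Sum>c\<in>Basis. ((inv (A y) v \<bullet> b) * (E b y h \<bullet> c)) *\<^sub>R inv (A y) c))"
      by (intro tdiff_sum tdiff_scaleR tdiff_mult tdiff_inner_const V IH Eh)
    from tdiff_bounded_linear[OF bounded_linear_minus[OF bounded_linear_ident] V this]
    show "tdiff k V (\<lambda>y. D y h)" by (simp add: D_def)
  qed
qed

end

text \<open>Bootstrapping: if \<open>g\<close> is differentiable \<open>k\<close> times, so is the
  family of derivatives of \<open>f\<close> along \<open>g\<close>, hence also the family of their
  inverses, which is the derivative of \<open>g\<close>. The formula for this derivative is exported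
  because complex linearity is later deduced from it.\<close>

theorem smooth_inverse_function:
  fixes f :: "'e::euclidean_space \<Rightarrow> 'e"
  assumes S: "open S" "x0 \<in> S" and f: "smooth_on S f" and inj: "inj (frechet_derivative f (at x0))"
  obtains U V g where "open U" "U \<subseteq> S" "x0 \<in> U" "open V" "f x0 \<in> V" "homeomorphism U V f g"
    "smooth_on V g"
    "\<And>y. y \<in> V \<Longrightarrow> bij (frechet_derivative f (at (g y)))"
    "\<And>y. y \<in> V \<Longrightarrow> (g has_derivative inv (frechet_derivative f (at (g y)))) (at y)"
proof -
  let ?D = "\<lambda>x. frechet_derivative f (at x)"
  have f1: "tdiff (Suc k) S f" for k using f by (simp add: smooth_on_def)
  have der: "(f has_derivative ?D x) (at x)" if "x \<in> S" for x
    using f1[of 0] that by (simp add: frechet_derivative_works)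
  define f' where "f' x = Blinfun (?D x)" for x
  have f': "blinfun_apply (f' x) = ?D x" if "x \<in> S" for x
    unfolding f'_def by (rule bounded_linear_Blinfun_apply) (use der[OF that] has_derivative_bounded_linear in blast)
  have lin: "linear (?D x)" if "x \<in> S" for x using der[OF that] has_derivative_linear by blast
  have cont: "continuous_on S f'"
  proof (rule continuous_on_blinfun_componentwise)
    fix i :: 'e
    have "continuous_on S (\<lambda>x. ?D x i)" using f1[of 0] by simp
    then show "continuous_on S (\<lambda>x. f' x i)" by (rule continuous_on_eq) (simp add: f')
  qed
  define invf where "invf = Blinfun (inv (?D x0))"
  have "bounded_linear (inv (?D x0))"
    using inj_linear_imp_inv_linear[OF lin[OF S(2)] inj] by (simp add: linear_conv_bounded_linear)
  then have "invf o\<^sub>L f' x0 = id_blinfun"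
    using f'[OF S(2)] inj by (intro blinfun_eqI) (simp add: invf_def bounded_linear_Blinfun_apply)
  moreover have "(f has_derivative blinfun_apply (f' x)) (at x)" if "x \<in> S" for x
    using der[OF that] f'[OF that] by simp
  ultimately obtain U V g g' where UV: "open U" "U \<subseteq> S" "x0 \<in> U" "open V" "f x0 \<in> V"
    and hom: "homeomorphism U V f g"
    and g': "\<And>y. y \<in> V \<Longrightarrow> (g has_derivative (g' y)) (at y)"
      "\<And>y. y \<in> V \<Longrightarrow> g' y = inv (blinfun_apply (f'(g y)))"
      "\<And>y. y \<in> V \<Longrightarrow> bij (blinfun_apply (f'(g y)))"
    using inverse_function_theorem[OF S(1) _ cont S(2)] by metis
  have gV: "g y \<in> U" if "y \<in> V" for y using hom that by (auto simp: homeomorphism_def)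
  then have gS: "g y \<in> S" if "y \<in> V" for y using UV that by blast
  have bij: "bij (?D (g y))" if "y \<in> V" for y using g'(3)[OF that] f'[OF gS[OF that]] by simp
  have derg: "(g has_derivative inv (?D (g y))) (at y)" if "y \<in> V" for y
    using g'(1,2)[OF that] f'[OF gS[OF that]] by simp
  have "tdiff k V g" for k
  proof (induction k)
    case 0
    then show ?case using hom by (simp add: homeomorphism_def)
  next
    case (Suc k)
    have "tdiff k V (\<lambda>y. inv (?D (g y)) v)" for v
    proof (rule tdiff_inverse_family[OF UV(4)])
      show "linear (?D (g y))" if "y \<in> V" for y by (rule lin[OF gS[OF that]])
      show "bij (?D (g y))" if "y \<in> V" for y by (rule bij[OF that])
      show "tdiff k V (\<lambda>y. ?D (g y) v)" for v
        by (rule tdiff_compose[OF UV(4) S(1) _ Suc]) (use f1[of k] gS in auto)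
    qed
    then show ?case using derg by (intro tdiff_SucI[OF UV(4)])
  qed
  then have "smooth_on V g" by (simp add: smooth_on_def)
  then show ?thesis using that UV hom bij derg by blast
qed

lemma tdiff_prod:
  fixes f :: "'i \<Rightarrow> 'e::real_normed_vector \<Rightarrow> 'f::{real_normed_algebra,comm_ring_1}"
  assumes "open S" "\<And>i. i \<in> I \<Longrightarrow> tdiff k S (f i)"
  shows "tdiff k S (\<lambda>x. \<Prod>i\<in>I. f i x)"
  using assms(2)
proof (induction I rule: infinite_finite_induct)
  case (insert i I)
  then show ?case by (simp add: tdiff_mult[OF assms(1)])
qed (simp_all add: tdiff_const)

lemma tdiff_vec:
  fixes f :: "'e::real_normed_vector \<Rightarrow> 'a::euclidean_space ^ 'i::finite"
  assumes "open S" "\<And>i. tdiff k S (\<lambda>x. f x $ i)"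
  shows "tdiff k S f"
proof (rule tdiff_componentwise[OF assms(1)])
  fix b :: "'a ^ 'i" assume "b \<in> Basis"
  then obtain i c where b: "b = axis i c" by (auto simp: Basis_vec_def)
  have "tdiff k S (\<lambda>x. f x $ i \<bullet> c)" by (intro tdiff_inner_const assms)
  then show "tdiff k S (\<lambda>x. f x \<bullet> b)" by (simp add: b inner_axis)
qed

lemma flat_bump_pos: "0 < x \<Longrightarrow> 0 < flat_bump n x"
  and flat_bump_nonneg: "0 \<le> flat_bump n x"
  by (simp_all add: flat_bump_def)

section \<open>A smooth equivariant map\<close>

context slice_data
begin

text \<open>The positive and negative parts of a kernel vector supported on the simplex
  \<open>J\<close> are cone points with equal image, hence equal, so the vector is zero. Forgetting
  the coordinates in \<open>J\<close> therefore loses nothing on the kernel.\<close>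

lemma kernel_restriction_left_inverse:
  assumes J: "J \<in> K"
  obtains \<pi> where "linear \<pi>" "\<And>u. \<pi> (\<chi> i. if i \<in> J then 0 else B u $ i) = u"
proof -
  interpret B: linear B by (rule B_linear)
  interpret L: linear "Lambda_R a" by (rule linear_Lambda_R)
  let ?f = "\<lambda>u. \<chi> i. if i \<in> J then 0 else B u $ i"
  have lin: "linear ?f" by (rule linearI) (auto simp: vec_eq_iff B.add B.scale)
  have "inj ?f"
  proof (rule linear_injective_0[OF lin, THEN iffD2], intro allI impI)
    fix u assume "?f u = 0"
    then have out: "B u $ i = 0" if "i \<notin> J" for i using that by (simp add: vec_eq_iff) metis
    define p where "p = (\<chi> i. max (B u $ i) 0)"
    define q where "q = (\<chi> i. max (- B u $ i) 0)"
    have "{i. p $ i \<noteq> 0} \<in> K" "{i. q $ i \<noteq> 0} \<in> K"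
      by (rule K_down[OF J]; use out in \<open>force simp: p_def q_def\<close>)+
    then have "p \<in> cone_points K" "q \<in> cone_points K" by (simp_all add: cone_points_def p_def q_def)
    moreover have Bu: "B u = p - q" by (simp add: vec_eq_iff p_def q_def max_def)
    then have "Lambda_R a p = Lambda_R a q" using Lambda_B[of u] by (simp add: L.diff)
    ultimately have "p = q" using Lambda_inj by (auto dest: inj_onD)
    then have "B u = B 0" using Bu by (simp add: B.zero)
    then show "u = 0" by (rule injD[OF B_inj])
  qed
  then obtain \<pi> where "linear \<pi>" "\<pi> \<circ> ?f = id" using linear_injective_left_inverse[OF lin] by blast
  then show ?thesis using that by (auto simp: fun_eq_iff)
qed

text \<open>One number serves both as a bound and, through \<open>exp (- M)\<close>, as a radius;
  \<open>1 \<le> M\<close> later accommodates the thresholds of \<open>weight\<close>.\<close>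

lemma norm_bounds_near:
  fixes z :: "complex ^ 'm"
  obtains M where "1 \<le> M"
    "\<And>z' i. dist z' z < exp (- M) \<Longrightarrow> norm (z' $ i) \<le> exp M"
    "\<And>z' i. dist z' z < exp (- M) \<Longrightarrow> z $ i \<noteq> 0 \<Longrightarrow> exp (- M) \<le> norm (z' $ i)"
proof -
  \<comment> \<open>The logarithm ensures \<open>exp (- M) \<le> norm (z $ i) / 2\<close>, which
    leaves the other half for the perturbation. At a zero coordinate it only enlarges
    \<open>M\<close>, if anything.\<close>
  define t where "t i = norm (z $ i) + 1 + \<bar>ln (norm (z $ i) / 2)\<bar>" for i
  define M where "M = (\<Sum>i\<in>UNIV. t i)"
  have t0: "t i \<ge> 1" for i by (simp add: t_def)
  have tM: "t i \<le> M" for i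
    unfolding M_def using t0 by (intro member_le_sum) (auto intro: order_trans[of 0 1])
  have M1: "1 \<le> M" using t0[of undefined] tM[of undefined] by linarith
  have comp: "norm (z' $ i - z $ i) < exp (- M)" if "dist z' z < exp (- M)" for z' i
    using that Finite_Cartesian_Product.norm_nth_le[of "z' - z" i] by (simp add: dist_norm)
  have "norm (z' $ i) \<le> exp M" if "dist z' z < exp (- M)" for z' i
  proof -
    have "norm (z' $ i) \<le> norm (z $ i) + exp (- M)"
      using comp[OF that, of i] norm_triangle_sub[of "z' $ i" "z $ i"] by linarith
    also have "exp (- M) \<le> 1" using M1 by simp
    also have "norm (z $ i) + 1 \<le> t i" by (simp add: t_def)
    also have "t i \<le> exp M" using tM[of i] exp_ge_add_one_self[of M] by linarith
    finally show ?thesis by simp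
  qed
  moreover have "exp (- M) \<le> norm (z' $ i)" if "dist z' z < exp (- M)" "z $ i \<noteq> 0" for z' i
  proof -
    have "- M \<le> ln (norm (z $ i) / 2)" using tM[of i] norm_ge_zero[of "z $ i"] unfolding t_def by linarith
    then have "exp (- M) \<le> exp (ln (norm (z $ i) / 2))" by (simp only: exp_le_cancel_iff)
    then have "exp (- M) \<le> norm (z $ i) / 2" using that by simp
    then show ?thesis
      using comp[OF that(1), of i] norm_triangle_sub[of "z $ i" "z' $ i"] by (simp add: norm_minus_commute)
  qed
  ultimately show ?thesis using that[of M] M1 by blast
qed

definition chart_domain :: "'m set \<Rightarrow> (complex ^ 'm) set" where
  "chart_domain J = {z. \<forall>i. i \<notin> J \<longrightarrow> z $ i \<noteq> 0}"

lemma open_chart_domain: "open (chart_domain J)"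
proof -
  have "chart_domain J = (\<Inter>i\<in>- J. {z. z $ i \<noteq> 0})" by (auto simp: chart_domain_def)
  then show ?thesis by (auto intro!: open_INT open_Collect_neq continuous_intros)
qed

text \<open>The squared modulus is a polynomial in the real coordinates, hence smooth; halving
  restores the logarithm of the modulus itself.\<close>

definition log_part :: "'m set \<Rightarrow> complex ^ 'm \<Rightarrow> real ^ 'm" where
  "log_part J z = (\<chi> i. if i \<in> J then 0 else ln ((norm (z $ i))\<^sup>2) / 2)"

text \<open>The choice of the left inverse is independent of \<open>z\<close>, so for a simplex
  \<open>J\<close> this is a linear function of \<open>log_part J z\<close>.\<close>

definition kernel_coord :: "'m set \<Rightarrow> complex ^ 'm \<Rightarrow> 'x" where
  "kernel_coord J z =
     (SOME \<pi>. linear \<pi> \<and> (\<forall>u. \<pi> (\<chi> i. if i \<in> J then 0 else B u $ i) = u)) (log_part J z)"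

text \<open>The squared modulus after \<open>z\<close> has been moved back by
  \<open>kernel_coord J z\<close>; on the chart domain it is therefore invariant under translations
  along the kernel.\<close>

definition level :: "'m set \<Rightarrow> complex ^ 'm \<Rightarrow> 'm \<Rightarrow> real" where
  "level J z i = (norm (z $ i))\<^sup>2 * exp (- 2 * B (kernel_coord J z) $ i)"

text \<open>At a translate in \<open>Z\<close>, and for a suitable \<open>J\<close>, the levels are
  at most one and exactly one outside \<open>J\<close>; the thresholds 2 and 1/2 leave room around
  these values. The lower threshold outside \<open>J\<close> keeps the support away from the
  boundary of the chart domain.\<close>

definition weight :: "'m set \<Rightarrow> complex ^ 'm \<Rightarrow> real" where
  "weight J z = (if z \<in> chart_domain J then
     (\<Prod>i\<in>UNIV. flat_bump 0 (2 - level J z i) * (if i \<in> J then 1 else flat_bump 0 (level J z i - 1 / 2)))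
     else 0)"

text \<open>On each chart domain a linear projection of the logarithms of the non-vanishing moduli is
  equivariant; these local maps are averaged with invariant weights.\<close>

definition equivariant_map :: "complex ^ 'm \<Rightarrow> 'x" where
  "equivariant_map z = inverse (\<Sum>J\<in>K. weight J z) *\<^sub>R (\<Sum>J\<in>K. weight J z *\<^sub>R kernel_coord J z)"

lemma kernel_coord_linear:
  assumes "J \<in> K"
  obtains \<pi> where "linear \<pi>" "\<And>z. kernel_coord J z = \<pi> (log_part J z)"
    "\<And>u. \<pi> (\<chi> i. if i \<in> J then 0 else B u $ i) = u"
proof -
  let ?P = "\<lambda>\<pi>. linear \<pi> \<and> (\<forall>u. \<pi> (\<chi> i. if i \<in> J then 0 else B u $ i) = u)"
  have "\<exists>\<pi>. ?P \<pi>" using kernel_restriction_left_inverse[OF assms] by metis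
  then have "?P (SOME \<pi>. ?P \<pi>)" by (rule someI_ex)
  then show ?thesis using that kernel_coord_def by blast
qed

lemma tdiff_norm_square: "tdiff k UNIV (\<lambda>z :: complex ^ 'm. (norm (z $ i))\<^sup>2)"
proof -
  have "tdiff k UNIV (\<lambda>z :: complex ^ 'm. z $ i)" by (intro tdiff_linear bounded_linear_vec_nth) auto
  then have "tdiff k UNIV (\<lambda>z :: complex ^ 'm. z $ i \<bullet> z $ i)"
    by (intro tdiff_bilinear[OF bounded_bilinear_inner]) auto
  then show ?thesis by (simp add: power2_norm_eq_inner)
qed

lemma tdiff_kernel_coord: assumes "J \<in> K" shows "tdiff k (chart_domain J) (kernel_coord J)"
proof -
  obtain \<pi> where \<pi>: "linear \<pi>" "\<And>z. kernel_coord J z = \<pi> (log_part J z)"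
    "\<And>u. \<pi> (\<chi> i. if i \<in> J then 0 else B u $ i) = u"
    by (rule kernel_coord_linear[OF assms]) (rule that)
  have "tdiff k (chart_domain J) (log_part J)"
  proof (rule tdiff_vec[OF open_chart_domain])
    fix i
    show "tdiff k (chart_domain J) (\<lambda>z. log_part J z $ i)"
    proof (cases "i \<in> J")
      case False
      have "tdiff k (chart_domain J) (\<lambda>z. ln ((norm (z $ i))\<^sup>2))"
        by (rule tdiff_compose[OF open_chart_domain _ _ tdiff_subset[OF tdiff_norm_square] tdiff_ln])
          (use False in \<open>auto simp: chart_domain_def\<close>)
      from tdiff_bounded_linear[OF bounded_linear_mult_right[of "1 / 2"] open_chart_domain this]
      show ?thesis using False by (simp add: log_part_def)
    qed (simp add: log_part_def tdiff_const)
  qed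
  moreover have "bounded_linear \<pi>" using \<pi>(1) by (simp add: linear_conv_bounded_linear)
  ultimately have "tdiff k (chart_domain J) (\<lambda>z. \<pi> (log_part J z))"
    using tdiff_bounded_linear open_chart_domain by blast
  moreover have "kernel_coord J = (\<lambda>z. \<pi> (log_part J z))" using \<pi>(2) by (rule ext)
  ultimately show ?thesis by simp
qed

lemma tdiff_level: assumes "J \<in> K" shows "tdiff k (chart_domain J) (\<lambda>z. level J z i)"
proof -
  have "linear (\<lambda>u. - 2 * B u $ i)"
    using B_linear by (intro linearI) (auto simp: linear_add linear_scale algebra_simps)
  then have g: "tdiff k (chart_domain J) (\<lambda>z. - 2 * B (kernel_coord J z) $ i)"
    using tdiff_bounded_linear[OF _ open_chart_domain tdiff_kernel_coord[OF assms]]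
    unfolding linear_conv_bounded_linear by blast
  have "tdiff k (chart_domain J) (\<lambda>z. exp (- 2 * B (kernel_coord J z) $ i))"
    by (rule tdiff_compose[OF open_chart_domain open_UNIV _ g tdiff_exp]) auto
  then show ?thesis
    unfolding level_def
    by (intro tdiff_mult open_chart_domain tdiff_subset[OF tdiff_norm_square]) auto
qed

lemma tdiff_weight_chart: assumes "J \<in> K" shows "tdiff k (chart_domain J) (weight J)"
proof (rule tdiff_cong[OF open_chart_domain])
  have b: "tdiff k (chart_domain J) (\<lambda>z. flat_bump 0 (c * level J z i + d))" for c d i
  proof (rule tdiff_compose[OF open_chart_domain open_UNIV _ _ tdiff_flat_bump])
    show "tdiff k (chart_domain J) (\<lambda>z. c * level J z i + d)"
      by (intro tdiff_add tdiff_mult tdiff_const open_chart_domain tdiff_level assms)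
  qed auto
  have b1: "tdiff k (chart_domain J) (\<lambda>z. flat_bump 0 (2 - level J z i))" for i
    using b[of "-1" i 2] by simp
  have b2: "tdiff k (chart_domain J) (\<lambda>z. if i \<in> J then 1 else flat_bump 0 (level J z i - 1 / 2))" for i
    using b[of 1 i "- (1/2)"] by (cases "i \<in> J") (auto simp: tdiff_const)
  show "tdiff k (chart_domain J) (\<lambda>z. \<Prod>i\<in>UNIV. flat_bump 0 (2 - level J z i) *
      (if i \<in> J then 1 else flat_bump 0 (level J z i - 1 / 2)))"
    by (intro tdiff_prod tdiff_mult open_chart_domain b1 b2)
qed (simp add: weight_def)

text \<open>Suppose that \<open>z'\<close> near \<open>z\<close> has nonzero weight. Moved back by
  \<open>u = kernel_coord J z'\<close> it has moduli controlled by the thresholds, so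
  \<open>translation_bound\<close> limits \<open>u\<close>. This keeps \<open>z' $ j\<close> away
  from zero for an index \<open>j\<close> outside \<open>J\<close> with \<open>z $ j = 0\<close>, a
  contradiction.\<close>

lemma weight_vanishes_near:
  assumes J: "J \<in> K" and z: "z \<in> U" "z \<notin> chart_domain J"
  shows "\<exists>\<epsilon>>0. \<forall>z'\<in>ball z \<epsilon>. weight J z' = 0"
proof -
  obtain M where M: "1 \<le> M"
    "\<And>z' i. dist z' z < exp (- M) \<Longrightarrow> norm (z' $ i) \<le> exp M"
    "\<And>z' i. dist z' z < exp (- M) \<Longrightarrow> z $ i \<noteq> 0 \<Longrightarrow> exp (- M) \<le> norm (z' $ i)"
    using norm_bounds_near[of z] by blast
  obtain C where C: "C > 0"
    "\<And>M z x u. 0 \<le> M \<Longrightarrow> log_bounded M z \<Longrightarrow> log_bounded M x \<Longrightarrow>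
      (\<And>i. norm (z $ i) = exp (B u $ i) * norm (x $ i)) \<Longrightarrow> norm u \<le> C * M"
    using translation_bound by blast
  obtain D where D: "D > 0" "\<And>u. norm (B u) \<le> D * norm u"
    using linear_bounded_pos[OF B_linear] by blast
  obtain j where j: "j \<notin> J" "z $ j = 0" using z(2) by (auto simp: chart_domain_def)
  \<comment> \<open>A lower bound for \<open>norm (z' $ j)\<close>: the normalised point has modulus
    at least \<open>exp (- M)\<close> there, and the other factor is the least one that a
    translation of size \<open>C * M\<close> can contribute.\<close>
  define \<delta> where "\<delta> = exp (- (D * (C * M))) * exp (- M)"
  define \<epsilon> where "\<epsilon> = min (exp (- M)) \<delta>"
  have e1: "exp 1 \<ge> (2::real)" using exp_ge_add_one_self[of 1] by simp
  \<comment> \<open>Levels are squared moduli, so the thresholds are compared with squares; this is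
    where \<open>1 \<le> M\<close> enters.\<close>
  have e2: "(2::real) \<le> (exp M)\<^sup>2" "(exp (- M))\<^sup>2 \<le> (1 / 2 :: real)"
  proof -
    have "exp 1 \<le> exp (2 * M)" using M(1) by simp
    then show 2: "(2::real) \<le> (exp M)\<^sup>2" using e1 by (simp add: exp_double)
    then show "(exp (- M))\<^sup>2 \<le> (1 / 2 :: real)" by (simp add: exp_minus power_inverse field_simps)
  qed
  have "weight J z' = 0" if z': "z' \<in> ball z \<epsilon>" for z'
  proof (rule ccontr)
    assume w: "weight J z' \<noteq> 0"
    then have dom: "z' \<in> chart_domain J" by (auto simp: weight_def split: if_splits)
    have prodnz: "flat_bump 0 (2 - level J z' i) * (if i \<in> J then 1 else flat_bump 0 (level J z' i - 1 / 2)) \<noteq> 0" for i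
      using w dom by (simp add: weight_def)
    have lev: "level J z' i \<le> 2" "i \<notin> J \<Longrightarrow> 1 / 2 \<le> level J z' i" for i
      using prodnz[of i] by (auto simp: flat_bump_def split: if_splits)
    define u where "u = kernel_coord J z'"
    define x where "x = (\<chi> i. complex_of_real (exp (- B u $ i)) * z' $ i)"
    have xlev: "(norm (x $ i))\<^sup>2 = level J z' i" for i
    proof -
      have "(exp (- B u $ i))\<^sup>2 = exp (- 2 * B u $ i)" using exp_double[of "- B u $ i"] by simp
      then show ?thesis by (simp add: x_def norm_mult power_mult_distrib level_def u_def)
    qed
    have d: "dist z' z < exp (- M)" "dist z' z < \<delta>" using z' by (auto simp: \<epsilon>_def dist_commute)
    have xM: "exp (- M) \<le> norm (x $ i)" if "i \<notin> J" for i
      by (rule power2_le_imp_le) (use lev(2)[OF that] e2(2) xlev[of i] in auto)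
    have "norm (x $ i) = exp (- B u $ i) * norm (z' $ i)" for i by (simp add: x_def norm_mult)
    then have zx: "norm (z' $ i) = exp (B u $ i) * norm (x $ i)" for i
      by (simp add: exp_minus field_simps)
    have "norm u \<le> C * M"
    proof (rule C(2))
      have "{i. z $ i = 0} \<in> K" using z(1) by (simp add: U_iff)
      then have "{i. norm (z' $ i) < exp (- M)} \<in> K"
        by (rule K_down) (use M(3)[OF d(1)] in \<open>auto simp: not_le[symmetric]\<close>)
      then show "log_bounded M z'" using M(2)[OF d(1)] by (simp add: log_bounded_def)
      have "{i. norm (x $ i) < exp (- M)} \<in> K"
        by (rule K_down[OF J]) (use xM in \<open>auto simp: not_le[symmetric]\<close>)
      moreover have "norm (x $ i) \<le> exp M" for i
        by (rule power2_le_imp_le) (use lev(1)[of i] e2(1) xlev[of i] in auto)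
      ultimately show "log_bounded M x" by (simp add: log_bounded_def)
    qed (use M(1) zx in auto)
    then have "norm (B u) \<le> D * (C * M)" using D by (meson mult_le_cancel_left_pos order_trans)
    then have "- (D * (C * M)) \<le> B u $ j" using component_le_norm_cart[of "B u" j] by linarith
    then have "exp (- (D * (C * M))) * exp (- M) \<le> exp (B u $ j) * norm (x $ j)"
      using xM[OF j(1)] by (intro mult_mono) auto
    then have "\<delta> \<le> norm (z' $ j)" by (simp add: \<delta>_def zx)
    moreover have "norm (z' $ j) \<le> dist z' z" using Finite_Cartesian_Product.norm_nth_le[of "z' - z" j] j by (simp add: dist_norm)
    ultimately show False using d(2) by linarith
  qed
  moreover have "\<epsilon> > 0" by (simp add: \<epsilon>_def \<delta>_def)
  ultimately show ?thesis by blast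
qed

text \<open>The values of \<open>f\<close> off the chart domain do no harm: near each point of
  \<open>U\<close> outside it the weight vanishes identically.\<close>

lemma tdiff_extend_weight:
  fixes f :: "complex ^ 'm \<Rightarrow> 'y::euclidean_space"
  assumes J: "J \<in> K" and f: "tdiff k (chart_domain J) f"
  shows "tdiff k U (\<lambda>z. weight J z *\<^sub>R f z)"
proof (rule tdiff_local)
  fix z assume z: "z \<in> U"
  show "\<exists>T. open T \<and> z \<in> T \<and> tdiff k T (\<lambda>z. weight J z *\<^sub>R f z)"
  proof (cases "z \<in> chart_domain J")
    case True
    have "tdiff k (chart_domain J) (\<lambda>z. weight J z *\<^sub>R f z)"
      by (intro tdiff_scaleR open_chart_domain tdiff_weight_chart J f)
    then show ?thesis using True open_chart_domain by blast
  next
    case False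
    then obtain \<epsilon> where \<epsilon>: "\<epsilon> > 0" "\<forall>z'\<in>ball z \<epsilon>. weight J z' = 0"
      using weight_vanishes_near[OF J z] by blast
    have "tdiff k (ball z \<epsilon>) (\<lambda>z. weight J z *\<^sub>R f z)"
      by (rule tdiff_cong[OF _ _ tdiff_const[of _ _ 0]]) (use \<epsilon> in auto)
    then show ?thesis using \<epsilon>(1) by (intro exI[of _ "ball z \<epsilon>"]) auto
  qed
qed

text \<open>The hypothesis speaks of moduli only, so the same lemma serves every action with real
  part \<open>B\<close> and, with \<open>u = 0\<close>, the torus.\<close>

lemma kernel_coord_equivariant:
  assumes J: "J \<in> K" and z: "z \<in> chart_domain J"
    and zz': "\<And>i. norm (z' $ i) = exp (B u $ i) * norm (z $ i)"
  shows "kernel_coord J z' = kernel_coord J z + u"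
proof -
  obtain \<pi> where \<pi>: "linear \<pi>" "\<And>z. kernel_coord J z = \<pi> (log_part J z)"
    "\<And>u. \<pi> (\<chi> i. if i \<in> J then 0 else B u $ i) = u"
    by (rule kernel_coord_linear[OF J]) (rule that)
  have "log_part J z' = log_part J z + (\<chi> i. if i \<in> J then 0 else B u $ i)"
    using z by (auto simp: vec_eq_iff log_part_def zz' chart_domain_def power_mult_distrib ln_mult
        exp_double[symmetric] ln_realpow)
  then show ?thesis using \<pi> by (simp add: linear_add)
qed

text \<open>The factor \<open>exp (2 * B u $ i)\<close> gained by the squared modulus is cancelled
  by the shift of \<open>kernel_coord\<close>.\<close>

lemma weight_invariant:
  assumes J: "J \<in> K" and zz': "\<And>i. norm (z' $ i) = exp (B u $ i) * norm (z $ i)"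
  shows "weight J z' = weight J z"
proof -
  have nz: "z' $ i = 0 \<longleftrightarrow> z $ i = 0" for i
    using zz'[of i] by (metis exp_not_eq_zero mult_eq_0_iff norm_eq_zero)
  then have dom: "z' \<in> chart_domain J \<longleftrightarrow> z \<in> chart_domain J" by (simp add: chart_domain_def)
  have "level J z' i = level J z i" if "z \<in> chart_domain J" for i
  proof -
    have "(exp (B u $ i))\<^sup>2 * exp (- 2 * B u $ i) = 1"
      by (simp add: exp_double[symmetric] exp_add[symmetric])
    moreover have "exp (- 2 * B (kernel_coord J z') $ i)
        = exp (- 2 * B (kernel_coord J z) $ i) * exp (- 2 * B u $ i)"
      unfolding kernel_coord_equivariant[OF J that zz'] linear_add[OF B_linear]
      by (simp add: exp_add[symmetric] distrib_left)
    then have "level J z' i = level J z i * ((exp (B u $ i))\<^sup>2 * exp (- 2 * B u $ i))"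
      unfolding level_def zz' power_mult_distrib by (simp only: mult_ac)
    ultimately show ?thesis by simp
  qed
  then have "level J z' = level J z" if "z \<in> chart_domain J" using that by (intro ext)
  then show ?thesis using dom by (simp add: weight_def cong: if_cong)
qed

lemma weight_nonneg: "0 \<le> weight J z"
  by (auto simp: weight_def intro!: prod_nonneg mult_nonneg_nonneg flat_bump_nonneg)

text \<open>Take for \<open>J\<close> the support of the cone point found by
  \<open>translate_into_Z\<close>. All moduli of the translate outside \<open>J\<close> are one, so
  its \<open>kernel_coord\<close> is zero and its levels are plain squared moduli, strictly within
  the thresholds.\<close>

lemma weights_pos: assumes z: "z \<in> U" shows "0 < (\<Sum>J\<in>K. weight J z)"
proof -
  obtain u p where p: "p \<in> cone_points K"
    and up: "\<And>i. exp (B u $ i) * norm (z $ i) = (if z $ i = 0 then 0 else exp (- p $ i))"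
    and pz: "\<And>i. z $ i = 0 \<Longrightarrow> p $ i \<noteq> 0"
    using translate_into_Z[OF z] by metis
  define J where "J = {i. p $ i \<noteq> 0}"
  have J: "J \<in> K" and p0: "\<And>i. 0 \<le> p $ i" using p by (auto simp: cone_points_def J_def)
  have dom: "z \<in> chart_domain J" using pz by (auto simp: chart_domain_def J_def)
  define x where "x = (\<chi> i. complex_of_real (exp (B u $ i)) * z $ i)"
  have nx: "norm (x $ i) = exp (B u $ i) * norm (z $ i)" for i by (simp add: x_def norm_mult)
  have nx1: "norm (x $ i) = 1" if "i \<notin> J" for i
    unfolding nx up using that pz[of i] by (auto simp: J_def)
  obtain \<pi> where \<pi>: "linear \<pi>" "\<And>z. kernel_coord J z = \<pi> (log_part J z)"
    "\<And>u. \<pi> (\<chi> i. if i \<in> J then 0 else B u $ i) = u"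
    by (rule kernel_coord_linear[OF J]) (rule that)
  have "log_part J x = 0" using nx1 by (simp add: vec_eq_iff log_part_def)
  then have kx: "kernel_coord J x = 0" using \<pi> by (simp add: linear_0)
  have lev: "level J x i = (norm (x $ i))\<^sup>2" for i
    by (simp add: level_def kx linear_0[OF B_linear])
  have le1: "norm (x $ i) \<le> 1" for i unfolding nx up using p0[of i] by auto
  have "x \<in> chart_domain J" using dom by (simp add: chart_domain_def x_def)
  moreover have "0 < flat_bump 0 (2 - level J x i) * (if i \<in> J then 1 else flat_bump 0 (level J x i - 1 / 2))" for i
  proof -
    have "level J x i \<le> 1" unfolding lev using le1[of i] by (simp add: power_le_one)
    moreover have "i \<notin> J \<Longrightarrow> level J x i = 1" unfolding lev using nx1 by simp
    ultimately show ?thesis by (auto intro!: mult_pos_pos flat_bump_pos)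
  qed
  ultimately have "0 < weight J x" by (auto simp: weight_def intro!: prod_pos)
  then have "0 < weight J z" using weight_invariant[OF J nx] by simp
  then show ?thesis using J by (intro sum_pos2[of _ J]) (auto simp: weight_nonneg)
qed

lemma smooth_equivariant_map: "smooth_on U equivariant_map"
  unfolding smooth_on_def
proof
  fix k
  have w: "tdiff k U (weight J)" if "J \<in> K" for J
    using tdiff_extend_weight[OF that tdiff_const[of _ _ "1::real"]] by simp
  have g: "tdiff k U (\<lambda>z. \<Sum>J\<in>K. weight J z)" by (intro tdiff_sum open_U_space w)
  have "tdiff k U (\<lambda>z. inverse (\<Sum>J\<in>K. weight J z))"
    by (rule tdiff_compose[OF open_U_space _ _ g tdiff_inverse[of "{0<..}"]]) (use weights_pos in auto)
  moreover have "tdiff k U (\<lambda>z. \<Sum>J\<in>K. weight J z *\<^sub>R kernel_coord J z)"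
    by (intro tdiff_sum open_U_space tdiff_extend_weight tdiff_kernel_coord)
  ultimately have "tdiff k U (\<lambda>z. inverse (\<Sum>J\<in>K. weight J z) *\<^sub>R (\<Sum>J\<in>K. weight J z *\<^sub>R kernel_coord J z))"
    by (intro tdiff_scaleR open_U_space)
  then show "tdiff k U equivariant_map" by (simp add: equivariant_map_def[abs_def])
qed

text \<open>An average, with invariant weights of positive sum, of local maps that all shift by
  \<open>u\<close>.\<close>

lemma equivariant_map_eq:
  assumes z: "z \<in> U" and zz': "\<And>i. norm (z' $ i) = exp (B u $ i) * norm (z $ i)"
  shows "equivariant_map z' = equivariant_map z + u"
proof -
  have "weight J z' *\<^sub>R kernel_coord J z' = weight J z *\<^sub>R kernel_coord J z + weight J z *\<^sub>R u" if "J \<in> K" for J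
  proof (cases "z \<in> chart_domain J")
    case True
    then show ?thesis
      using weight_invariant[OF that zz'] kernel_coord_equivariant[OF that True zz'] by (simp add: scaleR_add_right)
  next
    case False
    then have "weight J z = 0" by (simp add: weight_def)
    then show ?thesis using weight_invariant[OF that zz'] by simp
  qed
  moreover have "(\<Sum>J\<in>K. weight J z') = (\<Sum>J\<in>K. weight J z)"
    using weight_invariant[OF _ zz'] by simp
  ultimately show ?thesis
    using weights_pos[OF z]
    by (simp add: equivariant_map_def sum.distrib scaleR_add_right scaleR_sum_left[symmetric])
qed

end

section \<open>The action and its orbit space\<close>

lemma vexp_nth [simp]: "vexp x $ i = exp (x $ i)"
  by (simp add: vexp_def)

lemma vexp_add: "vexp (x + y) = vexp x * vexp (y :: complex ^ 'm::finite)"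
  by (simp add: vec_eq_iff exp_add)

lemma vexp_0 [simp]: "vexp 0 = (1 :: complex ^ 'm::finite)"
  by (simp add: vec_eq_iff)

lemma tdiff_vexp:
  fixes S :: "(complex ^ 'm::finite) set"
  assumes "open S" shows "tdiff k S vexp"
proof (rule tdiff_vec[OF assms])
  fix i
  have "tdiff k S (\<lambda>x. x $ i)" using assms by (intro tdiff_linear bounded_linear_vec_nth)
  from tdiff_compose[OF assms open_UNIV _ this tdiff_exp] show "tdiff k S (\<lambda>x. vexp x $ i)" by simp
qed

lemma bounded_bilinear_vec_mult: "bounded_bilinear ((*) :: complex ^ 'm::finite \<Rightarrow> complex ^ 'm \<Rightarrow> complex ^ 'm)"
proof -
  have "linear (\<lambda>x. x * (y :: complex ^ 'm))" "linear (\<lambda>x. (y :: complex ^ 'm) * x)" for y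
    by (auto intro!: linearI simp: vec_eq_iff algebra_simps)
  then show ?thesis by (simp add: bilinear_conv_bounded_bilinear[symmetric] bilinear_def)
qed

lemmas tdiff_vec_mult = tdiff_bilinear[OF bounded_bilinear_vec_mult]

text \<open>The imaginary part of \<open>H\<close> only rotates the coordinates; moduli change
  through \<open>B\<close> alone.\<close>

locale slice_action = slice_data a K B
  for a :: "'m::finite \<Rightarrow> 'v::euclidean_space" and K and B :: "'x::euclidean_space \<Rightarrow> real ^ 'm" +
  fixes H :: "'x \<Rightarrow> complex ^ 'm"
  assumes H_linear: "linear H" and Re_H: "Re_vec (H u) = B u"
begin

abbreviation "G \<equiv> vexp ` range H"
abbreviation "W \<equiv> equivariant_map"
abbreviation "pr \<equiv> orbit G"
abbreviation "X \<equiv> orbit_space G U"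

definition act :: "'x \<Rightarrow> complex ^ 'm \<Rightarrow> complex ^ 'm" where
  "act u z = vexp (H u) * z"

text \<open>The projection along orbits onto the zero set of \<open>W\<close> in
  \<open>U\<close>.\<close>

definition slice :: "complex ^ 'm \<Rightarrow> complex ^ 'm" where
  "slice z = act (- W z) z"

lemma act_0 [simp]: "act 0 z = z"
  by (simp add: act_def linear_0[OF H_linear])

lemma act_add: "act (u + v) z = act u (act v z)"
  by (simp add: act_def linear_add[OF H_linear] vexp_add mult.assoc)

lemma act_minus [simp]: "act (- u) (act u z) = z" "act u (act (- u) z) = z"
  by (simp_all add: act_add[symmetric])

lemma norm_act: "norm (act u z $ i) = exp (B u $ i) * norm (z $ i)"
proof -
  have "Re (H u $ i) = B u $ i" using Re_H[of u] by (simp add: Re_vec_def vec_eq_iff)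
  then show ?thesis by (simp add: act_def norm_mult)
qed

lemma act_in_U: "z \<in> U \<Longrightarrow> act u z \<in> U"
  by (simp add: U_iff act_def)

lemma act_in_U_iff [simp]: "act u z \<in> U \<longleftrightarrow> z \<in> U"
  by (simp add: U_iff act_def)

lemma W_act: "z \<in> U \<Longrightarrow> W (act u z) = W z + u"
  by (rule equivariant_map_eq) (simp_all add: norm_act)

lemma act_free: "z \<in> U \<Longrightarrow> act u z = act v z \<Longrightarrow> u = v"
  by (metis W_act add_left_cancel)

lemma slice_in_U [simp]: "slice z \<in> U \<longleftrightarrow> z \<in> U"
  by (simp add: slice_def)

lemma W_slice: "z \<in> U \<Longrightarrow> W (slice z) = 0"
  by (simp add: slice_def W_act)

lemma slice_act: "z \<in> U \<Longrightarrow> slice (act u z) = slice z"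
  by (simp add: slice_def W_act act_add[symmetric])

lemma orbit_eq: "pr z = range (\<lambda>u. act u z)"
  by (auto simp: orbit_def act_def)

lemma orbit_self: "z \<in> pr z"
  unfolding orbit_eq by (rule range_eqI[of _ _ 0]) simp

lemma orbit_act [simp]: "pr (act u z) = pr z"
proof
  have sub: "pr (act u z) \<subseteq> pr z" for u z
    unfolding orbit_eq using rangeI[of "\<lambda>u. act u z"] by (auto simp: act_add[symmetric])
  show "pr (act u z) \<subseteq> pr z" by (rule sub)
  show "pr z \<subseteq> pr (act u z)" using sub[of "- u" "act u z"] by simp
qed

lemma orbit_slice [simp]: "pr (slice z) = pr z"
  by (simp add: slice_def)

lemma orbit_eq_iff: "pr z = pr z' \<longleftrightarrow> (\<exists>u. z' = act u z)"
proof
  assume "pr z = pr z'"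
  then have "z' \<in> pr z" using orbit_self by simp
  then show "\<exists>u. z' = act u z" by (auto simp: orbit_eq)
qed auto

lemma orbit_eq_iff_slice: "z \<in> U \<Longrightarrow> z' \<in> U \<Longrightarrow> pr z = pr z' \<longleftrightarrow> slice z = slice z'"
  by (metis orbit_eq_iff orbit_slice slice_act)

lemma free: "free_action G U"
  unfolding free_action_def
proof (intro ballI impI)
  fix g z assume "g \<in> G" "z \<in> U" "g * z = z"
  then obtain u where u: "g = vexp (H u)" by auto
  then have "act u z = act 0 z" using \<open>g * z = z\<close> by (simp add: act_def linear_0[OF H_linear])
  then have "u = 0" using act_free \<open>z \<in> U\<close> by blast
  then show "g = 1" using u by (simp add: linear_0[OF H_linear])
qed

lemma group_action: "mult_group_action G U"
  unfolding mult_group_action_def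
proof (intro conjI ballI)
  have "vexp (H 0) \<in> G" by blast
  then show "1 \<in> G" by (simp add: linear_0[OF H_linear])
next
  fix g h assume "g \<in> G" "h \<in> G"
  then obtain u v where "g = vexp (H u)" "h = vexp (H v)" by auto
  then have "g * h = vexp (H (u + v))" by (simp add: linear_add[OF H_linear] vexp_add)
  then show "g * h \<in> G" by auto
next
  fix g assume "g \<in> G"
  then obtain u where "g = vexp (H u)" by auto
  then have "g * vexp (H (- u)) = 1" by (simp add: linear_neg[OF H_linear] vexp_add[symmetric])
  then show "\<exists>h\<in>G. g * h = 1" by blast
next
  fix g z assume "g \<in> G" "z \<in> U"
  then obtain u where "g = vexp (H u)" by auto
  then show "g * z \<in> U" using act_in_U[OF \<open>z \<in> U\<close>, of u] by (simp add: act_def)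
qed

lemma tdiff_act:
  fixes f :: "'e::real_normed_vector \<Rightarrow> 'x" and g :: "'e \<Rightarrow> complex ^ 'm"
  assumes "open S" "tdiff k S f" "tdiff k S g"
  shows "tdiff k S (\<lambda>x. act (f x) (g x))"
proof -
  have "bounded_linear H" using H_linear by (simp add: linear_conv_bounded_linear)
  then have "tdiff k S (\<lambda>x. H (f x))" by (rule tdiff_bounded_linear[OF _ assms(1,2)])
  from tdiff_compose[OF assms(1) open_UNIV _ this tdiff_vexp]
  have "tdiff k S (\<lambda>x. vexp (H (f x)))" by simp
  from tdiff_vec_mult[OF assms(1) this assms(3)] show ?thesis by (simp add: act_def)
qed

lemma tdiff_W: "tdiff k U W"
  using smooth_equivariant_map by (simp add: smooth_on_def)

lemma tdiff_slice: "tdiff k U slice"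
proof -
  have "tdiff k U (\<lambda>z. - W z)"
    by (rule tdiff_bounded_linear[OF bounded_linear_minus[OF bounded_linear_ident] open_U_space tdiff_W])
  from tdiff_act[OF open_U_space this tdiff_id[OF open_U_space]] show ?thesis
    by (simp add: slice_def[abs_def])
qed

lemma continuous_act: 
  fixes f :: "'e::topological_space \<Rightarrow> 'x" and g :: "'e \<Rightarrow> complex ^ 'm"
  assumes "continuous_on S f" "continuous_on S g"
  shows "continuous_on S (\<lambda>x. act (f x) (g x))"
proof -
  have "continuous_on UNIV H"
    using H_linear by (intro linear_continuous_on) (simp add: linear_conv_bounded_linear)
  then have "continuous_on S (\<lambda>x. H (f x))" by (rule continuous_on_compose2[OF _ assms(1)]) simp
  then have "continuous_on S (\<lambda>x. vexp (H (f x)))" unfolding vexp_def by (intro continuous_intros)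
  from bounded_bilinear.continuous_on[OF bounded_bilinear_vec_mult this assms(2)]
  show ?thesis by (simp add: act_def)
qed

lemma continuous_W: "continuous_on U W"
  using tdiff_W[of 0] by simp

lemma continuous_slice: "continuous_on U slice"
  using tdiff_slice[of 0] by simp

lemma quotient_map_orbit: "quotient_map (top_of_set U) X pr"
  unfolding quotient_map_def using topspace_orbit_space[of G U]
  by (auto simp: openin_orbit_space)

lemma continuous_map_orbit: "continuous_map (top_of_set U) X pr"
  using quotient_map_orbit by (rule quotient_imp_continuous_map)

text \<open>Up to a constant, \<open>W\<close> inverts the parametrisation along the orbit of
  \<open>1\<close>, which lies in \<open>U\<close> because the empty simplex belongs to
  \<open>K\<close>. So the group cannot accumulate on itself.\<close>

lemma homeomorphic_group: "homeomorphic_map euclidean (top_of_set G) (\<lambda>u. vexp (H u))"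
proof -
  have 1: "(1 :: complex ^ 'm) \<in> U" using empty_K by (simp add: U_iff)
  have U1: "vexp (H u) = act u 1" for u by (simp add: act_def)
  have "homeomorphic_maps euclidean (top_of_set G) (\<lambda>u. vexp (H u)) (\<lambda>g. W g - W 1)"
    unfolding homeomorphic_maps_def
  proof (intro conjI ballI)
    show "continuous_map euclidean (top_of_set G) (\<lambda>u. vexp (H u))"
      using continuous_act[of UNIV "\<lambda>u. u" "\<lambda>u. 1"]
      by (simp add: continuous_map_in_subtopology U1[symmetric] image_subset_iff Pi_iff)
    have "G \<subseteq> U" using 1 by (auto simp: U1)
    then show "continuous_map (top_of_set G) euclidean (\<lambda>g. W g - W 1)"
      by (auto intro!: continuous_intros continuous_on_subset[OF continuous_W])
    show "W (vexp (H u)) - W 1 = u" for u using W_act[OF 1, of u] by (simp add: U1)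
    show "vexp (H (W g - W 1)) = g" if "g \<in> topspace (top_of_set G)" for g
      using that W_act[OF 1] by (auto simp: U1)
  qed
  then show ?thesis by (auto simp: homeomorphic_map_maps)
qed

text \<open>The difference of the values of \<open>W\<close> recovers the group element from the
  pair \<open>(g * z, z)\<close>, so the map has a left inverse \<open>k\<close>, given by a
  continuous formula on all pairs. The map is thus closed and injective, hence proper.\<close>

lemma proper: "proper_action G U"
proof -
  let ?f = "\<lambda>(g, z). (g * z, z)"
  define k where "k y = (vexp (H (W (fst y) - W (snd y))), snd y)" for y
  have cW: "continuous_on (U \<times> U) (\<lambda>y. W (fst y) - W (snd y))"
    by (intro continuous_intros continuous_on_compose2[OF continuous_W]) auto
  have ck: "continuous_on (U \<times> U) k"
    using continuous_act[OF cW continuous_on_const[of _ 1]] unfolding k_def act_def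
    by (intro continuous_intros) auto
  have kf: "k (?f x) = x" if "x \<in> G \<times> U" for x
  proof -
    obtain u z where "x = (vexp (H u), z)" "z \<in> U" using \<open>x \<in> G \<times> U\<close> by auto
    then show ?thesis using W_act[of z u] by (simp add: k_def act_def)
  qed
  have fU: "?f x \<in> U \<times> U" if "x \<in> G \<times> U" for x
    using group_action that by (auto simp: mult_group_action_def)
  have cf: "continuous_on (G \<times> U) ?f"
    unfolding case_prod_unfold
    by (intro continuous_intros bounded_bilinear.continuous_on[OF bounded_bilinear_vec_mult])
  have closed: "closedin (top_of_set (U \<times> U)) (?f ` C)" if C: "closedin (top_of_set (G \<times> U)) C" for C
  proof -
    obtain C' where C': "closed C'" "C = (G \<times> U) \<inter> C'" using C by (auto simp: closedin_closed)
    \<comment> \<open>The first set asks that \<open>k y\<close> lie in \<open>C'\<close>, the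
      second that \<open>y\<close> lie in the image of the map; both conditions are closed in
      \<open>U \<times> U\<close>.\<close>
    have "?f ` C = (U \<times> U \<inter> k -` C') \<inter> (U \<times> U \<inter> (\<lambda>y. act (W (fst y) - W (snd y)) (snd y) - fst y) -` {0})"
    proof (intro equalityI subsetI)
      fix y assume "y \<in> ?f ` C"
      then obtain x where x: "x \<in> C" "y = ?f x" by blast
      then have "k y = x" "y \<in> U \<times> U" using kf fU C' by auto
      moreover have "act (W (fst y) - W (snd y)) (snd y) = fst (?f (k y))"
        by (simp add: k_def act_def)
      ultimately show "y \<in> (U \<times> U \<inter> k -` C') \<inter> (U \<times> U \<inter> (\<lambda>y. act (W (fst y) - W (snd y)) (snd y) - fst y) -` {0})"
        using x C' by auto
    next
      fix y assume y: "y \<in> (U \<times> U \<inter> k -` C') \<inter> (U \<times> U \<inter> (\<lambda>y. act (W (fst y) - W (snd y)) (snd y) - fst y) -` {0})"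
      then have "?f (k y) = y" by (auto simp: k_def act_def)
      moreover have "k y \<in> C" using y C' by (auto simp: k_def)
      ultimately show "y \<in> ?f ` C" by (rule image_eqI[OF sym])
    qed
    moreover have "closedin (top_of_set (U \<times> U)) (U \<times> U \<inter> k -` C')"
      using ck C'(1) by (rule continuous_closedin_preimage)
    moreover have "closedin (top_of_set (U \<times> U))
        (U \<times> U \<inter> (\<lambda>y. act (W (fst y) - W (snd y)) (snd y) - fst y) -` {0})"
      by (intro continuous_closedin_preimage continuous_on_diff continuous_act[OF cW] continuous_on_fst
          continuous_on_snd continuous_on_id closed_singleton)
    ultimately show ?thesis by (simp add: closedin_Int)
  qed
  have "closed_map (top_of_set (G \<times> U)) (top_of_set (U \<times> U)) ?f"
    using closed by (simp add: closed_map_def)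
  moreover have "inj_on ?f (G \<times> U)" using kf by (rule inj_on_inverseI)
  ultimately have "proper_map (top_of_set (G \<times> U)) (top_of_set (U \<times> U)) ?f"
    by (intro closed_injective_imp_proper_map) auto
  moreover have "continuous_map (top_of_set (G \<times> U)) (top_of_set (U \<times> U)) ?f"
    using cf fU by (simp add: Pi_iff del: mem_Times_iff)
  ultimately show ?thesis
    unfolding proper_action_def Let_def by simp
qed

text \<open>The point of \<open>Z\<close> on an orbit exists because logarithms of moduli can be moved into the cone
  complex along the kernel; it is unique because two such points satisfy \<open>translation_bound\<close> with
  bound \<open>0\<close>.\<close>

lemma orbit_meets_Z: assumes "z \<in> U" shows "\<exists>!w. w \<in> pr z \<inter> Z"
proof -
  obtain u p where p: "p \<in> cone_points K"
    and up: "\<And>i. exp (B u $ i) * norm (z $ i) = (if z $ i = 0 then 0 else exp (- p $ i))"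
    and pz: "\<And>i. z $ i = 0 \<Longrightarrow> p $ i \<noteq> 0"
    using translate_into_Z[OF assms] by metis
  have "act u z \<in> Z"
    unfolding Z_iff
  proof
    show "\<forall>i. norm (act u z $ i) \<le> 1"
      using p by (auto simp: norm_act up cone_points_def)
    have "{i. p $ i \<noteq> 0} \<in> K" using p by (simp add: cone_points_def)
    then show "{i. norm (act u z $ i) \<noteq> 1} \<in> K"
      by (rule K_down) (auto simp: norm_act up pz)
  qed
  moreover have "act u z \<in> pr z" by (simp add: orbit_eq)
  moreover have "x = y" if x: "x \<in> pr z \<inter> Z" and y: "y \<in> pr z \<inter> Z" for x y
  proof -
    obtain C where C: "C > 0"
      "\<And>M z x u. 0 \<le> M \<Longrightarrow> log_bounded M z \<Longrightarrow> log_bounded M x \<Longrightarrow>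
        (\<And>i. norm (z $ i) = exp (B u $ i) * norm (x $ i)) \<Longrightarrow> norm u \<le> C * M"
      using translation_bound by blast
    obtain v v' where v: "x = act v z" "y = act v' z" using x y by (auto simp: orbit_eq)
    have "y = act (v' - v) x" by (simp add: v act_add[symmetric])
    moreover have "norm (v' - v) \<le> C * 0"
    proof (rule C(2))
      show "log_bounded 0 y" "log_bounded 0 x"
        using x y unfolding log_bounded_def Z_iff Int_iff by (auto intro: K_down)
      show "norm (y $ i) = exp (B (v' - v) $ i) * norm (x $ i)" for i
        using \<open>y = act (v' - v) x\<close> norm_act by metis
    qed auto
    ultimately show ?thesis by simp
  qed
  ultimately show ?thesis by blast
qed

text \<open>\<open>slice\<close> is constant on orbits and separates them, so it descends to a
  continuous injection into a Euclidean space.\<close>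

lemma Hausdorff_orbit_space: "Hausdorff_space X"
proof -
  define f where "f P = slice (SOME z. z \<in> U \<and> pr z = P)" for P
  have f: "f (pr z) = slice z" if "z \<in> U" for z
  proof -
    have "(SOME w. w \<in> U \<and> pr w = pr z) \<in> U \<and> pr (SOME w. w \<in> U \<and> pr w = pr z) = pr z"
      by (rule someI[of _ z]) (simp add: that)
    then show ?thesis unfolding f_def using orbit_eq_iff_slice that by blast
  qed
  have "continuous_map (top_of_set U) euclidean (f \<circ> pr)"
    using continuous_on_cong[of U U "f \<circ> pr" slice] f continuous_slice by simp
  then have "continuous_map X euclidean f"
    by (rule continuous_compose_quotient_map[OF quotient_map_orbit])
  moreover have "inj_on f (topspace X)"
  proof (rule inj_onI)
    fix P Q assume "P \<in> topspace X" "Q \<in> topspace X" "f P = f Q"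
    then obtain z w where "z \<in> U" "w \<in> U" "P = pr z" "Q = pr w" "slice z = slice w"
      by (auto simp: topspace_orbit_space f)
    then show "P = Q" using orbit_eq_iff_slice by blast
  qed
  moreover have "Hausdorff_space (euclidean :: (complex ^ 'm) topology)" by simp
  ultimately show ?thesis using Hausdorff_space_injective_preimage by blast
qed

text \<open>A continuous bijection from a compact space onto a Hausdorff space. Compactness and
  second countability of the orbit space are then taken over from \<open>Z\<close>.\<close>

lemma homeomorphic_Z: "homeomorphic_map (top_of_set Z) X pr"
proof (rule continuous_imp_homeomorphic_map)
  show "continuous_map (top_of_set Z) X pr"
    using continuous_map_from_subtopology_mono[OF continuous_map_orbit Z_subset_U] .
  show "compact_space (top_of_set Z)"
    by (rule compact_space_subtopology) (simp add: compact_moment_angle_complex)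
  show "Hausdorff_space X" by (rule Hausdorff_orbit_space)
  have "pr z \<in> pr ` Z" if z: "z \<in> U" for z
  proof -
    obtain w where "w \<in> pr z" "w \<in> Z" using orbit_meets_Z[OF z] by blast
    then obtain u where "act u z \<in> Z" by (auto simp: orbit_eq)
    then have "pr (act u z) \<in> pr ` Z" by (rule imageI)
    then show ?thesis by simp
  qed
  then have "pr ` Z = pr ` U" using Z_subset_U by blast
  then show "pr ` topspace (top_of_set Z) = topspace X" by (simp add: topspace_orbit_space)
  show "inj_on pr (topspace (top_of_set Z))"
  proof (rule inj_onI)
    fix x y assume xy: "x \<in> topspace (top_of_set Z)" "y \<in> topspace (top_of_set Z)" "pr x = pr y"
    then have "x \<in> pr x \<inter> Z" "y \<in> pr x \<inter> Z" "x \<in> U" using orbit_self[of x] orbit_self[of y] Z_subset_U by auto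
    then show "x = y" using orbit_meets_Z by blast
  qed
qed

text \<open>The same description as in \<open>moment_angle_atlas\<close>, so that the transport used
  there is the one along \<open>rep\<close>.\<close>

definition rep :: "(complex ^ 'm) set \<Rightarrow> complex ^ 'm" where
  "rep P = (THE z. z \<in> P \<inter> Z)"

lemma rep_orbit: assumes "z \<in> U" shows "rep (pr z) \<in> Z" "pr (rep (pr z)) = pr z"
proof -
  have "rep (pr z) \<in> pr z \<inter> Z" unfolding rep_def by (rule theI') (rule orbit_meets_Z[OF assms])
  then show "rep (pr z) \<in> Z" "pr (rep (pr z)) = pr z" by (auto simp: orbit_eq[of z])
qed

lemma rep_Z: assumes "z \<in> Z" shows "rep (pr z) = z"
  unfolding rep_def
  using assms orbit_self[of z] orbit_meets_Z[of z] Z_subset_U by (intro the1_equality) auto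

lemma homeomorphic_rep: "homeomorphic_map X (top_of_set Z) rep"
proof -
  obtain g where g: "homeomorphic_maps (top_of_set Z) X pr g"
    using homeomorphic_Z by (auto simp: homeomorphic_map_maps)
  have "g P = rep P" if "P \<in> topspace X" for P
  proof -
    obtain z where z: "z \<in> U" "P = pr z" using \<open>P \<in> topspace X\<close> by (auto simp: topspace_orbit_space)
    have "g P = g (pr (rep P))" using rep_orbit[OF z(1)] z by simp
    then show ?thesis using g rep_orbit(1)[OF z(1)] z by (simp add: homeomorphic_maps_def)
  qed
  moreover have "homeomorphic_map X (top_of_set Z) g"
    using g homeomorphic_maps_sym homeomorphic_map_maps by blast
  ultimately show ?thesis by (rule homeomorphic_map_eq[rotated])
qed

lemma compact_orbit_space: "compact_space X"
proof -
  have "compact_space (top_of_set Z)"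
    by (rule compact_space_subtopology) (simp add: compact_moment_angle_complex)
  then show ?thesis
    using homeomorphic_compact_space[OF homeomorphic_map_imp_homeomorphic_space[OF homeomorphic_Z]] by blast
qed

lemma second_countable_orbit_space: "second_countable X"
proof -
  obtain D :: "(complex ^ 'm) set set" where D: "countable D" "topological_basis D"
    using ex_countable_basis by blast
  have "second_countable (euclidean :: (complex ^ 'm) topology)"
    unfolding second_countable_def
  proof (intro exI[of _ D] conjI ballI allI impI)
    show "openin euclidean V" if "V \<in> D" for V
      using topological_basis_open[OF D(2) that] by simp
    fix S :: "(complex ^ 'm) set" and x assume "openin euclidean S \<and> x \<in> S"
    then show "\<exists>V\<in>D. x \<in> V \<and> V \<subseteq> S"
      using topological_basisE[OF D(2), of S x] unfolding open_openin[symmetric] by metis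
  qed (rule D(1))
  then have "second_countable (top_of_set Z)" by (rule second_countable_subtopology)
  then show ?thesis
    using homeomorphic_space_second_countability[OF homeomorphic_map_imp_homeomorphic_space[OF homeomorphic_Z]]
    by blast
qed

end

section \<open>Charts of quotients\<close>

text \<open>The flag adds holomorphy to smoothness, so that the complex and the real quotient are treated
  simultaneously.\<close>

definition sreg :: "bool \<Rightarrow> (complex ^ 'a::finite) set \<Rightarrow> (complex ^ 'a \<Rightarrow> complex ^ 'b::finite) \<Rightarrow> bool" where
  "sreg h S f \<longleftrightarrow> smooth_on S f \<and> (h \<longrightarrow> holo_on S f)"

abbreviation "clinear \<equiv> Vector_Spaces.linear (*s) (*s)"

lemma sreg_False: "sreg False = smooth_on"
  by (simp add: fun_eq_iff sreg_def)

lemma sreg_True: "sreg True S f \<longleftrightarrow> smooth_on S f \<and> holo_on S f"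
  by (simp add: sreg_def)

lemma clinear_iff: "clinear f \<longleftrightarrow> (\<forall>x y. f (x + y) = f x + f y) \<and> (\<forall>c x. f (c *s x) = c *s f x)"
  for f :: "complex ^ 'a::finite \<Rightarrow> complex ^ 'b::finite"
  by (simp add: Vector_Spaces.linear_iff vec.vector_space_axioms)

lemma scaleR_eq_of_real_smult: "r *\<^sub>R x = complex_of_real r *s x" for x :: "complex ^ 'a::finite"
  unfolding vec_eq_iff by (simp add: scaleR_conv_of_real[where 'a = complex])

lemma clinear_imp_linear: "clinear f \<Longrightarrow> linear f"
  for f :: "complex ^ 'a::finite \<Rightarrow> complex ^ 'b::finite"
  by (rule linearI) (auto simp: clinear_iff scaleR_eq_of_real_smult)

lemma clinear_inv: "clinear f \<Longrightarrow> bij f \<Longrightarrow> clinear (inv f)"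
  for f :: "complex ^ 'a::finite \<Rightarrow> complex ^ 'b::finite"
  unfolding clinear_iff by (metis bij_inv_eq_iff)

lemma smooth_on_cong: "open S \<Longrightarrow> (\<And>x. x \<in> S \<Longrightarrow> f x = g x) \<Longrightarrow> smooth_on S f \<Longrightarrow> smooth_on S g"
  unfolding smooth_on_def using tdiff_cong by blast

lemma holo_on_cong:
  assumes "open S" "\<And>x. x \<in> S \<Longrightarrow> f x = g x" "holo_on S f"
  shows "holo_on S g"
  unfolding holo_on_def
proof
  fix x assume x: "x \<in> S"
  then obtain D where D: "(f has_derivative D) (at x)" "clinear D" using assms(3) by (auto simp: holo_on_def)
  have "(g has_derivative D) (at x)"
    using D(1) assms(1) x assms(2) by (rule has_derivative_transform_within_open)
  then show "\<exists>D. (g has_derivative D) (at x) \<and> clinear D" using D by blast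
qed

lemma sreg_cong: "open S \<Longrightarrow> (\<And>x. x \<in> S \<Longrightarrow> f x = g x) \<Longrightarrow> sreg h S f \<Longrightarrow> sreg h S g"
  unfolding sreg_def using smooth_on_cong[of S f g] holo_on_cong[of S f g] by blast

lemma sreg_subset: "sreg h S f \<Longrightarrow> T \<subseteq> S \<Longrightarrow> sreg h T f"
  unfolding sreg_def smooth_on_def holo_on_def using tdiff_subset by blast

lemma sreg_local:
  assumes "\<And>x. x \<in> S \<Longrightarrow> \<exists>T. open T \<and> x \<in> T \<and> sreg h T f"
  shows "sreg h S f"
  unfolding sreg_def smooth_on_def holo_on_def
proof (intro conjI allI impI ballI)
  show "tdiff k S f" for k
    by (rule tdiff_local) (use assms in \<open>auto simp: sreg_def smooth_on_def\<close>)
  show "\<exists>D. (f has_derivative D) (at x) \<and> clinear D" if "h" "x \<in> S" for x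
    using assms[OF that(2)] that(1) by (auto simp: sreg_def holo_on_def)
qed

lemma sreg_compose:
  assumes "open S" "open T" "g ` S \<subseteq> T" "sreg h S g" "sreg h T f"
  shows "sreg h S (\<lambda>x. f (g x))"
  unfolding sreg_def smooth_on_def holo_on_def
proof (intro conjI allI impI ballI)
  show "tdiff k S (\<lambda>x. f (g x))" for k
    by (rule tdiff_compose[OF assms(1,2,3)]) (use assms(4,5) in \<open>auto simp: sreg_def smooth_on_def\<close>)
next
  fix x assume h: h and x: "x \<in> S"
  then have gx: "g x \<in> T" using assms(3) by blast
  obtain D where D: "(g has_derivative D) (at x)" "clinear D"
    using assms(4) h x by (auto simp: sreg_def holo_on_def)
  obtain E where E: "(f has_derivative E) (at (g x))" "clinear E"
    using assms(5) h gx by (auto simp: sreg_def holo_on_def)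
  have "((\<lambda>x. f (g x)) has_derivative (\<lambda>v. E (D v))) (at x)"
    using diff_chain_at[OF D(1) E(1)] by (simp add: o_def)
  moreover have "clinear (\<lambda>v. E (D v))" using D(2) E(2) by (simp add: clinear_iff)
  ultimately show "\<exists>D. ((\<lambda>x. f (g x)) has_derivative D) (at x) \<and> clinear D" by blast
qed

lemma sreg_affine:
  assumes "linear L" "h \<Longrightarrow> clinear L" "open S"
  shows "sreg h S (\<lambda>x. c + L x)"
proof -
  have bl: "bounded_linear L" using assms(1) by (simp add: linear_conv_bounded_linear)
  have "tdiff k S (\<lambda>x. c + L x)" for k
    by (rule tdiff_add[OF assms(3) tdiff_const tdiff_linear[OF bl assms(3)]])
  moreover have "((\<lambda>x. c + L x) has_derivative L) (at x)" for x
    using has_derivative_add[OF has_derivative_const bounded_linear_imp_has_derivative[OF bl]] by simp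
  ultimately show ?thesis using assms(2) by (auto simp: sreg_def smooth_on_def holo_on_def)
qed

lemma sreg_continuous: "sreg h S f \<Longrightarrow> continuous_on S f"
  by (auto simp: sreg_def smooth_on_def dest: spec[of _ 0])

lemma sreg_has_derivative:
  assumes "sreg h S f" "x \<in> S"
  shows "(f has_derivative frechet_derivative f (at x)) (at x)"
    and "h \<Longrightarrow> clinear (frechet_derivative f (at x))"
proof -
  have "tdiff (Suc 0) S f" using assms(1) by (simp add: sreg_def smooth_on_def)
  then show "(f has_derivative frechet_derivative f (at x)) (at x)"
    using assms(2) by (simp add: frechet_derivative_works)
  show "clinear (frechet_derivative f (at x))" if hol: h
  proof -
    obtain D where "(f has_derivative D) (at x)" "clinear D"
      using assms hol by (auto simp: sreg_def holo_on_def)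
    then show ?thesis using frechet_derivative_at by blast
  qed
qed

text \<open>Restrict \<open>q\<close> to the affine space through \<open>z0\<close> in the
  directions of a right inverse \<open>\<kappa>\<close> of the derivative. The restriction has the
  identity as its derivative at the origin and is inverted locally.\<close>

lemma submersion_local_section:
  fixes q :: "complex ^ 'a::finite \<Rightarrow> complex ^ 'b::finite"
  assumes S: "open S" "z0 \<in> S" and q: "sreg h S q" and surj: "surj (frechet_derivative q (at z0))"
  obtains T s where "open T" "q z0 \<in> T" "sreg h T s" "s ` T \<subseteq> S" "\<And>x. x \<in> T \<Longrightarrow> q (s x) = x"
proof -
  let ?D = "frechet_derivative q (at z0)"
  have der: "(q has_derivative ?D) (at z0)" by (rule sreg_has_derivative[OF q S(2)])
  obtain \<kappa> where \<kappa>: "linear \<kappa>" "h \<Longrightarrow> clinear \<kappa>" "?D \<circ> \<kappa> = id"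
  proof (cases h)
    case True
    obtain \<kappa> where "clinear \<kappa>" "?D \<circ> \<kappa> = id"
      using vec.linear_surjective_right_inverse[OF sreg_has_derivative(2)[OF q S(2) True] surj] by blast
    then show ?thesis using that clinear_imp_linear by blast
  next
    case False
    obtain \<kappa> where "linear \<kappa>" "?D \<circ> \<kappa> = id"
      using linear_surjective_right_inverse[OF has_derivative_linear[OF der] surj] by blast
    then show ?thesis using that False by blast
  qed
  define S' where "S' = (\<lambda>x. z0 + \<kappa> x) -` S"
  have cont: "continuous_on UNIV (\<lambda>x. z0 + \<kappa> x)"
    using sreg_continuous[OF sreg_affine[OF \<kappa>(1,2) open_UNIV]] .
  have S': "open S'" "0 \<in> S'"
    unfolding S'_def using S open_vimage[OF S(1) cont] by (auto simp: linear_0[OF \<kappa>(1)])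
  define f where "f x = q (z0 + \<kappa> x)" for x
  have f: "sreg h S' f" unfolding f_def
    by (rule sreg_compose[OF S'(1) S(1) _ sreg_affine[OF \<kappa>(1,2) S'(1)] q]) (auto simp: S'_def)
  have "((\<lambda>x. z0 + \<kappa> x) has_derivative \<kappa>) (at 0)"
    using has_derivative_add[OF has_derivative_const bounded_linear_imp_has_derivative] \<kappa>(1)
    by (fastforce simp: linear_conv_bounded_linear)
  moreover have "(q has_derivative ?D) (at (z0 + \<kappa> 0))" using der by (simp add: linear_0[OF \<kappa>(1)])
  ultimately have "(f has_derivative ?D \<circ> \<kappa>) (at 0)"
    using diff_chain_at unfolding f_def[abs_def] o_def by blast
  then have "frechet_derivative f (at 0) = id" using frechet_derivative_at \<kappa>(3) by metis
  then have inj: "inj (frechet_derivative f (at 0))" by simp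
  have "smooth_on S' f" using f by (simp add: sreg_def)
  then obtain U V g where UV: "open U" "U \<subseteq> S'" "0 \<in> U" "open V" "f 0 \<in> V" "homeomorphism U V f g"
    "smooth_on V g" "\<And>y. y \<in> V \<Longrightarrow> bij (frechet_derivative f (at (g y)))"
    "\<And>y. y \<in> V \<Longrightarrow> (g has_derivative inv (frechet_derivative f (at (g y)))) (at y)"
    using smooth_inverse_function[OF S' _ inj] by metis
  have gV: "g y \<in> S'" "f (g y) = y" if "y \<in> V" for y
    using UV that by (auto simp: homeomorphism_def)
  \<comment> \<open>The derivative of \<open>g\<close> is the inverse of a complex linear bijection,
    hence complex linear.\<close>
  have "holo_on V g" if h
    unfolding holo_on_def
  proof
    fix y assume y: "y \<in> V"
    have "clinear (frechet_derivative f (at (g y)))"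
      by (rule sreg_has_derivative(2)[OF f gV(1)[OF y] that])
    then show "\<exists>D. (g has_derivative D) (at y) \<and> clinear D"
      using UV(8,9)[OF y] clinear_inv by blast
  qed
  then have g: "sreg h V g" using UV(7) by (simp add: sreg_def)
  show ?thesis
  proof (rule that[OF UV(4)])
    show "q z0 \<in> V" using UV(5) by (simp add: f_def linear_0[OF \<kappa>(1)])
    show "sreg h V (\<lambda>y. z0 + \<kappa> (g y))"
      by (rule sreg_compose[OF UV(4) open_UNIV _ g sreg_affine[OF \<kappa>(1,2)]]) auto
    show "(\<lambda>y. z0 + \<kappa> (g y)) ` V \<subseteq> S" using gV(1) by (auto simp: S'_def)
    show "q (z0 + \<kappa> (g y)) = y" if "y \<in> V" for y using gV(2)[OF that] by (simp add: f_def)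
  qed
qed

lemma is_chart_inj: "is_chart X (V, \<phi>) \<Longrightarrow> inj_on \<phi> V"
proof -
  assume c: "is_chart X (V, \<phi>)"
  then have "V \<subseteq> topspace X" by (simp add: is_chart_def openin_subset)
  then show "inj_on \<phi> V"
    using c homeomorphic_imp_injective_map[of "subtopology X V" "top_of_set (\<phi> ` V)" \<phi>]
    by (simp add: is_chart_def Int_absorb1)
qed

lemma quotient_chart_domain:
  assumes "quotient_chart reg G U (V, \<phi>)" "open U"
  shows "open {z \<in> U. orbit G z \<in> V}" "V \<subseteq> orbit G ` U"
  using assms openin_open_trans[of U]
  by (auto simp: quotient_chart_def is_chart_def openin_orbit_space)

text \<open>Local sections of the submersion defining the source chart reduce the statement to a lift.\<close>

lemma chart_representation_lift:
  fixes \<phi> :: "(complex ^ 'm::finite) set \<Rightarrow> complex ^ 'k::finite"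
    and \<psi> :: "(complex ^ 'm) set \<Rightarrow> complex ^ 'k"
  assumes U: "open U" "open U'" and c: "quotient_chart (sreg h) G U (V, \<phi>)"
    and c': "quotient_chart (sreg h) G' U' (V', \<psi>)"
    and g: "sreg h U g" "g ` U \<subseteq> U'" and F: "\<And>z. z \<in> U \<Longrightarrow> F (orbit G z) = orbit G' (g z)"
  shows "sreg h (\<phi> ` {P \<in> V. F P \<in> V'}) (\<psi> \<circ> F \<circ> inv_into V \<phi>)"
proof (rule sreg_local)
  fix x0 assume "x0 \<in> \<phi> ` {P \<in> V. F P \<in> V'}"
  then obtain P0 where P0: "P0 \<in> V" "F P0 \<in> V'" "x0 = \<phi> P0" by blast
  have inj: "inj_on \<phi> V" using c by (auto simp: quotient_chart_def intro: is_chart_inj)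
  let ?S = "{z \<in> U. orbit G z \<in> V}" and ?S' = "{z \<in> U'. orbit G' z \<in> V'}" and ?q = "\<phi> \<circ> orbit G"
  have S: "open ?S" "open ?S'" using quotient_chart_domain U c c' by blast+
  obtain z0 where z0: "z0 \<in> U" "P0 = orbit G z0" using quotient_chart_domain(2)[OF c U(1)] P0 by blast
  have q: "sreg h ?S ?q" "surj (frechet_derivative ?q (at z0))"
    using c z0 P0 by (auto simp: quotient_chart_def)
  have q': "sreg h ?S' (\<psi> \<circ> orbit G')" using c' by (auto simp: quotient_chart_def)
  obtain T s where T: "open T" "?q z0 \<in> T" "sreg h T s" "s ` T \<subseteq> ?S" "\<And>x. x \<in> T \<Longrightarrow> ?q (s x) = x"
    using submersion_local_section[OF S(1) _ q] z0 P0 by blast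
  have gs: "sreg h T (\<lambda>x. g (s x))"
    using sreg_compose[OF T(1) U(1) _ T(3) g(1)] T(4) by blast
  \<comment> \<open>Shrink so that the lifted point stays over the target chart.\<close>
  define T' where "T' = T \<inter> (\<lambda>x. g (s x)) -` ?S'"
  have T': "open T'" unfolding T'_def
    using continuous_open_preimage[OF sreg_continuous[OF gs] T(1) S(2)] .
  have inv: "inv_into V \<phi> x = orbit G (s x)" if "x \<in> T" for x
  proof (rule inv_into_f_eq[OF inj])
    show "orbit G (s x) \<in> V" using T(4) that by auto
    show "\<phi> (orbit G (s x)) = x" using T(5)[OF that] by simp
  qed
  have "x0 \<in> T" using T(2) z0 P0 by simp
  have "orbit G (s x0) = P0" using inv[OF \<open>x0 \<in> T\<close>] P0 inj by simp
  then have "x0 \<in> T'" using \<open>x0 \<in> T\<close> T(4) g(2) P0(2) F[of "s x0"] by (auto simp: T'_def)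
  have "sreg h T' (\<lambda>x. (\<psi> \<circ> orbit G') (g (s x)))"
    by (rule sreg_compose[OF T' S(2) _ sreg_subset[OF gs] q']) (auto simp: T'_def)
  then have "sreg h T' (\<psi> \<circ> F \<circ> inv_into V \<phi>)"
  proof (rule sreg_cong[OF T', rotated])
    fix x assume x: "x \<in> T'"
    then have "x \<in> T" "s x \<in> U" using T(4) by (auto simp: T'_def)
    then show "(\<psi> \<circ> orbit G') (g (s x)) = (\<psi> \<circ> F \<circ> inv_into V \<phi>) x" by (simp add: inv F)
  qed
  then show "\<exists>T. open T \<and> x0 \<in> T \<and> sreg h T (\<psi> \<circ> F \<circ> inv_into V \<phi>)" using T' \<open>x0 \<in> T'\<close> by blast
qed

text \<open>Transition maps represent the identity of the orbit space, which lifts to the identity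
  of \<open>U\<close>; any two quotient charts are thus compatible.\<close>

lemma quotient_manifold:
  fixes A :: "((complex ^ 'm::finite) set set \<times> ((complex ^ 'm) set \<Rightarrow> complex ^ 'k::finite)) set"
  assumes U: "open U" and top: "Hausdorff_space (orbit_space G U)" "second_countable (orbit_space G U)"
    and A: "\<And>c. c \<in> A \<Longrightarrow> quotient_chart (sreg h) G U c"
    and cover: "\<And>z. z \<in> U \<Longrightarrow> \<exists>c\<in>A. orbit G z \<in> fst c"
  shows "is_manifold (sreg h) (orbit_space G U) A"
  unfolding is_manifold_def
proof (intro conjI ballI top)
  show "is_chart (orbit_space G U) c" if "c \<in> A" for c
    using A[OF that] by (auto simp: quotient_chart_def split: prod.splits)
  have "fst c \<subseteq> orbit G ` U" if "c \<in> A" for c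
    using quotient_chart_domain(2)[of "sreg h" G U "fst c" "snd c"] A[OF that] U by simp
  then show "(\<Union>c\<in>A. fst c) = topspace (orbit_space G U)"
    using cover unfolding topspace_orbit_space by blast
next
  fix c assume c: "c \<in> A"
  show "case c of (V, \<phi>) \<Rightarrow> \<forall>(W, \<psi>)\<in>A. sreg h (\<phi> ` (V \<inter> W)) (\<psi> \<circ> inv_into V \<phi>)"
  proof (clarsimp split: prod.splits)
    fix V \<phi> W \<psi> assume *: "c = (V, \<phi>)" "(W, \<psi>) \<in> A"
    have id: "sreg h U (\<lambda>z. z)"
      using sreg_affine[of "\<lambda>z. z" h U 0] U by (auto simp: clinear_iff linear_id[unfolded id_def])
    have "sreg h (\<phi> ` {P \<in> V. P \<in> W}) (\<psi> \<circ> (\<lambda>P. P) \<circ> inv_into V \<phi>)"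
      by (rule chart_representation_lift[OF U U _ _ id, where G = G and G' = G]) (use A c * in auto)
    then show "sreg h (\<phi> ` (V \<inter> W)) (\<psi> \<circ> inv_into V \<phi>)" by (simp add: o_def Int_def)
  qed
qed

lemma quotient_manifold_map:
  fixes A :: "((complex ^ 'm::finite) set set \<times> ((complex ^ 'm) set \<Rightarrow> complex ^ 'k::finite)) set"
    and A' :: "((complex ^ 'm) set set \<times> ((complex ^ 'm) set \<Rightarrow> complex ^ 'k)) set"
  assumes "open U" "open U'" "\<And>c. c \<in> A \<Longrightarrow> quotient_chart (sreg h) G U c"
    and "\<And>c. c \<in> A' \<Longrightarrow> quotient_chart (sreg h) G' U' c"
    and "sreg h U g" "g ` U \<subseteq> U'" "\<And>z. z \<in> U \<Longrightarrow> F (orbit G z) = orbit G' (g z)"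
    and "continuous_map (orbit_space G U) (orbit_space G' U') F"
  shows "manifold_map (sreg h) (orbit_space G U) A (orbit_space G' U') A' F"
  unfolding manifold_map_def
proof (intro conjI ballI assms(8), clarify)
  fix V \<phi> W \<psi> assume "(V, \<phi>) \<in> A" "(W, \<psi>) \<in> A'"
  then show "sreg h (\<phi> ` {x \<in> V. F x \<in> W}) (\<psi> \<circ> F \<circ> inv_into V \<phi>)"
    by (intro chart_representation_lift[OF assms(1,2) assms(3,4) assms(5,6,7)])
qed

section \<open>Complements of the tangent spaces of orbits\<close>

lemma complement_bij:
  fixes D :: "'x::euclidean_space \<Rightarrow> 'z::euclidean_space" and \<kappa> :: "'y::euclidean_space \<Rightarrow> 'z"
  assumes lin: "linear D" "linear \<kappa>" "linear L" and L: "L \<circ> D = id"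
    and ker: "range \<kappa> = {z. L z = 0}" and inj: "inj \<kappa>"
  shows "bij (\<lambda>q. D (fst q) + \<kappa> (snd q))"
proof (rule bijI)
  let ?M = "\<lambda>q. D (fst q) + \<kappa> (snd q)"
  have LD: "L (D u) = u" for u using L by (simp add: fun_eq_iff)
  have L\<kappa>: "L (\<kappa> y) = 0" for y using ker by auto
  have LM: "L (?M q) = fst q" for q by (simp add: linear_add[OF lin(3)] LD L\<kappa>)
  show "inj ?M"
  proof (rule injI)
    fix p q assume eq: "?M p = ?M q"
    then have "fst p = fst q" using LM by metis
    moreover from this eq have "\<kappa> (snd p) = \<kappa> (snd q)" by simp
    ultimately show "p = q" using inj by (simp add: prod_eq_iff inj_eq)
  qed
  show "surj ?M"
  proof (rule surjI[of _ "\<lambda>z. (L z, inv \<kappa> (z - D (L z)))"])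
    fix z
    have "z - D (L z) \<in> range \<kappa>" unfolding ker by (simp add: linear_diff[OF lin(3)] LD)
    then have "\<kappa> (inv \<kappa> (z - D (L z))) = z - D (L z)" by (rule f_inv_into_f)
    then show "?M (L z, inv \<kappa> (z - D (L z))) = z" by simp
  qed
qed

text \<open>The complement is the kernel of a left inverse of \<open>D\<close>; the dimension count
  makes it isomorphic to the source of \<open>\<kappa>\<close>.\<close>

lemma linear_complement:
  fixes D :: "'x::euclidean_space \<Rightarrow> 'z::euclidean_space"
  assumes D: "linear D" "inj D" and dim: "DIM('z) = DIM('x) + DIM('y)"
  obtains \<kappa> :: "'y::euclidean_space \<Rightarrow> 'z" where "linear \<kappa>" "bij (\<lambda>q. D (fst q) + \<kappa> (snd q))"
proof -
  obtain L where L: "linear L" "L \<circ> D = id" using linear_injective_left_inverse[OF D] by blast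
  let ?S = "range D" and ?T = "{z. L z = 0}"
  have LD: "L (D u) = u" for u using L by (simp add: fun_eq_iff)
  have sub: "subspace ?S" "subspace ?T"
    using linear_subspace_image[OF D(1) subspace_UNIV] linear_subspace_kernel[OF L(1)] by auto
  have "?S \<inter> ?T = {0}" using LD linear_0[OF L(1)] linear_0[OF D(1)] by force
  moreover have "{x + y |x y. x \<in> ?S \<and> y \<in> ?T} = UNIV"
  proof -
    have "z = D (L z) + (z - D (L z)) \<and> L (z - D (L z)) = 0" for z
      by (simp add: linear_diff[OF L(1)] LD)
    then show ?thesis by blast
  qed
  ultimately have "dim (UNIV :: 'z set) = dim ?S + dim ?T"
    using dim_sums_Int[OF sub] by simp
  moreover have "dim ?S = DIM('x)" using dim_image_eq[OF D(1), of UNIV] D(2) by (simp add: inj_on_subset)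
  ultimately have "dim (UNIV :: 'y set) = dim ?T" using dim by simp
  then obtain \<kappa> :: "'y \<Rightarrow> 'z" where \<kappa>: "linear \<kappa>" "range \<kappa> = ?T" "inj \<kappa>"
    using subspace_isomorphism[OF subspace_UNIV sub(2)] by blast
  then show ?thesis using that complement_bij[OF D(1) \<kappa>(1) L] by blast
qed

text \<open>A holomorphic chart needs a complex linear \<open>\<kappa>\<close>, so the argument is
  carried out with complex dimensions.\<close>

lemma clinear_complement:
  fixes D :: "complex ^ 'l::finite \<Rightarrow> complex ^ 'm::finite"
  assumes D: "clinear D" "inj D" and dim: "CARD('m) = CARD('l) + CARD('k)"
  obtains \<kappa> :: "complex ^ 'k::finite \<Rightarrow> complex ^ 'm" where "clinear \<kappa>" "bij (\<lambda>q. D (fst q) + \<kappa> (snd q))"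
proof -
  obtain L where L: "clinear L" "L \<circ> D = id" using vec.linear_injective_left_inverse[OF D] by blast
  let ?S = "range D" and ?T = "{z. L z = 0}"
  have LD: "L (D u) = u" for u using L by (simp add: fun_eq_iff)
  have lin: "linear L" "linear D" using L D clinear_imp_linear by blast+
  have "D u + D v \<in> range D" "c *s D u \<in> range D" for u v c
    using D(1) unfolding clinear_iff by (metis rangeI)+
  then have sub: "vec.subspace ?S" "vec.subspace ?T"
    using L(1) linear_0[OF lin(1)] linear_0[OF lin(2)] by (auto simp: vec.subspace_def clinear_iff)
  have "?S \<inter> ?T = {0}" using LD linear_0[OF lin(1)] linear_0[OF lin(2)] by force
  moreover have "{x + y |x y. x \<in> ?S \<and> y \<in> ?T} = UNIV"
  proof -
    have "z = D (L z) + (z - D (L z)) \<and> L (z - D (L z)) = 0" for z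
      by (simp add: linear_diff[OF lin(1)] LD)
    then show ?thesis by blast
  qed
  ultimately have "vec.dim (UNIV :: (complex ^ 'm) set) = vec.dim ?S + vec.dim ?T"
    using vec.dim_sums_Int[OF sub] by simp
  moreover have "vec.dim ?S = vec.dim (UNIV :: (complex ^ 'l) set)"
    using vec.dim_image_eq[OF D(1), of UNIV] D(2) by (simp add: inj_on_subset)
  ultimately have "vec.dim (UNIV :: (complex ^ 'k) set) = vec.dim ?T" using dim unfolding vec_dim_card by simp
  then obtain \<kappa> :: "complex ^ 'k \<Rightarrow> complex ^ 'm" where \<kappa>: "clinear \<kappa>" "range \<kappa> = ?T" "inj \<kappa>"
    using vec.subspace_isomorphism[OF vec.subspace_UNIV sub(2)] by blast
  then show ?thesis using that complement_bij[OF lin(2) _ lin(1) L(2) \<kappa>(2,3)] clinear_imp_linear by blast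
qed

lemma vexp_has_derivative: "(vexp has_derivative (\<lambda>h. h * vexp x)) (at (x :: complex ^ 'm::finite))"
proof -
  have ax: "bounded_linear (axis i :: complex \<Rightarrow> complex ^ 'm)" for i
    by (auto intro!: linearI simp: linear_conv_bounded_linear[symmetric] vec_eq_iff axis_def)
  have "((\<lambda>x. axis i (exp (x $ i))) has_derivative (\<lambda>h. axis i (h $ i * exp (x $ i)))) (at x)" for i
  proof (rule bounded_linear.has_derivative[OF ax])
    show "((\<lambda>x. exp (x $ i)) has_derivative (\<lambda>h. h $ i * exp (x $ i))) (at x)"
      using diff_chain_at[OF bounded_linear_imp_has_derivative[OF bounded_linear_vec_nth[of i]],
          of exp "(*) (exp (x $ i))" x] DERIV_exp[of "x $ i"]
      by (simp add: o_def has_field_derivative_def mult.commute)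
  qed
  then have "((\<lambda>x. \<Sum>i\<in>UNIV. axis i (exp (x $ i))) has_derivative
      (\<lambda>h. \<Sum>i\<in>UNIV. axis i (h $ i * exp (x $ i)))) (at x)"
    by (rule has_derivative_sum)
  moreover have "(\<Sum>i\<in>UNIV. axis i (exp (x $ i))) = vexp x" for x :: "complex ^ 'm"
    by (simp add: vec_eq_iff axis_def)
  moreover have "(\<Sum>i\<in>UNIV. axis i (h $ i * exp (x $ i))) = h * vexp x" for h :: "complex ^ 'm"
    by (simp add: vec_eq_iff axis_def)
  ultimately show ?thesis by (simp only:)
qed

context slice_action
begin

lemma bounded_linear_H: "bounded_linear H"
  using H_linear by (simp add: linear_conv_bounded_linear)

lemma act_has_derivative:
  assumes f: "(f has_derivative f') (at p)" and g: "(g has_derivative g') (at p)"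
  shows "((\<lambda>p. act (f p) (g p)) has_derivative (\<lambda>h. H (f' h) * act (f p) (g p) + vexp (H (f p)) * g' h)) (at p)"
proof -
  have "((\<lambda>p. vexp (H (f p))) has_derivative (\<lambda>h. H (f' h) * vexp (H (f p)))) (at p)"
    using diff_chain_at[OF bounded_linear.has_derivative[OF bounded_linear_H f] vexp_has_derivative]
    by (simp add: o_def)
  from bounded_bilinear.FDERIV[OF bounded_bilinear_vec_mult this g] show ?thesis
    by (simp add: act_def mult.assoc add.commute)
qed

text \<open>If \<open>H u * z = 0\<close>, then \<open>H u\<close> vanishes at every nonzero
  coordinate of \<open>z\<close>, so translation by \<open>u\<close> fixes \<open>z\<close>, and
  freeness gives \<open>u = 0\<close>.\<close>

lemma infinitesimal_action_inj:
  assumes "z \<in> U" shows "inj (\<lambda>u. H u * z)"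
proof -
  have lin: "linear (\<lambda>u. H u * z)"
    by (intro linearI) (auto simp: linear_add[OF H_linear] linear_scale[OF H_linear] vec_eq_iff algebra_simps)
  show ?thesis
  proof (rule linear_injective_0[OF lin, THEN iffD2], intro allI impI)
    fix u assume "H u * z = 0"
    then have "act u z = act 0 z" by (simp add: act_def linear_0[OF H_linear] vec_eq_iff) (metis exp_zero mult_eq_0_iff mult.left_neutral mult_zero_right)
    then show "u = 0" using act_free[OF assms] by blast
  qed
qed

end

locale complex_slice_action = slice_action a K B H
  for a :: "'m::finite \<Rightarrow> 'v::euclidean_space" and K and B :: "complex ^ 'l::finite \<Rightarrow> real ^ 'm" and H
begin

text \<open>Near \<open>z0\<close> the space looks like the group times a transversal: the
  derivative of \<open>(u, x) \<mapsto> act u (z0 + \<kappa> x)\<close> at the origin is the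
  bijection assumed in \<open>bij\<close>, so the inverse function theorem applies. The second
  component of the inverse is going to be the chart.\<close>

lemma local_product:
  fixes \<kappa> :: "complex ^ 'k::finite \<Rightarrow> complex ^ 'm"
  assumes \<kappa>: "linear \<kappa>" and hol: "h \<Longrightarrow> clinear H" "h \<Longrightarrow> clinear \<kappa>"
    and bij: "bij (\<lambda>q. H (fst q) * z0 + \<kappa> (snd q))"
  obtains U1 O1 e where "open U1" "(0, 0) \<in> U1" "open O1" "z0 \<in> O1"
    "\<And>u x. (u, x) \<in> U1 \<Longrightarrow> act u (z0 + \<kappa> x) \<in> O1 \<and> e (act u (z0 + \<kappa> x)) = (u, x)"
    "\<And>z. z \<in> O1 \<Longrightarrow> e z \<in> U1 \<and> act (fst (e z)) (z0 + \<kappa> (snd (e z))) = z"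
    "continuous_on O1 e" "sreg h O1 (\<lambda>z. snd (e z))"
proof -
  define \<Phi> where "\<Phi> p = act (fst p) (z0 + \<kappa> (snd p))" for p
  define M where "M q = H (fst q) * z0 + \<kappa> (snd q)" for q
  \<comment> \<open>Complex scaling of both components, to express complex linearity of maps on the
    product.\<close>
  define sc where "sc c q = (c *s fst q, c *s snd q)" for c and q :: "(complex ^ 'l) \<times> (complex ^ 'k)"
  define D\<Phi> where "D\<Phi> p q = H (fst q) * \<Phi> p + vexp (H (fst p)) * \<kappa> (snd q)" for p q
  have linM: "linear M"
    unfolding M_def
    by (intro linearI) (auto simp: linear_add[OF H_linear] linear_scale[OF H_linear] linear_add[OF \<kappa>]
        linear_scale[OF \<kappa>] vec_eq_iff algebra_simps)
  have bijM: "bij M" using bij by (simp add: M_def[abs_def])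
  define Mi where "Mi = inv M"
  have MMi: "M (Mi z) = z" "Mi (M q) = q" for z q
    using bijM by (simp_all add: Mi_def bij_is_surj surj_f_inv_f bij_is_inj)
  have linMi: "linear Mi"
  proof (rule linearI)
    show "Mi (v + w) = Mi v + Mi w" for v w using MMi linear_add[OF linM] by metis
    show "Mi (r *\<^sub>R v) = r *\<^sub>R Mi v" for r v using MMi linear_scale[OF linM] by metis
  qed
  have blMi: "bounded_linear Mi" using linMi by (simp add: linear_conv_bounded_linear)
  have bl\<kappa>: "bounded_linear (\<lambda>p :: (complex ^ 'l) \<times> (complex ^ 'k). \<kappa> (snd p))"
    using \<kappa> bounded_linear_compose[OF _ bounded_linear_snd] by (simp add: linear_conv_bounded_linear)
  have der\<Phi>: "(\<Phi> has_derivative D\<Phi> p) (at p)" for p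
  proof -
    have "((\<lambda>p. z0 + \<kappa> (snd p)) has_derivative (\<lambda>h. 0 + \<kappa> (snd h))) (at p)"
      by (intro has_derivative_add has_derivative_const bounded_linear_imp_has_derivative[OF bl\<kappa>])
    from act_has_derivative[OF bounded_linear_imp_has_derivative[OF bounded_linear_fst] this]
    show ?thesis by (simp add: \<Phi>_def[abs_def] D\<Phi>_def[abs_def])
  qed
  \<comment> \<open>Composing with the inverse of the derivative at the origin makes source and
    target the same space and turns that derivative into the identity.\<close>
  define f where "f p = Mi (\<Phi> p)" for p
  have derf: "(f has_derivative (\<lambda>q. Mi (D\<Phi> p q))) (at p)" for p
    unfolding f_def by (rule bounded_linear.has_derivative[OF blMi der\<Phi>])
  have fr: "frechet_derivative f (at p) = (\<lambda>q. Mi (D\<Phi> p q))" for p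
    using frechet_derivative_at[OF derf] by simp
  have \<Phi>0: "\<Phi> (0, 0) = z0" by (simp add: \<Phi>_def linear_0[OF \<kappa>])
  have "frechet_derivative f (at (0, 0)) = id"
    unfolding fr using MMi(2) by (auto simp: D\<Phi>_def \<Phi>0 M_def linear_0[OF H_linear] fun_eq_iff)
  then have inj: "inj (frechet_derivative f (at (0, 0)))" by simp
  have "tdiff k UNIV f" for k
  proof -
    have "tdiff k UNIV (\<lambda>p :: (complex ^ 'l) \<times> (complex ^ 'k). z0 + \<kappa> (snd p))"
      by (rule tdiff_add[OF open_UNIV tdiff_const tdiff_linear[OF bl\<kappa> open_UNIV]])
    from tdiff_act[OF open_UNIV tdiff_linear[OF bounded_linear_fst open_UNIV] this]
    have "tdiff k UNIV \<Phi>" by (simp add: \<Phi>_def[abs_def])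
    from tdiff_bounded_linear[OF blMi open_UNIV this] show ?thesis by (simp add: f_def[abs_def])
  qed
  then have "smooth_on UNIV f" by (simp add: smooth_on_def)
  then obtain U1 V1 g where UV: "open U1" "(0, 0) \<in> U1" "open V1" "homeomorphism U1 V1 f g"
    "smooth_on V1 g" "\<And>y. y \<in> V1 \<Longrightarrow> bij (frechet_derivative f (at (g y)))"
    "\<And>y. y \<in> V1 \<Longrightarrow> (g has_derivative inv (frechet_derivative f (at (g y)))) (at y)"
    using smooth_inverse_function[OF open_UNIV UNIV_I _ inj] by metis
  define O1 where "O1 = Mi -` V1"
  define e where "e z = g (Mi z)" for z
  have contMi: "continuous_on S Mi" for S using blMi by (rule linear_continuous_on)
  have O1: "open O1" unfolding O1_def using open_vimage[OF UV(3) contMi] .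
  have fwd: "\<Phi> p \<in> O1" "e (\<Phi> p) = p" if "p \<in> U1" for p
    using UV(4) that by (auto simp: O1_def e_def homeomorphism_def f_def[symmetric])
  have bwd: "e z \<in> U1" "\<Phi> (e z) = z" if "z \<in> O1" for z
  proof -
    have "Mi z \<in> V1" using that by (simp add: O1_def)
    then have "g (Mi z) \<in> U1" "f (g (Mi z)) = Mi z" using UV(4) by (auto simp: homeomorphism_def)
    then show "e z \<in> U1" "\<Phi> (e z) = z" unfolding e_def f_def using MMi(1) by metis+
  qed
  have conte: "continuous_on O1 e"
    unfolding e_def using UV(4)
    by (intro continuous_on_compose2[of V1 g O1 Mi] contMi) (auto simp: homeomorphism_def O1_def)
  have "tdiff k O1 (\<lambda>z. snd (e z))" for k
  proof -
    have "tdiff k O1 e" unfolding e_def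
      by (rule tdiff_compose[OF O1 UV(3) _ tdiff_linear[OF blMi O1]])
        (use UV(5) in \<open>auto simp: O1_def smooth_on_def\<close>)
    then show ?thesis by (rule tdiff_bounded_linear[OF bounded_linear_snd O1])
  qed
  moreover have "holo_on O1 (\<lambda>z. snd (e z))" if h
    unfolding holo_on_def
  proof
    fix z assume "z \<in> O1"
    then have y: "Mi z \<in> V1" by (simp add: O1_def)
    let ?A = "frechet_derivative f (at (g (Mi z)))"
    let ?D = "\<lambda>v. snd (inv ?A (Mi v))"
    have cH: "H (c *s u) = c *s H u" "\<kappa> (c *s x) = c *s \<kappa> x" for c u x
      using hol that by (auto simp: clinear_iff)
    have "M (sc c q) = c *s M q" for c q
      by (simp add: M_def sc_def cH vec_eq_iff algebra_simps)
    then have Mi_sc: "Mi (c *s v) = sc c (Mi v)" for c v using MMi by metis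
    have A_sc: "?A (sc c q) = sc c (?A q)" for c q
    proof -
      have "D\<Phi> p (sc c q) = c *s D\<Phi> p q" for p
        by (simp add: D\<Phi>_def sc_def cH vec_eq_iff algebra_simps)
      then show ?thesis by (simp add: fr Mi_sc)
    qed
    have bijA: "bij ?A" by (rule UV(6)[OF y])
    have invA_sc: "inv ?A (sc c w) = sc c (inv ?A w)" for c w
    proof -
      have "?A (sc c (inv ?A w)) = sc c w"
        unfolding A_sc surj_f_inv_f[OF bij_is_surj[OF bijA]] ..
      from inv_f_eq[OF bij_is_inj[OF bijA] this] show ?thesis .
    qed
    have "((\<lambda>z. g (Mi z)) has_derivative (\<lambda>v. inv ?A (Mi v))) (at z)"
      using diff_chain_at[OF bounded_linear_imp_has_derivative[OF blMi] UV(7)[OF y]] by (simp add: o_def)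
    from bounded_linear.has_derivative[OF bounded_linear_snd this]
    have der: "((\<lambda>z. snd (e z)) has_derivative ?D) (at z)" by (simp add: e_def)
    have "?D (v + w) = ?D v + ?D w" for v w using has_derivative_linear[OF der] by (rule linear_add)
    moreover have "?D (c *s v) = c *s ?D v" for c v by (simp add: Mi_sc invA_sc) (simp add: sc_def)
    ultimately have "clinear ?D" by (simp add: clinear_iff)
    then show "\<exists>D. ((\<lambda>z. snd (e z)) has_derivative D) (at z) \<and> clinear D" using der by blast
  qed
  ultimately have sreg: "sreg h O1 (\<lambda>z. snd (e z))" by (simp add: sreg_def smooth_on_def)
  have "z0 \<in> O1" using fwd(1)[OF UV(2)] \<Phi>0 by simp
  show ?thesis
    by (rule that[OF UV(1,2) O1 \<open>z0 \<in> O1\<close> _ _ conte sreg])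
      (use fwd[of "(_, _)"] bwd in \<open>auto simp: \<Phi>_def\<close>)
qed

text \<open>The inverse function theorem gives injectivity for small \<open>u\<close> only, whereas
  an orbit might return to the transversal after a long translation. Small variation of
  \<open>W\<close> on the transversal excludes this, since \<open>W\<close> measures the
  translation.\<close>

lemma quotient_chart_exists:
  fixes \<kappa> :: "complex ^ 'k::finite \<Rightarrow> complex ^ 'm"
  assumes z0: "z0 \<in> U" and \<kappa>: "linear \<kappa>" and hol: "h \<Longrightarrow> clinear H" "h \<Longrightarrow> clinear \<kappa>"
    and bij: "bij (\<lambda>q. H (fst q) * z0 + \<kappa> (snd q))"
  shows "\<exists>V (\<phi> :: (complex ^ 'm) set \<Rightarrow> complex ^ 'k). pr z0 \<in> V \<and> quotient_chart (sreg h) G U (V, \<phi>)"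
proof -
  obtain U1 O1 e where UO: "open U1" "(0, 0) \<in> U1" "open O1" "z0 \<in> O1"
    and fwd: "\<And>u x. (u, x) \<in> U1 \<Longrightarrow> act u (z0 + \<kappa> x) \<in> O1 \<and> e (act u (z0 + \<kappa> x)) = (u, x)"
    and bwd: "\<And>z. z \<in> O1 \<Longrightarrow> e z \<in> U1 \<and> act (fst (e z)) (z0 + \<kappa> (snd (e z))) = z"
    and e: "continuous_on O1 e" "sreg h O1 (\<lambda>z. snd (e z))"
    using local_product[OF \<kappa> hol bij] by metis
  define \<tau> where "\<tau> x = z0 + \<kappa> x" for x
  have \<tau>0: "\<tau> 0 = z0" by (simp add: \<tau>_def linear_0[OF \<kappa>])
  have \<tau>reg: "sreg h S \<tau>" if "open S" for S
    using sreg_affine[OF \<kappa> hol(2) that] by (simp add: \<tau>_def[abs_def])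
  have cont\<tau>: "continuous_on UNIV \<tau>" using sreg_continuous[OF \<tau>reg[OF open_UNIV]] .
  obtain A1 A2 where A: "open A1" "open A2" "(0 :: complex ^ 'l) \<in> A1" "(0 :: complex ^ 'k) \<in> A2" "A1 \<times> A2 \<subseteq> U1"
    using open_prod_elim[OF UO(1,2)] by (metis mem_Sigma_iff)
  obtain r where r: "r > 0" "ball 0 r \<subseteq> A1" using A(1,3) open_contains_ball by blast
  \<comment> \<open>If two points of the transversal on one orbit have \<open>W\<close> within
    \<open>r / 2\<close> of \<open>W z0\<close>, they differ by some \<open>u\<close> of norm below
    \<open>r\<close>, and this \<open>u\<close> lies in \<open>A1\<close>.\<close>
  define Q where "Q = A2 \<inter> \<tau> -` (U \<inter> W -` ball (W z0) (r / 2))"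
  have "open (U \<inter> W -` ball (W z0) (r / 2))"
    by (rule continuous_open_preimage[OF continuous_W open_U_space open_ball])
  then have "open (\<tau> -` (U \<inter> W -` ball (W z0) (r / 2)))" by (rule open_vimage[OF _ cont\<tau>])
  then have openQ: "open Q" unfolding Q_def by (rule open_Int[OF A(2)])
  have Q0: "0 \<in> Q" using A(4) z0 r(1) by (simp add: Q_def \<tau>0)
  have QU: "\<tau> x \<in> U" if "x \<in> Q" for x using that by (simp add: Q_def)
  have sep: "u = 0 \<and> x = x'" if "x \<in> Q" "x' \<in> Q" "\<tau> x' = act u (\<tau> x)" for x x' u
  proof -
    have "W (\<tau> x') = W (\<tau> x) + u" using that QU W_act by metis
    moreover have "dist (W z0) (W (\<tau> x)) < r / 2" "dist (W z0) (W (\<tau> x')) < r / 2"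
      using that by (auto simp: Q_def)
    ultimately have "norm u < r"
      using dist_triangle_half_r[of "W z0" "W (\<tau> x)" r "W (\<tau> x')"] by (simp add: dist_norm)
    then have "(u, x) \<in> U1" "(0, x') \<in> U1" using that A r by (auto simp: Q_def)
    from fwd[OF this(1)] fwd[OF this(2)] show ?thesis using that(3) by (simp add: \<tau>_def)
  qed
  define V where "V = pr ` \<tau> ` Q"
  have inj: "inj_on (pr \<circ> \<tau>) Q"
    by (rule inj_onI) (use sep orbit_eq_iff in auto)
  define \<phi> where "\<phi> = inv_into Q (pr \<circ> \<tau>)"
  have \<phi>: "\<phi> (pr (\<tau> x)) = x" if "x \<in> Q" for x
    using inv_into_f_f[OF inj that] by (simp add: \<phi>_def)
  have \<phi>V: "\<phi> ` V = Q" using \<phi> by (force simp: V_def)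
  define S where "S = {z \<in> U. pr z \<in> V}"
  have S_iff: "z \<in> S \<longleftrightarrow> (\<exists>u. \<exists>x\<in>Q. z = act u (\<tau> x))" for z
  proof
    assume "z \<in> S"
    then obtain x where "x \<in> Q" "pr (\<tau> x) = pr z" by (auto simp: S_def V_def)
    then show "\<exists>u. \<exists>x\<in>Q. z = act u (\<tau> x)" using orbit_eq_iff by blast
  next
    assume "\<exists>u. \<exists>x\<in>Q. z = act u (\<tau> x)"
    then show "z \<in> S" using QU by (auto simp: S_def V_def)
  qed
  \<comment> \<open>Each point over \<open>V\<close> is first moved back to the transversal by a
    fixed group element; there \<open>local_product\<close> describes the chart as the second
    component of \<open>e\<close>.\<close>
  have local: "\<exists>T. open T \<and> z1 \<in> T \<and> T \<subseteq> S \<and> sreg h T (\<phi> \<circ> pr)" if z1: "z1 \<in> S" for z1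
  proof -
    obtain u1 x1 where u1: "x1 \<in> Q" "z1 = act u1 (\<tau> x1)" using z1 S_iff by blast
    define m where "m z = 0 + vexp (H (- u1)) * z" for z
    have m_eq: "m z = act (- u1) z" for z by (simp add: m_def act_def)
    have mreg: "sreg h T m" if "open T" for T
      unfolding m_def[abs_def] by (rule sreg_affine[OF _ _ that])
        (auto intro!: linearI simp: clinear_iff vec_eq_iff algebra_simps)
    define T where "T = m -` (O1 \<inter> (\<lambda>z. snd (e z)) -` Q)"
    have "open (O1 \<inter> (\<lambda>z. snd (e z)) -` Q)"
      by (rule continuous_open_preimage[OF sreg_continuous[OF e(2)] UO(3) openQ])
    then have T: "open T" unfolding T_def
      by (rule open_vimage[OF _ sreg_continuous[OF mreg[OF open_UNIV]]])
    have "(0, x1) \<in> U1" using u1(1) A by (auto simp: Q_def)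
    from fwd[OF this] have "z1 \<in> T" using u1 by (simp add: T_def m_eq \<tau>_def[symmetric])
    have rep: "z = act (u1 + fst (e (m z))) (\<tau> (snd (e (m z))))" "snd (e (m z)) \<in> Q" if "z \<in> T" for z
    proof -
      have "m z \<in> O1" "snd (e (m z)) \<in> Q" using that by (auto simp: T_def)
      from bwd[OF this(1)] have "act (fst (e (m z))) (\<tau> (snd (e (m z)))) = act (- u1) z"
        by (simp add: \<tau>_def m_eq)
      then show "z = act (u1 + fst (e (m z))) (\<tau> (snd (e (m z))))" by (simp add: act_add)
      show "snd (e (m z)) \<in> Q" by fact
    qed
    have "T \<subseteq> S" using rep S_iff by blast
    moreover have "sreg h T (\<lambda>z. snd (e (m z)))"
      by (rule sreg_compose[OF T UO(3) _ mreg[OF T] e(2)]) (auto simp: T_def)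
    then have "sreg h T (\<phi> \<circ> pr)"
    proof (rule sreg_cong[OF T, rotated])
      fix z assume "z \<in> T"
      then show "snd (e (m z)) = (\<phi> \<circ> pr) z" using rep[of z] \<phi> orbit_act by (metis comp_apply)
    qed
    ultimately show ?thesis using T \<open>z1 \<in> T\<close> by blast
  qed
  have S: "open S" using local by (subst open_subopen) blast
  have reg: "sreg h S (\<phi> \<circ> pr)" using local by (intro sreg_local) blast
  have VU: "V \<subseteq> pr ` U" using QU by (auto simp: V_def)
  have openV: "openin X V"
    unfolding openin_orbit_space S_def[symmetric] openin_open_eq[OF open_U_space]
    using VU S by (auto simp: S_def)
  have chart: "is_chart X (V, \<phi>)"
    unfolding is_chart_def
  proof (clarsimp simp: \<phi>V openQ openV)
    have topV: "topspace (subtopology X V) = V" using VU by (auto simp: topspace_orbit_space)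
    have "homeomorphic_maps (subtopology X V) (top_of_set Q) \<phi> (pr \<circ> \<tau>)"
      unfolding homeomorphic_maps_def topV
    proof (intro conjI ballI)
      show "continuous_map (subtopology X V) (top_of_set Q) \<phi>"
        unfolding continuous_map_def topV
      proof (intro conjI allI impI)
        show "\<phi> \<in> V \<rightarrow> topspace (top_of_set Q)" using \<phi>V by auto
        fix T assume T: "openin (top_of_set Q) T"
        have "open T" using openin_open_trans[OF T openQ] .
        have "open (S \<inter> (\<phi> \<circ> pr) -` T)"
          by (rule continuous_open_preimage[OF sreg_continuous[OF reg] S \<open>open T\<close>])
        moreover have "{z \<in> U. pr z \<in> {P \<in> V. \<phi> P \<in> T}} = S \<inter> (\<phi> \<circ> pr) -` T" by (auto simp: S_def)
        ultimately have "openin X {P \<in> V. \<phi> P \<in> T}"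
          unfolding openin_orbit_space openin_open_eq[OF open_U_space] using VU by (auto simp: S_def)
        then show "openin (subtopology X V) {P \<in> V. \<phi> P \<in> T}"
          using openV by (auto simp: openin_open_subtopology)
      qed
      have "continuous_map (top_of_set Q) (top_of_set U) \<tau>"
        using continuous_on_subset[OF cont\<tau>] QU by auto
      then have "continuous_map (top_of_set Q) X (pr \<circ> \<tau>)"
        using continuous_map_orbit by (rule continuous_map_compose)
      then show "continuous_map (top_of_set Q) (subtopology X V) (pr \<circ> \<tau>)"
        by (auto simp: continuous_map_in_subtopology V_def)
      show "(pr \<circ> \<tau>) (\<phi> P) = P" if "P \<in> V" for P using that \<phi> by (auto simp: V_def)
      show "\<phi> ((pr \<circ> \<tau>) x) = x" if "x \<in> topspace (top_of_set Q)" for x using that \<phi> by simp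
    qed
    then show "homeomorphic_map (subtopology X V) (top_of_set Q) \<phi>" by (auto simp: homeomorphic_map_maps)
  qed
  \<comment> \<open>On a translated copy of the transversal the chart is the identity in the
    coordinate \<open>x\<close>, so its derivative has a right inverse.\<close>
  have "surj (frechet_derivative (\<phi> \<circ> pr) (at z))" if "z \<in> S" for z
  proof -
    obtain u1 x1 where u1: "x1 \<in> Q" "z = act u1 (\<tau> x1)" using \<open>z \<in> S\<close> S_iff by blast
    let ?D = "frechet_derivative (\<phi> \<circ> pr) (at z)" and ?s = "\<lambda>x. act u1 (\<tau> x)"
    have "(\<tau> has_derivative frechet_derivative \<tau> (at x1)) (at x1)"
      using sreg_has_derivative(1)[OF \<tau>reg[OF open_UNIV]] by simp
    from act_has_derivative[OF has_derivative_const this]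
    obtain E where E: "(?s has_derivative E) (at x1)" by blast
    have "((\<phi> \<circ> pr) has_derivative ?D) (at (?s x1))"
      using sreg_has_derivative(1)[OF reg that] u1 by simp
    from diff_chain_at[OF E this] have "((\<lambda>x. x) has_derivative ?D \<circ> E) (at x1)"
      by (rule has_derivative_transform_within_open[OF _ openQ u1(1)]) (use \<phi> in auto)
    then have "?D \<circ> E = (\<lambda>x. x)" using has_derivative_unique has_derivative_ident by blast
    then show ?thesis by (metis comp_apply surjI)
  qed
  then have "quotient_chart (sreg h) G U (V, \<phi>)"
    using chart reg by (auto simp: quotient_chart_def S_def)
  moreover have "pr z0 \<in> V" unfolding V_def using imageI[OF imageI[OF Q0, of \<tau>], of pr] \<tau>0 by simp
  ultimately show ?thesis by blast
qed

end

section \<open>Transport of manifold structures\<close>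

lemma homeomorphic_map_inv_into:
  assumes "homeomorphic_map X Y f"
  shows "homeomorphic_map Y X (inv_into (topspace X) f)"
proof -
  obtain g where g: "homeomorphic_maps X Y f g" using assms by (auto simp: homeomorphic_map_maps)
  have inj: "inj_on f (topspace X)" using assms by (rule homeomorphic_imp_injective_map)
  have "homeomorphic_map Y X g" using g homeomorphic_maps_sym homeomorphic_map_maps by blast
  moreover have "g y = inv_into (topspace X) f y" if "y \<in> topspace Y" for y
  proof -
    have "g y \<in> topspace X" "f (g y) = y"
      using g that by (auto simp: homeomorphic_maps_def continuous_map_def)
    then show ?thesis using inv_into_f_f[OF inj, of "g y"] by simp
  qed
  ultimately show ?thesis by (rule homeomorphic_map_eq)
qed

lemma open_chart_image:
  assumes c: "is_chart X (V, \<phi>)" and W: "openin X W" "W \<subseteq> V"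
  shows "open (\<phi> ` W)"
proof -
  have "open_map (subtopology X V) (top_of_set (\<phi> ` V)) \<phi>"
    using c by (auto simp: is_chart_def dest: homeomorphic_imp_open_map)
  moreover have "openin (subtopology X V) W" using W c by (auto simp: is_chart_def openin_open_subtopology)
  ultimately have "openin (top_of_set (\<phi> ` V)) (\<phi> ` W)" by (auto simp: open_map_def)
  then show ?thesis using c by (auto simp: is_chart_def dest: openin_open_trans)
qed

text \<open>Weaker than being the transported atlas, this also covers an atlas kept in place,
  through the identity; maps can thus be transported at one end or at both.\<close>

definition atlas_via ::
    "('x \<Rightarrow> 'y) \<Rightarrow> ('x set \<times> ('x \<Rightarrow> 'e)) set \<Rightarrow> ('y set \<times> ('y \<Rightarrow> 'e)) set \<Rightarrow> bool" where
  "atlas_via f A B \<longleftrightarrow> (\<forall>(W, \<psi>)\<in>B. \<exists>(V, \<phi>)\<in>A. W = f ` V \<and> (\<forall>x\<in>V. \<psi> (f x) = \<phi> x))"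

lemma atlas_via_id: "atlas_via (\<lambda>x. x) A A"
  by (fastforce simp: atlas_via_def)

lemma atlas_via_transport:
  assumes "inj_on f T" "\<And>V \<phi>. (V, \<phi>) \<in> A \<Longrightarrow> V \<subseteq> T"
  shows "atlas_via f A (transport_atlas T f A)"
  unfolding atlas_via_def transport_atlas_def
proof clarify
  fix V \<phi> assume *: "(V, \<phi>) \<in> A"
  have "(\<phi> \<circ> inv_into T f) (f x) = \<phi> x" if "x \<in> V" for x
    using assms(2)[OF *] that by (simp add: inv_into_f_f[OF assms(1)] subset_iff)
  then show "\<exists>(V', \<phi>')\<in>A. f ` V = f ` V' \<and> (\<forall>x\<in>V'. (\<phi> \<circ> inv_into T f) (f x) = \<phi>' x)"
    using * by blast
qed

text \<open>Matched charts have the same images and the same coordinate representations of the map,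
  so the new representation agrees with the old one on the relevant open set; \<open>cong\<close>
  disregards the values elsewhere.\<close>

lemma manifold_map_via:
  fixes reg :: "'e::euclidean_space set \<Rightarrow> ('e \<Rightarrow> 'f::euclidean_space) \<Rightarrow> bool"
  assumes mm: "manifold_map reg X A Y B F"
    and cong: "\<And>S f g. open S \<Longrightarrow> (\<And>x. x \<in> S \<Longrightarrow> f x = g x) \<Longrightarrow> reg S f \<Longrightarrow> reg S g"
    and A: "\<And>c. c \<in> A \<Longrightarrow> is_chart X c" and B: "\<And>W \<psi>. (W, \<psi>) \<in> B \<Longrightarrow> openin Y W"
    and \<alpha>: "inj_on \<alpha> (topspace X)" "atlas_via \<alpha> A A'"
    and \<beta>: "inj_on \<beta> (topspace Y)" "atlas_via \<beta> B B'"
    and F': "\<And>x. x \<in> topspace X \<Longrightarrow> F' (\<alpha> x) = \<beta> (F x)" and cont: "continuous_map X' Y' F'"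
  shows "manifold_map reg X' A' Y' B' F'"
  unfolding manifold_map_def
proof (intro conjI cont ballI, clarify)
  fix V' \<phi>' W' \<psi>' assume "(V', \<phi>') \<in> A'" "(W', \<psi>') \<in> B'"
  then obtain V \<phi> W \<psi> where V: "(V, \<phi>) \<in> A" "V' = \<alpha> ` V" "\<And>x. x \<in> V \<Longrightarrow> \<phi>' (\<alpha> x) = \<phi> x"
    and W: "(W, \<psi>) \<in> B" "W' = \<beta> ` W" "\<And>y. y \<in> W \<Longrightarrow> \<psi>' (\<beta> y) = \<psi> y"
    using \<alpha>(2) \<beta>(2) unfolding atlas_via_def by fast
  have VX: "openin X V" "V \<subseteq> topspace X" using A[OF V(1)] by (auto simp: is_chart_def openin_subset)
  have WY: "openin Y W" "W \<subseteq> topspace Y" using B[OF W(1)] by (auto simp: openin_subset)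
  have inj: "inj_on \<phi> V" using A[OF V(1)] by (rule is_chart_inj)
  have contF: "continuous_map X Y F" using mm by (simp add: manifold_map_def)
  let ?P = "{x \<in> V. F x \<in> W}"
  have FY: "F x \<in> topspace Y" if "x \<in> V" for x using contF VX(2) that by (auto simp: continuous_map_def)
  have mem: "F' (\<alpha> x) \<in> W' \<longleftrightarrow> F x \<in> W" if "x \<in> V" for x
  proof -
    have "F' (\<alpha> x) = \<beta> (F x)" using F' VX(2) that by blast
    then show ?thesis using inj_on_image_mem_iff[OF \<beta>(1) FY[OF that] WY(2)] W(2) by simp
  qed
  have img: "\<phi>' ` {x \<in> V'. F' x \<in> W'} = \<phi> ` ?P"
    using mem V by (auto simp: image_iff) metis+
  have "?P = {x \<in> topspace X. F x \<in> W} \<inter> V" using VX(2) by auto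
  then have "openin X ?P" using openin_continuous_map_preimage[OF contF WY(1)] VX(1) by (simp add: openin_Int)
  then have opn: "open (\<phi> ` ?P)" by (rule open_chart_image[OF A[OF V(1)]]) auto
  have inj': "inj_on \<phi>' V'"
    unfolding V(2) using inj V(3) by (auto simp: inj_on_def)
  have "reg (\<phi> ` ?P) (\<psi> \<circ> F \<circ> inv_into V \<phi>)"
    using mm V(1) W(1) by (auto simp: manifold_map_def)
  then have "reg (\<phi> ` ?P) (\<psi>' \<circ> F' \<circ> inv_into V' \<phi>')"
  proof (rule cong[OF opn, rotated])
    fix y assume "y \<in> \<phi> ` ?P"
    then obtain x where x: "x \<in> V" "F x \<in> W" "y = \<phi> x" by blast
    have "inv_into V \<phi> y = x" using x inv_into_f_f[OF inj] by simp
    moreover have "inv_into V' \<phi>' y = \<alpha> x"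
      using x V by (intro inv_into_f_eq[OF inj']) auto
    moreover have "F' (\<alpha> x) = \<beta> (F x)" using F' VX(2) x by blast
    ultimately show "(\<psi> \<circ> F \<circ> inv_into V \<phi>) y = (\<psi>' \<circ> F' \<circ> inv_into V' \<phi>') y"
      using W(3)[OF x(2)] by simp
  qed
  then show "reg (\<phi>' ` {x \<in> V'. F' x \<in> W'}) (\<psi>' \<circ> F' \<circ> inv_into V' \<phi>')" by (simp add: img)
qed

text \<open>The transition maps of the new atlas are chart representations of the identity, so
  \<open>manifold_map_via\<close> with the same bijection at both ends handles them.\<close>

lemma is_manifold_transport:
  fixes reg :: "'e::euclidean_space set \<Rightarrow> ('e \<Rightarrow> 'e) \<Rightarrow> bool"
  assumes mf: "is_manifold reg X A" and f: "homeomorphic_map X Y f"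
    and cong: "\<And>S f g. open S \<Longrightarrow> (\<And>x. x \<in> S \<Longrightarrow> f x = g x) \<Longrightarrow> reg S f \<Longrightarrow> reg S g"
  shows "is_manifold reg Y (transport_atlas (topspace X) f A)"
proof -
  let ?T = "topspace X" and ?B = "transport_atlas (topspace X) f A"
  let ?g = "inv_into ?T f"
  have inj: "inj_on f ?T" using f by (rule homeomorphic_imp_injective_map)
  have chart: "is_chart X c" if "c \<in> A" for c using mf that by (simp add: is_manifold_def)
  have VX: "openin X V" "V \<subseteq> ?T" if "(V, \<phi>) \<in> A" for V \<phi>
    using chart[OF that] by (auto simp: is_chart_def openin_subset)
  have g: "homeomorphic_map Y X ?g" using f by (rule homeomorphic_map_inv_into)
  have gf: "?g ` f ` V = V" if "V \<subseteq> ?T" for V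
    using inv_into_image_cancel[OF inj that] .
  have fV: "openin Y (f ` V)" if "openin X V" for V
    using homeomorphic_imp_open_map[OF f] that by (simp add: open_map_def)
  have "manifold_map reg X A X A (\<lambda>x. x)"
    using mf by (auto simp: manifold_map_def is_manifold_def o_def Int_def)
  then have "manifold_map reg Y ?B Y ?B (\<lambda>x. x)"
  proof (rule manifold_map_via[OF _ cong chart])
    show "atlas_via f A ?B" using VX(2) by (intro atlas_via_transport[OF inj]) blast
    then show "atlas_via f A ?B" .
  qed (use inj VX in auto)
  then have trans: "\<forall>(V, \<phi>)\<in>?B. \<forall>(W, \<psi>)\<in>?B. reg (\<phi> ` (V \<inter> W)) (\<psi> \<circ> inv_into V \<phi>)"
    by (simp add: manifold_map_def o_def Int_def)
  have chartB: "is_chart Y (f ` V, \<phi> \<circ> ?g)" if c: "(V, \<phi>) \<in> A" for V \<phi>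
  proof -
    have img: "(\<phi> \<circ> ?g) ` f ` V = \<phi> ` V" unfolding image_comp[symmetric] gf[OF VX(2)[OF c]] ..
    have "homeomorphic_map (subtopology Y (f ` V)) (subtopology X V) ?g"
    proof (rule homeomorphic_map_subtopologies[OF g])
      have "topspace Y \<inter> f ` V = f ` V"
        using openin_subset[OF fV[OF VX(1)[OF c]]] by blast
      then show "?g ` (topspace Y \<inter> f ` V) = topspace X \<inter> V" using gf VX(2)[OF c] by auto
    qed
    then have "homeomorphic_map (subtopology Y (f ` V)) (top_of_set (\<phi> ` V)) (\<phi> \<circ> ?g)"
      using chart[OF c] by (auto simp: is_chart_def intro: homeomorphic_map_compose)
    then show ?thesis
      unfolding is_chart_def prod.case img
      using fV[OF VX(1)[OF c]] chart[OF c] by (simp add: is_chart_def)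
  qed
  have "(\<Union>c\<in>?B. fst c) = f ` (\<Union>c\<in>A. fst c)"
    by (force simp: transport_atlas_def)
  then have cover: "(\<Union>c\<in>?B. fst c) = topspace Y"
    using mf homeomorphic_imp_surjective_map[OF f] by (simp add: is_manifold_def)
  have hom: "X homeomorphic_space Y" using f by (rule homeomorphic_map_imp_homeomorphic_space)
  have "\<forall>c\<in>?B. is_chart Y c" using chartB by (auto simp: transport_atlas_def)
  then show ?thesis
    using mf cover trans homeomorphic_Hausdorff_space[OF hom] homeomorphic_space_second_countability[OF hom]
    by (simp add: is_manifold_def)
qed

section \<open>Torus symmetry\<close>

context slice_action
begin

lemma act_mult: "act u (t * z) = t * act u z"
  by (simp add: act_def mult_ac)

lemma orbit_mult: "(*) t ` pr z = pr (t * z)"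
  by (auto simp: orbit_eq act_mult)

lemma torus_norm: "t \<in> compact_torus \<Longrightarrow> norm ((t * z) $ i) = norm (z $ i)"
  by (simp add: compact_torus_def norm_mult dist_norm)

lemma torus_U: "t \<in> compact_torus \<Longrightarrow> t * z \<in> U \<longleftrightarrow> z \<in> U"
proof -
  assume "t \<in> compact_torus"
  then have "(t * z) $ i = 0 \<longleftrightarrow> z $ i = 0" for i using torus_norm[of t z i] by (metis norm_eq_zero)
  then show ?thesis by (simp only: U_iff)
qed

lemma torus_Z: "t \<in> compact_torus \<Longrightarrow> t * z \<in> Z \<longleftrightarrow> z \<in> Z"
  by (simp only: Z_iff torus_norm)

lemma torus_slice:
  assumes "t \<in> compact_torus" "z \<in> U"
  shows "slice (t * z) = t * slice z"
proof -
  \<comment> \<open>Multiplication by a torus element preserves moduli, which is equivariance with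
    \<open>u = 0\<close>.\<close>
  have "W (t * z) = W z + 0"
    using torus_norm[OF assms(1)] by (intro equivariant_map_eq assms) (simp add: linear_0[OF B_linear])
  then show ?thesis by (simp add: slice_def act_mult)
qed

lemma torus_rep:
  assumes t: "t \<in> compact_torus" and z: "z \<in> U"
  shows "rep (pr (t * z)) = t * rep (pr z)"
proof -
  let ?w = "rep (pr z)"
  have w: "?w \<in> Z" "pr ?w = pr z" using rep_orbit[OF z] by auto
  have "pr (t * ?w) = pr (t * z)" using w(2) by (simp only: orbit_mult[symmetric])
  then have "rep (pr (t * z)) = rep (pr (t * ?w))" by simp
  also have "\<dots> = t * ?w" using w(1) torus_Z[OF t] by (intro rep_Z) simp
  finally show ?thesis .
qed

end

context complex_slice_action
begin

text \<open>At every point the tangent space of the orbit has a complement of the dimension of the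
  model space, complex linear if required, and this supplies a chart there.\<close>

lemma is_manifold_quotient:
  fixes A :: "((complex ^ 'm) set set \<times> ((complex ^ 'm) set \<Rightarrow> complex ^ 'k::finite)) set"
  assumes card: "CARD('m) = CARD('l) + CARD('k)" and hol: "h \<Longrightarrow> clinear H"
    and A: "A = {c. quotient_chart (sreg h) G U c}"
  shows "is_manifold (sreg h) X A"
proof (rule quotient_manifold[OF open_U_space Hausdorff_orbit_space
      second_countable_orbit_space])
  fix z assume z: "z \<in> U"
  have lin: "linear (\<lambda>u. H u * z)"
    by (intro linearI) (auto simp: linear_add[OF H_linear] linear_scale[OF H_linear] vec_eq_iff algebra_simps)
  have "\<exists>\<kappa> :: complex ^ 'k \<Rightarrow> complex ^ 'm. linear \<kappa> \<and> (h \<longrightarrow> clinear \<kappa>) \<and>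
      bij (\<lambda>q. H (fst q) * z + \<kappa> (snd q))"
  proof (cases h)
    case True
    then have cl: "clinear (\<lambda>u. H u * z)" using hol by (auto simp: clinear_iff vec_eq_iff algebra_simps)
    obtain \<kappa> :: "complex ^ 'k \<Rightarrow> complex ^ 'm"
      where "clinear \<kappa>" "bij (\<lambda>q. H (fst q) * z + \<kappa> (snd q))"
      by (rule clinear_complement[OF cl infinitesimal_action_inj[OF z] card]) (rule that)
    then show ?thesis using clinear_imp_linear[of \<kappa>] by (intro exI[of _ \<kappa>]) simp
  next
    case False
    have dim: "DIM(complex ^ 'm) = DIM(complex ^ 'l) + DIM(complex ^ 'k)" using card by simp
    obtain \<kappa> :: "complex ^ 'k \<Rightarrow> complex ^ 'm"
      where "linear \<kappa>" "bij (\<lambda>q. H (fst q) * z + \<kappa> (snd q))"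
      by (rule linear_complement[OF lin infinitesimal_action_inj[OF z] dim]) (rule that)
    then show ?thesis using False by (intro exI[of _ \<kappa>]) simp
  qed
  then obtain \<kappa> :: "complex ^ 'k \<Rightarrow> complex ^ 'm" where \<kappa>: "linear \<kappa>" "h \<Longrightarrow> clinear \<kappa>"
    "bij (\<lambda>q. H (fst q) * z + \<kappa> (snd q))" by blast
  obtain V and \<phi> :: "(complex ^ 'm) set \<Rightarrow> complex ^ 'k"
    where "pr z \<in> V" "quotient_chart (sreg h) G U (V, \<phi>)"
    using quotient_chart_exists[OF z \<kappa>(1) hol \<kappa>(2,3)] by blast
  then show "\<exists>c\<in>A. pr z \<in> fst c" unfolding A by force
qed (simp add: A)

end

text \<open>Both actions have the real part \<open>B\<close>, so they share \<open>U\<close>,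
  \<open>Z\<close> and literally the same \<open>W\<close>.\<close>

locale action_pair = P: complex_slice_action a K B H + Q: complex_slice_action a K B H'
  for a :: "'m::finite \<Rightarrow> 'v::euclidean_space" and K and B :: "complex ^ 'l::finite \<Rightarrow> real ^ 'm" and H H'
begin

text \<open>Both quotients are identified with the common slice, on which the equivariant map vanishes.\<close>

definition transfer :: "(complex ^ 'm) set \<Rightarrow> (complex ^ 'm) set" where
  "transfer R = Q.pr (P.slice (SOME z. z \<in> P.U \<and> P.pr z = R))"

lemma transfer_orbit: assumes "z \<in> P.U" shows "transfer (P.pr z) = Q.pr (P.slice z)"
proof -
  define w where "w = (SOME w. w \<in> P.U \<and> P.pr w = P.pr z)"
  have "w \<in> P.U \<and> P.pr w = P.pr z"
    unfolding w_def by (rule someI[of _ z]) (simp add: assms)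
  then have "P.slice w = P.slice z" using P.orbit_eq_iff_slice[of w z] assms by blast
  then show ?thesis by (simp add: transfer_def w_def)
qed

lemma continuous_transfer: "continuous_map P.X Q.X transfer"
proof (rule continuous_compose_quotient_map[OF P.quotient_map_orbit])
  have "continuous_map (top_of_set P.U) (top_of_set P.U) P.slice"
    using P.continuous_slice by auto
  then have "continuous_map (top_of_set P.U) Q.X (Q.pr \<circ> P.slice)"
    using Q.continuous_map_orbit by (rule continuous_map_compose)
  then show "continuous_map (top_of_set P.U) Q.X (transfer \<circ> P.pr)"
    by (rule continuous_map_eq) (simp add: transfer_orbit)
qed

text \<open>\<open>W\<close> vanishes on the slice, so the second projection translates by
  zero.\<close>

lemma slice_slice: "z \<in> P.U \<Longrightarrow> Q.slice (P.slice z) = P.slice z"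
  unfolding Q.slice_def by (simp add: P.W_slice)

end

lemma manifold_map_mono:
  assumes "manifold_map reg X A Y B F" "\<And>S f. reg S f \<Longrightarrow> reg' S f"
  shows "manifold_map reg' X A Y B F"
  using assms unfolding manifold_map_def by blast

lemma is_manifold_mono:
  assumes "is_manifold reg X A" "\<And>S f. reg S f \<Longrightarrow> reg' S f"
  shows "is_manifold reg' X A"
  using assms(1) by (simp add: is_manifold_def case_prod_unfold assms(2))

lemma quotient_chart_mono:
  assumes "quotient_chart reg G U c" "\<And>S f. reg S f \<Longrightarrow> reg' S f"
  shows "quotient_chart reg' G U c"
proof (cases c)
  case (Pair V \<phi>)
  show ?thesis using assms unfolding Pair quotient_chart_def prod.case by blast
qed

lemma quotient_chart_openin:
  "quotient_chart reg G U (V, \<phi>) \<Longrightarrow> openin (orbit_space G U) V"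
  "quotient_chart reg G U c \<Longrightarrow> is_chart (orbit_space G U) c"
  by (auto simp: quotient_chart_def is_chart_def split: prod.splits)

text \<open>The second copy, with exchanged roles, provides the inverse of
  \<open>transfer\<close>.\<close>

locale action_pairs = action_pair a K B H H' + S: action_pair a K B H' H
  for a :: "'m::finite \<Rightarrow> 'v::euclidean_space" and K and B :: "complex ^ 'l::finite \<Rightarrow> real ^ 'm" and H H' +
  assumes holomorphic: "clinear H"
begin

lemma transfer_back: "z \<in> P.U \<Longrightarrow> S.transfer (transfer (P.pr z)) = P.pr z"
  by (simp add: transfer_orbit S.transfer_orbit slice_slice)

lemma transfer_forth: "z \<in> P.U \<Longrightarrow> transfer (S.transfer (Q.pr z)) = Q.pr z"
  by (simp add: transfer_orbit S.transfer_orbit S.slice_slice)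

lemma homeomorphic_transfer: "homeomorphic_map P.X Q.X transfer"
proof -
  have "homeomorphic_maps P.X Q.X transfer S.transfer"
    unfolding homeomorphic_maps_def
    using continuous_transfer S.continuous_transfer transfer_back transfer_forth
    by (auto simp: topspace_orbit_space)
  then show ?thesis by (auto simp: homeomorphic_map_maps)
qed

text \<open>Not defined as the point of \<open>Z\<close> on the orbit itself: the path goes along
  that orbit to the slice and from there along an orbit of the other group to \<open>Z\<close>. This
  makes it smooth for the atlas that \<open>Z\<close> receives from the real quotient.\<close>

definition to_Z :: "(complex ^ 'm) set \<Rightarrow> complex ^ 'm" where
  "to_Z R = Q.rep (transfer R)"

lemma homeomorphic_to_Z: "homeomorphic_map P.X (top_of_set P.Z) to_Z"
  using homeomorphic_map_compose[OF homeomorphic_transfer Q.homeomorphic_rep]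
  by (simp add: to_Z_def[abs_def] o_def)

lemma to_Z_torus:
  assumes t: "t \<in> compact_torus" and R: "R \<in> topspace P.X"
  shows "to_Z ((*) t ` R) = t * to_Z R"
proof -
  obtain z where z: "z \<in> P.U" "R = P.pr z" using R by (auto simp: topspace_orbit_space)
  have "to_Z ((*) t ` R) = Q.rep (Q.pr (P.slice (t * z)))"
    using z P.torus_U[OF t] by (simp add: to_Z_def P.orbit_mult transfer_orbit)
  also have "\<dots> = t * to_Z R"
    using z P.torus_slice[OF t] Q.torus_rep[OF t, of "P.slice z"] by (simp add: to_Z_def transfer_orbit)
  finally show ?thesis .
qed

text \<open>The charts in \<open>A\<close> are smooth and holomorphic at once: holomorphy gives the
  complex structures, smoothness the comparison with \<open>Z\<close>. The diffeomorphism is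
  \<open>transfer\<close> read through \<open>rep\<close>; its lifts in the two directions are the
  smooth projections \<open>P.slice\<close> and \<open>Q.slice\<close>.\<close>

lemma quotient_structures:
  fixes A :: "((complex ^ 'm) set set \<times> ((complex ^ 'm) set \<Rightarrow> complex ^ 'k::finite)) set"
  assumes card: "CARD('m) = CARD('l) + CARD('k)"
    and A_def: "A = {c. quotient_chart (sreg True) P.G P.U c}"
    and C_def: "C = transport_atlas (topspace Q.X) Q.rep {c. quotient_chart smooth_on Q.G P.U c}"
    and D_def: "D = transport_atlas (topspace P.X) to_Z A"
  shows "complex_manifold P.X A"
    and "diffeomorphism P.X A (top_of_set P.Z) C to_Z"
    and "complex_manifold (top_of_set P.Z) D"
    and "t \<in> compact_torus \<Longrightarrow> manifold_map holo_on (top_of_set P.Z) D (top_of_set P.Z) D ((*) t)"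
proof -
  define C0 :: "((complex ^ 'm) set set \<times> ((complex ^ 'm) set \<Rightarrow> complex ^ 'k)) set"
    where "C0 = {c. quotient_chart smooth_on Q.G P.U c}"
  have C0: "C0 = {c. quotient_chart (sreg False) Q.G P.U c}" by (simp add: C0_def sreg_False)
  have A_False: "quotient_chart (sreg False) P.G P.U c" if "c \<in> A" for c
    using that quotient_chart_mono[of "sreg True" P.G P.U c "sreg False"] by (auto simp: A_def sreg_def)
  have mA: "is_manifold (sreg True) P.X A" using holomorphic by (intro P.is_manifold_quotient[OF card _ A_def])
  have mC0: "is_manifold (sreg False) Q.X C0" by (rule Q.is_manifold_quotient[OF card _ C0]) simp
  have holoA: "is_manifold holo_on P.X A" by (rule is_manifold_mono[OF mA]) (simp add: sreg_True)
  have smoothA: "is_manifold smooth_on P.X A" by (rule is_manifold_mono[OF mA]) (simp add: sreg_True)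
  then show "complex_manifold P.X A" using holoA by (simp add: complex_manifold_def)
  have smoothC: "is_manifold smooth_on (top_of_set P.Z) C"
    unfolding C_def using mC0 unfolding sreg_False C0_def
    by (rule is_manifold_transport[OF _ Q.homeomorphic_rep smooth_on_cong])
  show "complex_manifold (top_of_set P.Z) D"
    unfolding complex_manifold_def D_def
    by (rule is_manifold_transport[OF holoA homeomorphic_to_Z holo_on_cong])
  have chartA: "is_chart P.X c" if "c \<in> A" for c
    by (rule quotient_chart_openin(2)) (use that in \<open>simp add: A_def\<close>)
  have openA: "openin P.X V" if "(V, \<phi>) \<in> A" for V \<phi>
    by (rule quotient_chart_openin(1)) (use that in \<open>simp add: A_def\<close>)
  have chartC0: "is_chart Q.X c" if "c \<in> C0" for c
    by (rule quotient_chart_openin(2)) (use that in \<open>simp add: C0_def\<close>)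
  have openC0: "openin Q.X V" if "(V, \<phi>) \<in> C0" for V \<phi>
    by (rule quotient_chart_openin(1)) (use that in \<open>simp add: C0_def\<close>)
  have inj_rep: "inj_on Q.rep (topspace Q.X)"
    using Q.homeomorphic_rep by (rule homeomorphic_imp_injective_map)
  have inj_to_Z: "inj_on to_Z (topspace P.X)"
    using homeomorphic_to_Z by (rule homeomorphic_imp_injective_map)
  have via_rep: "atlas_via Q.rep C0 C"
    unfolding C_def C0_def[symmetric] using openC0 openin_subset by (intro atlas_via_transport[OF inj_rep]) blast
  have via_to_Z: "atlas_via to_Z A D"
    unfolding D_def using openA openin_subset by (intro atlas_via_transport[OF inj_to_Z]) blast
  have slice_reg: "sreg False P.U P.slice" "sreg False P.U Q.slice"
    using P.tdiff_slice Q.tdiff_slice by (simp_all add: sreg_def smooth_on_def)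
  have fwd: "manifold_map smooth_on P.X A Q.X C0 transfer"
    unfolding sreg_False[symmetric]
    by (rule quotient_manifold_map[OF open_U_space open_U_space A_False _ slice_reg(1) _ transfer_orbit
          continuous_transfer]) (auto simp: C0)
  have bwd: "manifold_map smooth_on Q.X C0 P.X A S.transfer"
    unfolding sreg_False[symmetric]
    by (rule quotient_manifold_map[OF open_U_space open_U_space _ A_False slice_reg(2) _ S.transfer_orbit
          S.continuous_transfer]) (auto simp: C0)
  have "manifold_map smooth_on P.X A (top_of_set P.Z) C to_Z"
    by (rule manifold_map_via[OF fwd smooth_on_cong chartA openC0 _ atlas_via_id inj_rep via_rep])
      (simp_all add: to_Z_def[symmetric] homeomorphic_imp_continuous_map[OF homeomorphic_to_Z])
  moreover have "manifold_map smooth_on (top_of_set P.Z) C P.X A (inv_into (topspace P.X) to_Z)"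
  proof (rule manifold_map_via[OF bwd smooth_on_cong chartC0 openA inj_rep via_rep _ atlas_via_id])
    show "continuous_map (top_of_set P.Z) P.X (inv_into (topspace P.X) to_Z)"
      by (intro homeomorphic_imp_continuous_map homeomorphic_map_inv_into homeomorphic_to_Z)
    fix R assume "R \<in> topspace Q.X"
    then obtain z where z: "z \<in> P.U" "R = Q.pr z" by (auto simp: topspace_orbit_space)
    have "S.transfer R \<in> topspace P.X" using z by (simp add: S.transfer_orbit topspace_orbit_space)
    moreover have "to_Z (S.transfer R) = Q.rep R" using z transfer_forth by (simp add: to_Z_def)
    ultimately show "inv_into (topspace P.X) to_Z (Q.rep R) = S.transfer R"
      by (intro inv_into_f_eq[OF inj_to_Z])
  qed auto
  ultimately show "diffeomorphism P.X A (top_of_set P.Z) C to_Z"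
    using smoothA smoothC homeomorphic_to_Z by (simp add: diffeomorphism_def smooth_manifold_def)
  show "manifold_map holo_on (top_of_set P.Z) D (top_of_set P.Z) D ((*) t)" if t: "t \<in> compact_torus"
  proof -
    have lin: "clinear ((*) t)" by (simp add: clinear_iff vec_eq_iff algebra_simps)
    \<comment> \<open>The lift of the torus action to \<open>U\<close>; the summand \<open>0\<close>
      fits the form of \<open>sreg_affine\<close>.\<close>
    have treg: "sreg True P.U (\<lambda>z. 0 + t * z)"
      by (rule sreg_affine[OF clinear_imp_linear[OF lin] lin open_U_space])
    have contt: "continuous_map P.X P.X ((`) ((*) t))"
    proof (rule continuous_compose_quotient_map[OF P.quotient_map_orbit])
      have "continuous_map (top_of_set P.U) (top_of_set P.U) (\<lambda>z. 0 + t * z)"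
        using sreg_continuous[OF treg] P.torus_U[OF t] by auto
      then have "continuous_map (top_of_set P.U) P.X (P.pr \<circ> (\<lambda>z. 0 + t * z))"
        using P.continuous_map_orbit by (rule continuous_map_compose)
      then show "continuous_map (top_of_set P.U) P.X ((`) ((*) t) \<circ> P.pr)"
        by (rule continuous_map_eq) (simp add: P.orbit_mult)
    qed
    have "manifold_map (sreg True) P.X A P.X A ((`) ((*) t))"
      by (rule quotient_manifold_map[OF open_U_space open_U_space _ _ treg _ _ contt])
        (use P.torus_U[OF t] in \<open>auto simp: A_def P.orbit_mult\<close>)
    then have "manifold_map holo_on P.X A P.X A ((`) ((*) t))"
      by (rule manifold_map_mono) (simp add: sreg_True)
    then show ?thesis
    proof (rule manifold_map_via[OF _ holo_on_cong chartA openA inj_to_Z via_to_Z inj_to_Z via_to_Z])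
      show "t * to_Z R = to_Z ((*) t ` R)" if "R \<in> topspace P.X" for R using to_Z_torus[OF t that] by simp
      have "continuous_on P.Z (\<lambda>z. 0 + t * z)"
        using sreg_continuous[OF treg] P.Z_subset_U by (rule continuous_on_subset)
      then show "continuous_map (top_of_set P.Z) (top_of_set P.Z) ((*) t)"
        using P.torus_Z[OF t] by auto
    qed
  qed
qed

end

section \<open>The dimension count and the assembly\<close>

lemma linear_Re_vec: "linear Re_vec"
  by (intro linearI) (simp_all add: Re_vec_def vec_eq_iff)

text \<open>Rank and nullity: a right inverse of \<open>L\<close> on its range gives a complement of
  the kernel, so the kernel has the same dimension as the range of \<open>B\<close> that it
  contains.\<close>

lemma kernel_eq_range:
  fixes L :: "'a::euclidean_space \<Rightarrow> 'b::euclidean_space" and B :: "'c::euclidean_space \<Rightarrow> 'a"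
  assumes L: "linear L" and B: "linear B" "inj B" and LB: "\<And>u. L (B u) = 0"
    and dim: "DIM('a) = dim (range L) + DIM('c)"
  shows "range B = {x. L x = 0}"
proof (rule subspace_dim_equal)
  have sub: "subspace {x. L x = 0}" using linear_subspace_kernel[OF L] .
  show "subspace (range B)" using linear_subspace_image[OF B(1) subspace_UNIV] .
  show "subspace {x. L x = 0}" by (rule sub)
  show "range B \<subseteq> {x. L x = 0}" using LB by auto
  obtain g where g: "linear g" "\<And>v. v \<in> range L \<Longrightarrow> L (g v) = v"
    using linear_exists_right_inverse_on[OF L subspace_UNIV] by auto
  have subL: "subspace (range L)" using linear_subspace_image[OF L subspace_UNIV] .
  have subg: "subspace (g ` range L)" using linear_subspace_image[OF g(1) subL] .
  have "inj_on g (range L)" using g(2) by (rule inj_on_inverseI)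
  then have "inj_on g (span (range L))" using subL by (simp add: span_eq_iff[THEN iffD2])
  then have dimg: "dim (g ` range L) = dim (range L)" by (rule dim_image_eq[OF g(1)])
  have "{x + y |x y. x \<in> {x. L x = 0} \<and> y \<in> g ` range L} = UNIV"
  proof -
    have "x = (x - g (L x)) + g (L x) \<and> L (x - g (L x)) = 0" for x
      using g(2) by (simp add: linear_diff[OF L])
    then show ?thesis by blast
  qed
  moreover have "{x. L x = 0} \<inter> g ` range L = {0}"
    using g(2) linear_0[OF g(1)] linear_0[OF L] by force
  ultimately have "DIM('a) = dim {x. L x = 0} + dim (range L)"
    using dim_sums_Int[OF sub subg] dimg by simp
  moreover have "dim (range B) = DIM('c)" using dim_image_eq[OF B(1), of UNIV] B(2) by (simp add: inj_on_subset)
  ultimately show "dim {x. L x = 0} \<le> dim (range B)" using dim by simp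
qed

theorem theorem3p3:
  fixes N :: "'v::euclidean_space set"
    and \<Sigma> :: "'v set set"
    and a :: "'m::finite \<Rightarrow> 'v"
    and \<Psi> :: "complex ^ 'l::finite \<Rightarrow> complex ^ 'm"
    and K :: "'m set set"
    and U C Z :: "(complex ^ 'm) set"
  assumes "subspace N"
    and "complete_fan N \<Sigma>" and "simplicial_fan N \<Sigma>"
    and "ray_generators \<Sigma> a"
    and "K = fan_complex \<Sigma> a"
    and "CARD('m) = dim N + 2 * CARD('l)"
    and "Vector_Spaces.linear (*s) (*s) \<Psi>"
    and "inj (Re_vec \<circ> \<Psi>)"
    and "\<And>w. Lambda_R a (Re_vec (\<Psi> w)) = 0"
    and "CARD('k::finite) = CARD('m) - CARD('l)"
    and "U = U_space K" and "C = C_group \<Psi>" and "Z = moment_angle_complex K"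
  shows "holomorphic_action \<Psi> U \<and> free_action C U \<and> proper_action C U \<and>
    (\<exists>A :: ((complex ^ 'm) set set \<times> ((complex ^ 'm) set \<Rightarrow> complex ^ 'k)) set.
       compact_space (orbit_space C U) \<and>
       complex_manifold (orbit_space C U) A \<and>
       (\<forall>c\<in>A. quotient_chart holo_on C U c) \<and>
       (\<exists>f. diffeomorphism (orbit_space C U) A (top_of_set Z) (moment_angle_atlas a K) f \<and>
          (\<forall>t\<in>compact_torus. \<forall>P\<in>topspace (orbit_space C U). f ((*) t ` P) = t * f P) \<and>
          (let B = transport_atlas (topspace (orbit_space C U)) f A
           in complex_manifold (top_of_set Z) B \<and>
              (\<forall>t\<in>compact_torus. manifold_map holo_on (top_of_set Z) B (top_of_set Z) B ((*) t)))))"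
proof -
  define B where "B u = Re_vec (\<Psi> u)" for u
  \<comment> \<open>The real group written with complex entries, so that \<open>R_group a\<close>
    becomes the image of \<open>range H'\<close> under \<open>vexp\<close>.\<close>
  define H' where "H' u = (\<chi> i. complex_of_real (B u $ i))" for u
  have lin\<Psi>: "linear \<Psi>" using assms(7) by (rule clinear_imp_linear)
  have B_linear: "linear B"
    using linear_compose[OF lin\<Psi> linear_Re_vec] by (simp add: B_def[abs_def] o_def)
  have B_inj: "inj B" using assms(8) by (simp add: B_def[abs_def] o_def)
  have N0: "0 \<in> N" using assms(1) by (rule subspace_0)
  interpret F: fan_rays N \<Sigma> a K by unfold_locales (use assms in auto)
  have Lambda_N: "Lambda_R a y \<in> N" for y
    unfolding Lambda_R_def using F.generator_in[OF N0]
    by (intro subspace_sum[OF assms(1)] subspace_scale[OF assms(1)])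
  have "range (Lambda_R a) = N"
    using Lambda_N F.Lambda_surj by blast
  \<comment> \<open>The real dimension of \<open>complex ^ 'l\<close> is
    \<open>2 * CARD('l)\<close>, exactly what \<open>assms(6)\<close> leaves for the kernel.\<close>
  then have B_range: "range B = {x. Lambda_R a x = 0}"
    using assms(6,9) by (intro kernel_eq_range[OF linear_Lambda_R B_linear B_inj]) (simp_all add: B_def)
  have sd: "slice_data a K B"
  proof (rule slice_data.intro)
    show "J \<in> K" if "I \<in> K" "J \<subseteq> I" for I J using that by (rule F.K_down)
  qed (fact F.empty_in_K[OF N0] F.Lambda_inj_on F.Lambda_surj[OF Lambda_N] B_linear B_inj B_range)+
  have "linear H'"
    unfolding H'_def
    by (intro linearI) (simp_all add: vec_eq_iff linear_add[OF B_linear] linear_scale[OF B_linear] scaleR_conv_of_real[where 'a = complex])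
  then have "action_pairs a K B \<Psi> H'"
    using sd lin\<Psi> assms(7)
    by (simp add: action_pairs_def action_pairs_axioms_def action_pair_def complex_slice_action_def
        slice_action_def slice_action_axioms_def H'_def Re_vec_def B_def)
  then interpret A: action_pairs a K B \<Psi> H' .
  have U: "U = A.P.U" and Z: "Z = A.P.Z" by (simp_all add: assms(11,13))
  have C: "C = A.P.G" by (simp add: assms(12) C_group_def)
  have "vexp (H' u) = (\<chi> i. complex_of_real (vexp (B u) $ i))" for u
    by (simp add: vec_eq_iff H'_def exp_of_real)
  then have R: "R_group a = A.Q.G"
    unfolding R_group_def A.P.B_range[symmetric] by (simp add: image_comp o_def image_image)
  \<comment> \<open>The subtraction in \<open>assms(10)\<close> is not truncated, since
    \<open>assms(6)\<close> gives \<open>CARD('l) \<le> CARD('m)\<close>.\<close>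
  have card: "CARD('m) = CARD('l) + CARD('k)" using assms(6,10) by simp
  define \<A> :: "((complex ^ 'm) set set \<times> ((complex ^ 'm) set \<Rightarrow> complex ^ 'k)) set"
    where "\<A> = {c. quotient_chart (sreg True) A.P.G A.P.U c}"
  have MA: "moment_angle_atlas a K =
      transport_atlas (topspace A.Q.X) A.Q.rep {c. quotient_chart smooth_on A.Q.G A.P.U c}"
    by (simp add: moment_angle_atlas_def R topspace_orbit_space A.Q.rep_def[abs_def])
  have "holomorphic_action \<Psi> U"
    unfolding holomorphic_action_def C_group_def U
  proof (intro conjI allI ballI open_U_space A.P.group_action A.P.homeomorphic_group)
    fix w and z :: "complex ^ 'm"
    let ?D = "\<lambda>p. \<Psi> (fst p) * (vexp (\<Psi> w) * z) + vexp (\<Psi> w) * snd p"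
    have "((\<lambda>p. vexp (\<Psi> (fst p)) * snd p) has_derivative ?D) (at (w, z))"
      using A.P.act_has_derivative[OF bounded_linear_imp_has_derivative[OF bounded_linear_fst]
          bounded_linear_imp_has_derivative[OF bounded_linear_snd], of "(w, z)"]
      by (simp add: A.P.act_def)
    moreover have "?D (c *s h, c *s k) = c *s ?D (h, k)" for c h k
      using assms(7) by (simp add: clinear_iff vec_eq_iff algebra_simps)
    ultimately show "\<exists>D. ((\<lambda>(w, z). vexp (\<Psi> w) * z) has_derivative D) (at (w, z)) \<and>
        (\<forall>c h k. D (c *s h, c *s k) = c *s D (h, k))"
      unfolding case_prod_unfold by blast
  qed
  moreover have "free_action C U" "proper_action C U" "compact_space (orbit_space C U)"
    unfolding U C by (rule A.P.free A.P.proper A.P.compact_orbit_space)+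
  moreover have "quotient_chart holo_on C U c" if "c \<in> \<A>" for c
    using that quotient_chart_mono[of "sreg True" A.P.G A.P.U c holo_on]
    by (simp add: \<A>_def U C sreg_True)
  moreover note A.quotient_structures[OF card \<A>_def MA refl, folded U C Z] A.to_Z_torus[folded U C]
  ultimately show ?thesis
    unfolding Let_def by (intro conjI exI[of _ \<A>] exI[of _ A.to_Z] ballI) blast+
qed

end
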